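(* Assume that the matrix $[J_{i+1}]_{B_i}$ has been computed for some $i$ such that $1\le i\le n-1$. Then the matrix $[B_{i+1}]_{B_i}$ can be computed in $O\!\left(\binom nk\right)$ operations.
   Context: Let $0\le k\le n$ and let $X$ be the set of words $w_1\dots w_n$ in the alphabet $\{1,2\}$ with exactly $k$ letters $1$ (the word corresponds to the $k$-subset $\{j: w_j=1\}$ of $\{1,\dots,n\}$). The symmetric group $S_n$ acts on $X$ via its action on $k$-subsets. $\mathcal F$ is the space of complex functions on $X$, with $\sigma f=f\circ\sigma^{-1}$ and the inner product for which the delta functions $\delta(x)$, $x\in X$, are orthonormal. For $i\le n$, $S_i\subset S_n$ is the subgroup fixing $i+1,\dots,n$; irreducible representations of $S_i$ are indexed by Young diagrams with $i$ boxes in the usual way, and $\mathcal F_{i,\lambda}$ is the $\lambda$-isotypic component of $\mathcal F$ as an $S_i$-module. Write $\lambda\nearrow\mu$ if $\mu$ is obtained from $\lambda$ by adding one box. For Young diagrams $\lambda_1,\dots,\lambda_p$ with $\lambda_j$ having $j$ boxes, $\mathcal F_{\lambda_1\dots\lambda_p}=\mathcal F_{1,\lambda_1}\cap\dots\cap\mathcal F_{p,\lambda_p}$. For a word $c_q\dots c_n$ in $\{1,2\}$, $\mathcal F^{c_q\dots c_n}$ is the span of the $\delta(w)$ with $w\in X$, $w_q\dots w_n=c_q\dots c_n$; for $q=n+1$ (empty word) it is $\mathcal F$. Put $\mathcal F_{\lambda_1\dots\lambda_p}^{c_q\dots c_n}=\mathcal F_{\lambda_1\dots\lambda_p}\cap\mathcal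 F^{c_q\dots c_n}$ (for $p=0$ this means $\mathcal F^{c_q\dots c_n}$). For $0\le i\le n$, $\mathcal F$ is the orthogonal direct sum of the one-dimensional subspaces $\mathcal F_{\lambda_1\dots\lambda_i}^{c_{i+1}\dots c_n}$, over all words $c_{i+1}\dots c_n$ with exactly $k-r$ letters $1$ for some $0\le r\le k$, and all chains $\lambda_1\nearrow\dots\nearrow\lambda_i$ with $\lambda_i=(i-a,a)$, $0\le a\le\min(r,i-r)$. The $i$-th intermediate basis $B_i$ is the orthonormal basis, unique up to scalars, of $\mathcal F$ adapted to this decomposition, i.e. consisting of one unit vector from each of these subspaces; $B_0$ is the basis of delta functions. $[B]_{B'}$ denotes the change of basis matrix, whose columns are the elements of $B$ written in the basis $B'$; for a linear operator $T$ on $\mathcal F$, $[T]_B$ is the matrix whose columns are the images under $T$ of the elements of $B$, written in the basis $B$. The Jucys-Murphy element is $J_j=(1\,j)+(2\,j)+\dots+((j-1)\,j)\in\mathbb C[S_n]$ (with $J_1=0$), regarded as a linear operator on $\mathcal F$. Computational model: a single complex multiplication and addition counts as one operation. Only these algebraic operations are counted; operations involved in the storage of the matrices (for example reordering rows and columns of a matrix) are not counted. *)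

theory Defs
  imports
    Complex_Main
    "HOL-Library.FuncSet"
    "HOL-Library.Function_Algebras"
    "HOL-Combinatorics.Combinatorics"
begin

section \<open>Complex functions as a vector space\<close>

definition cscale :: "complex \<Rightarrow> ('a \<Rightarrow> complex) \<Rightarrow> 'a \<Rightarrow> complex" where
  "cscale c f = (\<lambda>x. c * f x)"

interpretation cfun: vector_space "cscale :: complex \<Rightarrow> ('a \<Rightarrow> complex) \<Rightarrow> 'a \<Rightarrow> complex"
  by unfold_locales (auto simp: cscale_def fun_eq_iff algebra_simps)

definition delta :: "'a \<Rightarrow> 'a \<Rightarrow> complex" where
  "delta x = (\<lambda>y. if y = x then 1 else 0)"


section \<open>Words, and the action of permutations\<close>

text \<open>
  A word \<open>w\<^sub>1\<dots>w\<^sub>n\<close> is an extensional function on \<open>{1..n}\<close>. Functions on words are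
  functions on the whole type that vanish off the words in question.
\<close>

type_synonym word = "nat \<Rightarrow> nat"

definition words :: "nat \<Rightarrow> nat \<Rightarrow> word set" where
  "words n k = {w \<in> {1..n} \<rightarrow>\<^sub>E {1, 2}. card {j \<in> {1..n}. w j = 1} = k}"

definition funs :: "nat \<Rightarrow> nat \<Rightarrow> (word \<Rightarrow> complex) set" where
  "funs n k = {f. \<forall>w. w \<notin> words n k \<longrightarrow> f w = 0}"

definition inner_funs :: "nat \<Rightarrow> nat \<Rightarrow> (word \<Rightarrow> complex) \<Rightarrow> (word \<Rightarrow> complex) \<Rightarrow> complex" where
  "inner_funs n k f g = (\<Sum>w\<in>words n k. f w * cnj (g w))"

text \<open>
  The letter of \<open>\<sigma> w\<close> at \<open>\<sigma> j\<close> is \<open>w j\<close>; this is the action on subsets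
  \<open>{j. w j = 1}\<close>.
\<close>

definition act_word :: "(nat \<Rightarrow> nat) \<Rightarrow> word \<Rightarrow> word" where
  "act_word \<sigma> w = w \<circ> inv \<sigma>"

definition act :: "(nat \<Rightarrow> nat) \<Rightarrow> (word \<Rightarrow> complex) \<Rightarrow> word \<Rightarrow> complex" where
  "act \<sigma> f = f \<circ> act_word (inv \<sigma>)"

definition jucys_murphy :: "nat \<Rightarrow> (word \<Rightarrow> complex) \<Rightarrow> word \<Rightarrow> complex" where
  "jucys_murphy j f = (\<Sum>m\<in>{1..<j}. act (transpose m j) f)"


section \<open>Young diagrams and Specht modules\<close>

text \<open>Boxes are pairs (row, column), both counted from 0.\<close>

type_synonym diagram = "(nat \<times> nat) set"

definition young_diagram :: "diagram \<Rightarrow> bool" where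
  "young_diagram \<nu> \<longleftrightarrow> finite \<nu> \<and>
     (\<forall>r c r' c'. (r, c) \<in> \<nu> \<and> r' \<le> r \<and> c' \<le> c \<longrightarrow> (r', c') \<in> \<nu>)"

definition add_box :: "diagram \<Rightarrow> diagram \<Rightarrow> bool" where
  "add_box \<nu> \<mu> \<longleftrightarrow> young_diagram \<nu> \<and> young_diagram \<mu> \<and> (\<exists>b. b \<notin> \<nu> \<and> \<mu> = insert b \<nu>)"

definition two_row :: "nat \<Rightarrow> nat \<Rightarrow> diagram" where
  "two_row p q = {0} \<times> {..<p} \<union> {1} \<times> {..<q}"

text \<open>
  A tableau \<open>t\<close> sends each entry in \<open>{1..i}\<close> to its box. A tabloid (a tableau up to
  permutations within rows) is determined by the row of each entry and is encoded as that
  function, so that \<^const>\<open>act\<close> is also the action on functions on tabloids.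
\<close>

definition tableaux :: "nat \<Rightarrow> diagram \<Rightarrow> (nat \<Rightarrow> nat \<times> nat) set" where
  "tableaux i \<nu> = {t. bij_betw t {1..i} \<nu>}"

definition tabloid :: "nat \<Rightarrow> (nat \<Rightarrow> nat \<times> nat) \<Rightarrow> word" where
  "tabloid i t = (\<lambda>j\<in>{1..i}. fst (t j))"

definition column_stabilizer :: "nat \<Rightarrow> (nat \<Rightarrow> nat \<times> nat) \<Rightarrow> (nat \<Rightarrow> nat) set" where
  "column_stabilizer i t = {\<pi>. \<pi> permutes {1..i} \<and> (\<forall>j\<in>{1..i}. snd (t (\<pi> j)) = snd (t j))}"

definition polytabloid :: "nat \<Rightarrow> (nat \<Rightarrow> nat \<times> nat) \<Rightarrow> word \<Rightarrow> complex" where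
  "polytabloid i t =
     (\<Sum>\<pi>\<in>column_stabilizer i t. cscale (of_int (sign \<pi>)) (delta (act_word \<pi> (tabloid i t))))"

definition specht :: "nat \<Rightarrow> diagram \<Rightarrow> (word \<Rightarrow> complex) set" where
  "specht i \<nu> = cfun.span (polytabloid i ` tableaux i \<nu>)"

text \<open>
  The isotypic component is the sum of all submodules isomorphic to the Specht module.
  Any linear map on the Specht module extends to the whole space of functions, hence it is
  harmless that \<open>T\<close> is linear on the whole type.
\<close>

definition iso_to_specht :: "nat \<Rightarrow> diagram \<Rightarrow> (word \<Rightarrow> complex) set \<Rightarrow> bool" where
  "iso_to_specht i \<nu> W \<longleftrightarrow>
     (\<exists>T. Vector_Spaces.linear cscale cscale T \<and> bij_betw T (specht i \<nu>) W \<and>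
          (\<forall>\<sigma> v. \<sigma> permutes {1..i} \<and> v \<in> specht i \<nu> \<longrightarrow> T (act \<sigma> v) = act \<sigma> (T v)))"

definition isotypic :: "nat \<Rightarrow> nat \<Rightarrow> nat \<Rightarrow> diagram \<Rightarrow> (word \<Rightarrow> complex) set" where
  "isotypic n k i \<nu> = cfun.span (\<Union>{W. W \<subseteq> funs n k \<and> iso_to_specht i \<nu> W})"


section \<open>Intermediate bases\<close>

text \<open>
  A label \<open>([\<nu>\<^sub>1, \<dots>, \<nu>\<^sub>i], [c\<^bsub>i+1\<^esub>, \<dots>, c\<^sub>n])\<close> names one of the one-dimensional
  subspaces. Note the shift: \<open>\<nu>\<^sub>j\<close> is the list entry at position \<open>j - 1\<close>.
\<close>

type_synonym label = "diagram list \<times> nat list"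

definition suffix_space :: "nat \<Rightarrow> nat \<Rightarrow> nat \<Rightarrow> nat list \<Rightarrow> (word \<Rightarrow> complex) set" where
  "suffix_space n k q c = cfun.span (delta ` {w \<in> words n k. map w [q..<n+1] = c})"

definition chain_space :: "nat \<Rightarrow> nat \<Rightarrow> diagram list \<Rightarrow> (word \<Rightarrow> complex) set" where
  "chain_space n k \<Lambda> = funs n k \<inter> (\<Inter>j\<in>{1..length \<Lambda>}. isotypic n k j (\<Lambda> ! (j - 1)))"

fun label_space :: "nat \<Rightarrow> nat \<Rightarrow> nat \<Rightarrow> label \<Rightarrow> (word \<Rightarrow> complex) set" where
  "label_space n k i (\<Lambda>, c) = chain_space n k \<Lambda> \<inter> suffix_space n k (i + 1) c"

definition diagram_chain :: "nat \<Rightarrow> diagram list \<Rightarrow> bool" where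
  "diagram_chain i \<Lambda> \<longleftrightarrow> length \<Lambda> = i \<and>
     (\<forall>j\<in>{1..i}. young_diagram (\<Lambda> ! (j - 1)) \<and> card (\<Lambda> ! (j - 1)) = j) \<and>
     successively add_box \<Lambda>"

text \<open>The bound \<open>a + r \<le> i\<close> is \<open>a \<le> i - r\<close> without truncated subtraction.\<close>

definition labels :: "nat \<Rightarrow> nat \<Rightarrow> nat \<Rightarrow> label set" where
  "labels n k i = {(\<Lambda>, c). diagram_chain i \<Lambda> \<and> length c = n - i \<and> set c \<subseteq> {1, 2} \<and>
     (\<exists>r a. r \<le> k \<and> count_list c 1 = k - r \<and> a \<le> r \<and> a + r \<le> i \<and>
            (\<Lambda> \<noteq> [] \<longrightarrow> last \<Lambda> = two_row (i - a) a))}"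

definition intermediate_basis :: "nat \<Rightarrow> nat \<Rightarrow> nat \<Rightarrow> (label \<Rightarrow> word \<Rightarrow> complex) \<Rightarrow> bool" where
  "intermediate_basis n k i B \<longleftrightarrow>
     (\<forall>l\<in>labels n k i. B l \<in> label_space n k i l) \<and>
     (\<forall>l\<in>labels n k i. \<forall>m\<in>labels n k i. inner_funs n k (B l) (B m) = (if l = m then 1 else 0)) \<and>
     cfun.span (B ` labels n k i) = funs n k"

text \<open>
  The matrix whose columns are the vectors \<open>V m\<close>, \<open>m \<in> M\<close>, written in the basis
  \<open>B l\<close>, \<open>l \<in> L\<close>; entries are addressed by (row, column).
\<close>

definition columns_in_basis ::
    "label set \<Rightarrow> (label \<Rightarrow> word \<Rightarrow> complex) \<Rightarrow> label set \<Rightarrow> (label \<Rightarrow> word \<Rightarrow> complex) \<Rightarrow>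
     label \<times> label \<Rightarrow> complex" where
  "columns_in_basis L B M V = (\<lambda>(l, m).
     if l \<in> L \<and> m \<in> M then cfun.representation (B ` L) (V m) (B l) else 0)"

definition operator_matrix ::
    "nat \<Rightarrow> nat \<Rightarrow> nat \<Rightarrow> (label \<Rightarrow> word \<Rightarrow> complex) \<Rightarrow>
     ((word \<Rightarrow> complex) \<Rightarrow> word \<Rightarrow> complex) \<Rightarrow> label \<times> label \<Rightarrow> complex" where
  "operator_matrix n k i B T = columns_in_basis (labels n k i) B (labels n k i) (\<lambda>l. T (B l))"

text \<open>\<open>[B']\<^sub>B\<close>, where \<open>B\<close> is an \<open>i\<close>-th and \<open>B'\<close> an \<open>i'\<close>-th intermediate basis.\<close>

definition change_matrix ::
    "nat \<Rightarrow> nat \<Rightarrow> nat \<Rightarrow> (label \<Rightarrow> word \<Rightarrow> complex) \<Rightarrow> nat \<Rightarrow> (label \<Rightarrow> word \<Rightarrow> complex) \<Rightarrow>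
     label \<times> label \<Rightarrow> complex" where
  "change_matrix n k i B i' B' = columns_in_basis (labels n k i) B (labels n k i') B'"


section \<open>Counting algebraic operations\<close>

text \<open>
  Straight-line programs over the complex numbers. One multiplication together with one addition
  is a single operation; a division and a square root (needed to normalize vectors) are charged
  one operation each. The only free constants are 0, 1 and -1: with arbitrary constants a program
  could contain the change of basis for one choice of unit vectors ready-made. Addressing
  operands and arranging the output entries is free.
\<close>

datatype 'v operand = Zero | One | Neg_One | Input 'v | Result nat

datatype 'v operation =
    Mult_Add "'v operand" "'v operand" "'v operand"
  | Divide "'v operand" "'v operand"
  | Square_Root "'v operand"

fun operand_value :: "('v \<Rightarrow> complex) \<Rightarrow> complex list \<Rightarrow> 'v operand \<Rightarrow> complex" where
  "operand_value inp rs Zero = 0"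
| "operand_value inp rs One = 1"
| "operand_value inp rs Neg_One = -1"
| "operand_value inp rs (Input v) = inp v"
| "operand_value inp rs (Result j) = (if j < length rs then rs ! j else 0)"

text \<open>
  \<^const>\<open>None\<close> signals a division by zero, so that the convention \<open>x / 0 = 0\<close> cannot be
  used as a test for zero.
\<close>

fun execute :: "('v \<Rightarrow> complex) \<Rightarrow> complex list \<Rightarrow> 'v operation list \<Rightarrow> complex list option" where
  "execute inp rs [] = Some rs"
| "execute inp rs (Mult_Add x y z # ops) =
     execute inp
       (rs @ [operand_value inp rs x * operand_value inp rs y + operand_value inp rs z]) ops"
| "execute inp rs (Divide x y # ops) =
     (if operand_value inp rs y = 0 then None
      else execute inp (rs @ [operand_value inp rs x / operand_value inp rs y]) ops)"
| "execute inp rs (Square_Root x # ops) =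
     execute inp (rs @ [csqrt (operand_value inp rs x)]) ops"

text \<open>A program is a list of operations and, for each output entry, the operand holding it.\<close>

type_synonym ('v, 'o) program = "'v operation list \<times> ('o \<Rightarrow> 'v operand)"

fun operation_count :: "('v, 'o) program \<Rightarrow> nat" where
  "operation_count (ops, out) = length ops"

fun computes :: "('v, 'o) program \<Rightarrow> ('v \<Rightarrow> complex) \<Rightarrow> 'o set \<Rightarrow> ('o \<Rightarrow> complex) \<Rightarrow> bool" where
  "computes (ops, out) inp Out res \<longleftrightarrow>
     (\<exists>rs. execute inp [] ops = Some rs \<and> (\<forall>e\<in>Out. operand_value inp rs (out e) = res e))"

end

theory Submission
  imports Defs
begin

text \<open>
  The operator \<open>J = J\<^bsub>i+1\<^esub>\<close> commutes with \<open>S\<^sub>i\<close> and preserves the letters after position \<open>i + 1\<close>,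
  so that in the basis \<open>B\<^sub>i\<close> it is block diagonal, with one block of size at most 2 for each chain
  of diagrams and each suffix. On two-letter words
  \<open>J\<^sup>2 = (i - 1) J + T\<^sub>i + i - i (i - 1) / 2\<close>, where \<open>T\<^sub>i = J\<^sub>1 + \<dots> + J\<^sub>i\<close> is the sum of the
  transpositions in \<open>S\<^sub>i\<close>, a scalar on every isotypic component. Hence the eigenvalues of a block
  are the contents of the two boxes that can be added, and its diagonal entries count letters; it
  follows that the off-diagonal entries of a block of size 2 do not vanish and that the larger
  eigenvalue belongs to the box in the first row. The eigenvectors of \<open>J\<close> are eigenvectors of
  \<open>T\<^bsub>i+1\<^esub> = T\<^sub>i + J\<close>, whose eigenvalue determines the isotypic component. Thus normalized
  eigenvectors of the blocks form an \<open>(i + 1)\<close>-th intermediate basis, and each is found with 12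
  operations.
\<close>

section \<open>Raising and lowering operators on functions on subsets\<close>

text \<open>The hard direction is from an eigenvalue to an isotypic component:
  \<open>isotypic\<close> is a span of submodules isomorphic to a Specht module, so an eigenvector
  has to be exhibited inside an explicit copy. No decomposition theory is used. With the suffix
  fixed, an eigenvector is a function on r-subsets of an m-set (m = i + 1), and the class sum is an
  affine function of \<open>up\<close> after \<open>down\<close>. Hence r - a applications of
  \<open>down\<close> lead to a function on a-subsets killed by \<open>down\<close>, which is shown
  to lie in the Specht module; r - a applications of \<open>up\<close> lead back, equivariantly and
  injectively, and the round trip is a nonzero scalar. The second constraint is uniformity: the
  program is fixed before \<open>B\<close>, whose unit vectors have arbitrary phases. So it may
  branch on labels only; these decide which blocks have size 2 and which sign a square root takes.
  The phases enter through the input matrix, and \<open>B'\<close> is the basis that the computed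
  columns describe. The model has no complex conjugation, but the product of the two off-diagonal
  entries is already a squared modulus.\<close>

definition down :: "'a set \<Rightarrow> ('a set \<Rightarrow> complex) \<Rightarrow> 'a set \<Rightarrow> complex" where
  "down N f S = (\<Sum>x\<in>N - S. f (insert x S))"

definition up :: "('a set \<Rightarrow> complex) \<Rightarrow> 'a set \<Rightarrow> complex" where
  "up f S = (\<Sum>x\<in>S. f (S - {x}))"

lemma up_down:
  assumes "finite N" "S \<subseteq> N"
  shows "up (down N f) S = of_nat (card S) * f S + (\<Sum>y\<in>S. \<Sum>x\<in>N - S. f (insert x (S - {y})))"
proof -
  have "down N f (S - {y}) = f S + (\<Sum>x\<in>N - S. f (insert x (S - {y})))" if "y \<in> S" for y
  proof -
    have "N - (S - {y}) = insert y (N - S)" using that assms by auto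
    then show ?thesis using that assms by (simp add: down_def insert_absorb)
  qed
  then show ?thesis by (simp add: up_def sum.distrib)
qed

lemma down_up:
  assumes "finite N" "S \<subseteq> N"
  shows "down N (up f) S =
    of_nat (card (N - S)) * f S + (\<Sum>y\<in>S. \<Sum>x\<in>N - S. f (insert x (S - {y})))"
proof -
  have fin: "finite S" using assms finite_subset by blast
  have "up f (insert x S) = f S + (\<Sum>y\<in>S. f (insert x (S - {y})))" if "x \<in> N - S" for x
  proof -
    have "(\<Sum>y\<in>S. f (insert x S - {y})) = (\<Sum>y\<in>S. f (insert x (S - {y})))"
      using that by (intro sum.cong refl arg_cong[of _ _ f]) auto
    moreover have "insert x S - {x} = S" using that by auto
    ultimately show ?thesis using that fin by (simp add: up_def)
  qed
  then have "down N (up f) S = (\<Sum>x\<in>N - S. f S + (\<Sum>y\<in>S. f (insert x (S - {y}))))"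
    by (simp add: down_def)
  then show ?thesis by (simp add: sum.distrib sum.swap[of _ "N - S"])
qed

text \<open>Together, \<open>up\<close> and \<open>down\<close> generate an action of \<open>sl\<^sub>2\<close>.\<close>

lemma down_up_commutator:
  assumes "finite N" "S \<subseteq> N"
  shows "down N (up f) S =
    up (down N f) S + (of_nat (card N) - 2 * of_nat (card S)) * f S"
proof -
  have "card (N - S) + card S = card N"
    using assms by (metis card_Diff_subset card_mono finite_subset le_add_diff_inverse2)
  then have "of_nat (card N) = (of_nat (card (N - S)) + of_nat (card S) :: complex)"
    by (metis of_nat_add)
  then show ?thesis by (simp add: up_down[OF assms] down_up[OF assms] algebra_simps)
qed

text \<open>Ordered pairs on the same side of \<open>S\<close>, diagonal ones included, fix
  \<open>S\<close>; every exchange of an element of \<open>S\<close> for one outside arises from two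
  ordered pairs. The last sum is the one in \<open>up_down\<close>, so this is the bridge from
  transpositions to \<open>up\<close> after \<open>down\<close>.\<close>

lemma sum_transpose_image:
  assumes "finite N" "S \<subseteq> N"
  shows "(\<Sum>x\<in>N. \<Sum>y\<in>N. f (transpose x y ` S)) =
    (of_nat (card S) ^ 2 + of_nat (card (N - S)) ^ 2) * f S +
    2 * (\<Sum>y\<in>S. \<Sum>x\<in>N - S. f (insert x (S - {y})) :: complex)"
proof -
  have fin: "finite S" using assms finite_subset by blast
  have split: "(\<Sum>x\<in>N. g x) = (\<Sum>x\<in>S. g x) + (\<Sum>x\<in>N - S. g x)" for g :: "'a \<Rightarrow> complex"
    by (metis add.commute assms sum.subset_diff)
  have same: "transpose x y ` S = S" if "x \<in> S \<longleftrightarrow> y \<in> S" for x y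
    using that by (auto simp: transpose_def image_iff split: if_splits)
  have move: "transpose x y ` S = insert y (S - {x})" "transpose y x ` S = insert y (S - {x})"
    if "x \<in> S" "y \<notin> S" for x y
    using that by (auto simp: transpose_def image_iff)
  have "(\<Sum>x\<in>S. \<Sum>y\<in>N. f (transpose x y ` S)) =
      of_nat (card S) ^ 2 * f S + (\<Sum>y\<in>S. \<Sum>x\<in>N - S. f (insert x (S - {y})))"
    by (simp add: split same move sum.distrib power2_eq_square algebra_simps)
  moreover have "(\<Sum>x\<in>N - S. \<Sum>y\<in>N. f (transpose x y ` S)) =
      of_nat (card (N - S)) ^ 2 * f S + (\<Sum>x\<in>N - S. \<Sum>y\<in>S. f (insert x (S - {y})))"
    by (simp add: split same move sum.distrib power2_eq_square algebra_simps)
  ultimately show ?thesis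
    using split[of "\<lambda>x. \<Sum>y\<in>N. f (transpose x y ` S)"]
    by (simp add: sum.swap[of _ "N - S"] algebra_simps)
qed

text \<open>The value of \<open>up \<circ> down\<close> on \<open>r\<close>-subsets of an \<open>m\<close>-set, in the isotypic component of the
  diagram \<open>(m - a, a)\<close>.\<close>

definition ladder_coeff :: "nat \<Rightarrow> nat \<Rightarrow> nat \<Rightarrow> complex" where
  "ladder_coeff m a r = (of_nat r - of_nat a) * (of_nat m - of_nat r - of_nat a + 1)"

text \<open>The condition is imposed on all sizes of \<open>S\<close> at once, with an eigenvalue
  depending on the size; in this form it is inherited by \<open>up f\<close> and
  \<open>down N f\<close>.\<close>

definition ladder_eigen :: "'a set \<Rightarrow> nat \<Rightarrow> ('a set \<Rightarrow> complex) \<Rightarrow> bool" where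
  "ladder_eigen N a f \<longleftrightarrow>
     (\<forall>S\<subseteq>N. up (down N f) S = ladder_coeff (card N) a (card S) * f S)"

lemma ladder_coeff_neq_0:
  assumes "r \<noteq> a" "r + a \<le> m"
  shows "ladder_coeff m a r \<noteq> 0"
proof -
  have "of_nat (m + 1 - r - a + r + a) = (of_nat (m + 1) :: complex)"
    using assms by (intro arg_cong[of _ _ of_nat]) simp
  then have eq: "of_nat m - of_nat r - of_nat a + (1::complex) = of_nat (m + 1 - r - a)"
    by (simp only: of_nat_add) (simp add: algebra_simps)
  have "of_nat (m + 1 - r - a) \<noteq> (0::complex)"
    using assms by (simp only: of_nat_eq_0_iff)
  then show ?thesis using assms unfolding ladder_coeff_def eq by simp
qed

text \<open>The increment is exactly the weight in \<open>down_up_commutator\<close>, which is why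
  the ladder condition survives \<open>up\<close> and \<open>down\<close>.\<close>

lemma ladder_coeff_Suc:
  "ladder_coeff m a (Suc r) = ladder_coeff m a r + (of_nat m - 2 * of_nat r)"
  by (simp add: ladder_coeff_def algebra_simps)

lemma ladder_eigen_down_up:
  assumes "finite N" "ladder_eigen N a f" "S \<subseteq> N"
  shows "down N (up f) S = ladder_coeff (card N) a (Suc (card S)) * f S"
  using assms by (simp add: down_up_commutator ladder_eigen_def ladder_coeff_Suc algebra_simps)

lemma ladder_eigen_down:
  assumes "finite N" "ladder_eigen N a f"
  shows "ladder_eigen N a (down N f)"
  unfolding ladder_eigen_def
proof (intro allI impI)
  fix S assume S: "S \<subseteq> N"
  then have fin: "finite S" using assms finite_subset by blast
  have "down N (up (down N f)) S =
      (\<Sum>x\<in>N - S. ladder_coeff (card N) a (Suc (card S)) * f (insert x S))"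
    unfolding down_def[of N "up _"]
    using assms S fin by (intro sum.cong) (auto simp: ladder_eigen_def)
  also have "\<dots> = ladder_coeff (card N) a (Suc (card S)) * down N f S"
    by (simp add: down_def sum_distrib_left)
  finally show "up (down N (down N f)) S = ladder_coeff (card N) a (card S) * down N f S"
    using down_up_commutator[OF assms(1) S, of "down N f"]
    by (simp add: ladder_coeff_Suc algebra_simps)
qed

lemma ladder_eigen_up:
  assumes "finite N" "ladder_eigen N a f"
  shows "ladder_eigen N a (up f)"
  unfolding ladder_eigen_def
proof (intro allI impI)
  fix S assume S: "S \<subseteq> N"
  then have fin: "finite S" using assms finite_subset by blast
  have "down N (up f) (S - {x}) = ladder_coeff (card N) a (card S) * f (S - {x})"
    if "x \<in> S" for x
    using ladder_eigen_down_up[OF assms, of "S - {x}"] card_Suc_Diff1[OF fin that] S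
    by (metis Diff_subset subset_trans)
  then show "up (down N (up f)) S = ladder_coeff (card N) a (card S) * up f S"
    by (simp add: up_def[of "down N _"] up_def[of f] sum_distrib_left)
qed

lemma ladder_eigen_funpow_down:
  "finite N \<Longrightarrow> ladder_eigen N a f \<Longrightarrow> ladder_eigen N a ((down N ^^ d) f)"
  by (induction d) (auto intro: ladder_eigen_down)

text \<open>Induction on the size: \<open>down N f\<close> satisfies the same condition and vanishes
  on smaller sets, so \<open>up (down N f) S\<close> is 0, while the coefficient at a size below
  \<open>a\<close> is not. Applied to \<open>down N f\<close>, it shows that the values of
  \<open>f\<close> at size \<open>a\<close> lie in the kernel of \<open>down\<close>.\<close>

lemma ladder_eigen_eq_0:
  assumes "finite N" "2 * a \<le> card N" "ladder_eigen N a f" "S \<subseteq> N" "card S < a"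
  shows "f S = 0"
  using assms(3-)
proof (induction "card S" arbitrary: S f)
  case 0
  then have "S = {}" using finite_subset[OF _ assms(1)] by simp
  then have "ladder_coeff (card N) a (card S) * f S = 0"
    using 0 by (auto simp: ladder_eigen_def up_def)
  then show ?case using ladder_coeff_neq_0[of "card S" a "card N"] 0 assms(2) by simp
next
  case (Suc r)
  have fin: "finite S" using Suc assms finite_subset by blast
  have "down N f (S - {x}) = 0" if "x \<in> S" for x
    using that fin Suc.hyps(2) Suc.prems
    by (intro Suc.hyps(1) ladder_eigen_down assms) auto
  then have "ladder_coeff (card N) a (card S) * f S = 0"
    using Suc.prems by (auto simp: ladder_eigen_def up_def)
  then show ?case using ladder_coeff_neq_0[of "card S" a "card N"] Suc.prems assms(2) by simp
qed

lemma funpow_up_funpow_down: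
  assumes "finite N" "ladder_eigen N a f" "S \<subseteq> N" "card S = a + d"
  shows "(up ^^ d) ((down N ^^ d) f) S = (\<Prod>j=1..d. ladder_coeff (card N) a (a + j)) * f S"
  using assms(2-)
proof (induction d arbitrary: f S)
  case (Suc d)
  have fin: "finite S" using Suc assms finite_subset by blast
  have "(up ^^ Suc d) ((down N ^^ Suc d) f) S =
      (\<Sum>x\<in>S. (up ^^ d) ((down N ^^ d) (down N f)) (S - {x}))"
    by (simp add: up_def[of "(up ^^ d) _"] funpow_swap1[of "down N"])
  also have "\<dots> = (\<Sum>x\<in>S. (\<Prod>j=1..d. ladder_coeff (card N) a (a + j)) * down N f (S - {x}))"
    using Suc.prems fin
    by (intro sum.cong refl Suc.IH ladder_eigen_down assms) auto
  also have "\<dots> = (\<Prod>j=1..d. ladder_coeff (card N) a (a + j)) * up (down N f) S"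
    by (simp add: up_def sum_distrib_left)
  finally show ?case using Suc.prems by (simp add: ladder_eigen_def mult_ac)
qed simp

text \<open>Each single \<open>up\<close> is injective on the ladder as long as the size reached is
  at most \<open>card N - a\<close>, because \<open>down\<close> after \<open>up\<close> multiplies
  by a nonzero coefficient there.\<close>

lemma funpow_up_eq_0:
  assumes "finite N" "ladder_eigen N a f" "a \<le> b" "b + d + a \<le> card N"
    and "\<And>S. S \<subseteq> N \<Longrightarrow> card S = b + d \<Longrightarrow> (up ^^ d) f S = 0"
    and "S \<subseteq> N" "card S = b"
  shows "f S = 0"
  using assms(2-)
proof (induction d arbitrary: f b S)
  case (Suc d)
  have fin: "finite S" using Suc.prems(5) assms(1) finite_subset by blast
  have "up f (insert x S) = 0" if "x \<in> N - S" for x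
  proof (rule Suc.IH[where b = "Suc b"])
    show "ladder_eigen N a (up f)" by (rule ladder_eigen_up[OF assms(1) Suc.prems(1)])
    show "(up ^^ d) (up f) U = 0" if "U \<subseteq> N" "card U = Suc b + d" for U
      using Suc.prems(4)[of U] that by (simp add: funpow_swap1)
  qed (use that Suc.prems(2,3,5,6) fin in auto)
  then have "ladder_coeff (card N) a (Suc b) * f S = 0"
    using ladder_eigen_down_up[OF assms(1) Suc.prems(1) Suc.prems(5)] Suc.prems(6)
    by (simp add: down_def)
  then show ?case using ladder_coeff_neq_0[of "Suc b" a "card N"] Suc.prems(2,3) by simp
qed simp

text \<open>This allows a function defined on all sizes to be replaced by its truncation to one size
  before \<open>up\<close> is applied.\<close>

lemma funpow_up_cong:
  assumes "\<And>S. S \<subseteq> N \<Longrightarrow> card S = b \<Longrightarrow> f S = g S" "finite N" "S \<subseteq> N" "card S = b + d"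
  shows "(up ^^ d) f S = (up ^^ d) g S"
  using assms(3-)
proof (induction d arbitrary: S)
  case (Suc d)
  have fin: "finite S" using Suc.prems(1) assms(2) finite_subset by blast
  have "(up ^^ d) f (S - {x}) = (up ^^ d) g (S - {x})" if "x \<in> S" for x
    using that fin Suc.prems by (intro Suc.IH) auto
  then show ?case by (simp add: up_def[of "(up ^^ d) _"])
qed (use assms in auto)

lemma funpow_up_image:
  assumes "inj \<sigma>"
  shows "(up ^^ d) (\<lambda>S. f (\<sigma> ` S)) S = (up ^^ d) f (\<sigma> ` S)"
proof (induction d arbitrary: S)
  case (Suc d)
  have "\<sigma> ` (S - {x}) = \<sigma> ` S - {\<sigma> x}" for x
    using assms by (auto simp: inj_def)
  then have "up ((up ^^ d) f) (\<sigma> ` S) = (\<Sum>x\<in>S. (up ^^ d) f (\<sigma> ` (S - {x})))"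
    using assms by (simp add: up_def sum.reindex inj_on_subset[OF _ subset_UNIV])
  then show ?case using Suc by (simp add: up_def[of "(up ^^ d) (\<lambda>S. f (\<sigma> ` S))"])
qed simp

lemma funpow_up_linear:
  "(up ^^ d) (\<lambda>S. c * f S + g S) S = c * (up ^^ d) f S + (up ^^ d) g S"
proof (induction d arbitrary: S)
  case (Suc d)
  then show ?case by (simp add: up_def[of "(up ^^ d) _"] sum.distrib sum_distrib_left)
qed simp

text \<open>A function \<open>H\<close> invariant under the stabilizer of \<open>S0\<close> depends on \<open>Q\<close> only through
  \<open>card (Q - S0)\<close>, and the kernel condition becomes a two-term recurrence whose solution
  alternates in sign.\<close>

lemma spherical_eq:
  assumes "finite N" "S0 \<subseteq> N" "card S0 = a"
    and inv: "\<And>x y Q. x \<in> N \<Longrightarrow> y \<in> N \<Longrightarrow> (x \<in> S0 \<longleftrightarrow> y \<in> S0) \<Longrightarrow> Q \<subseteq> N \<Longrightarrow>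
               H (transpose x y ` Q) = H Q"
    and ker: "\<And>R. R \<subseteq> N \<Longrightarrow> Suc (card R) = a \<Longrightarrow> down N H R = 0"
    and "Q \<subseteq> N" "card Q = a" "card (Q - S0) = j"
  shows "H Q = (- 1) ^ j * H S0 / of_nat ((card N - a) choose j)"
  using assms(6-)
proof (induction j arbitrary: Q)
  case 0
  have "finite Q" "finite S0" using 0 assms(1,2) finite_subset by blast+
  then have "Q \<subseteq> S0" using 0 by auto
  then have "Q = S0" using 0 assms(3) \<open>finite S0\<close> by (metis card_subset_eq)
  then show ?case by simp
next
  case (Suc j)
  have fin: "finite Q" "finite S0" using Suc.prems(1) assms(1,2) finite_subset by blast+
  from Suc.prems(3) obtain x0 where x0: "x0 \<in> Q" "x0 \<notin> S0"
    by (metis card.empty Diff_iff all_not_in_conv nat.distinct(1))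
  \<comment> \<open>The kernel condition at \<open>R\<close> involves completions by elements of
    \<open>S0\<close>, which have \<open>j\<close> elements outside \<open>S0\<close>, and
    completions by other elements, which have \<open>Suc j\<close> and all share the value
    \<open>H Q\<close>.\<close>
  define R where "R = Q - {x0}"
  have Q: "Q = insert x0 R" "x0 \<notin> R" using x0 by (auto simp: R_def)
  have cR: "Suc (card R) = a" using Q fin Suc.prems by auto
  have RN: "R \<subseteq> N" "finite R" using Suc.prems fin by (auto simp: R_def)
  have "Q - S0 = insert x0 (R - S0)" "x0 \<notin> R - S0" using Q x0 by auto
  then have cRS: "card (R - S0) = j" using Suc.prems(3) RN by simp
  have "card R = card (R - S0) + card (R \<inter> S0)"
    using RN by (metis add.commute card_Int_Diff)
  moreover have "card S0 = card (S0 - R) + card (R \<inter> S0)"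
    using fin by (metis add.commute card_Int_Diff inf_commute)
  ultimately have c1: "card (S0 - R) = Suc j" using cR cRS assms(3) by simp
  have "card (N - S0) = card (N - S0 - R) + card ((N - S0) \<inter> R)"
    using assms(1) by (metis add.commute card_Int_Diff finite_Diff)
  moreover have "(N - S0) \<inter> R = R - S0" using RN by auto
  ultimately have c2: "card N - a = card (N - S0 - R) + j"
    using cRS assms(1-3) by (simp add: card_Diff_subset fin)
  have "x0 \<in> N - S0 - R" using Q Suc.prems x0 by auto
  then have pos: "card (N - S0 - R) > 0" using assms(1) card_gt_0_iff by blast
  have "N - R = (S0 - R) \<union> (N - S0 - R)" using assms(2) by auto
  then have "down N H R = (\<Sum>x\<in>S0 - R. H (insert x R)) + (\<Sum>x\<in>N - S0 - R. H (insert x R))"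
    using fin assms(1) by (simp only: down_def) (rule sum.union_disjoint, auto)
  moreover have "H (insert x R) = (- 1) ^ j * H S0 / of_nat ((card N - a) choose j)"
    if "x \<in> S0 - R" for x
  proof (rule Suc.IH)
    have "insert x R - S0 = R - S0" using that by auto
    then show "card (insert x R - S0) = j" using cRS by simp
  qed (use that RN cR assms(2) in auto)
  moreover have "H (insert x R) = H Q" if "x \<in> N - S0 - R" for x
  proof -
    have "transpose x x0 ` Q = insert x R"
      using that Q by (auto simp: transpose_def image_iff)
    then show ?thesis using inv[of x x0 Q] that x0 Suc.prems by auto
  qed
  ultimately have "of_nat (card (N - S0 - R)) * H Q +
      of_nat (Suc j) * ((- 1) ^ j * H S0 / of_nat ((card N - a) choose j)) = 0"
    using ker[OF RN(1) cR] c1 by (simp add: add.commute del: of_nat_Suc)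
  then have eq: "of_nat (card (N - S0 - R)) * H Q =
      - of_nat (Suc j) * ((- 1) ^ j * H S0 / of_nat ((card N - a) choose j))"
    by (simp only: eq_neg_iff_add_eq_0 mult_minus_left)
  define p where "p = card (N - S0 - R)"
  \<comment> \<open>Here \<open>p + j\<close> is \<open>card N - a\<close>. The recurrence says that
    \<open>p\<close> times the value at distance \<open>j + 1\<close> is \<open>-(j + 1)\<close>
    times the value at distance \<open>j\<close>; absorption identifies \<open>(j + 1) / p\<close>
    as a ratio of consecutive binomial coefficients.\<close>
  have bin: "of_nat (Suc j) * of_nat ((p + j) choose Suc j) =
      (of_nat p * of_nat ((p + j) choose j) :: complex)"
  proof -
    have "Suc j * ((p + j) choose Suc j) = (p + j) * ((p + j - 1) choose j)"
      by (rule binomial_absorption)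
    also have "\<dots> = (p + j - j) * ((p + j) choose j)"
      by (rule binomial_absorb_comp[symmetric])
    finally show ?thesis by (simp only: of_nat_mult[symmetric] add_diff_cancel_right')
  qed
  have nz: "of_nat p \<noteq> (0::complex)" "of_nat ((p + j) choose j) \<noteq> (0::complex)"
    using pos by (auto simp: p_def[symmetric])
  from eq have "H Q = - of_nat (Suc j) * ((- 1) ^ j * H S0 / of_nat ((p + j) choose j)) / of_nat p"
    unfolding c2 p_def[symmetric] using nz(1) by (metis nonzero_mult_div_cancel_left)
  also have "\<dots> = of_nat (Suc j) * ((- 1) ^ Suc j * H S0) / (of_nat p * of_nat ((p + j) choose j))"
    by (simp add: mult.commute del: of_nat_Suc)
  also have "\<dots> = (- 1) ^ Suc j * H S0 / of_nat ((p + j) choose Suc j)"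
    by (simp only: bin[symmetric]) (rule nonzero_mult_divide_mult_cancel_left, simp del: of_nat_Suc)
  finally show ?case unfolding c2 p_def[symmetric] .
qed

section \<open>Jucys-Murphy elements\<close>

lemma sum_fun_apply: "(\<Sum>x\<in>A. F x) w = (\<Sum>x\<in>A. F x w)"
  for F :: "'a \<Rightarrow> 'b \<Rightarrow> 'c::comm_monoid_add"
  by (induction A rule: infinite_finite_induct) auto

lemma cscale_apply: "cscale c f x = c * f x"
  by (simp add: cscale_def)

lemma act_apply: "bij \<sigma> \<Longrightarrow> act \<sigma> f w = f (w \<circ> \<sigma>)"
  by (simp add: act_def act_word_def inv_inv_eq)

lemma jucys_murphy_apply: "jucys_murphy j f w = (\<Sum>m\<in>{1..<j}. f (w \<circ> transpose m j))"
  by (simp add: jucys_murphy_def sum_fun_apply act_apply)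

text \<open>The sum of all transpositions of the first \<open>m\<close> positions, arranged so that
  passing to \<open>Suc m\<close> adds one Jucys-Murphy element.\<close>

definition class_sum :: "nat \<Rightarrow> (word \<Rightarrow> complex) \<Rightarrow> word \<Rightarrow> complex" where
  "class_sum m f = (\<Sum>j\<in>{1..m}. jucys_murphy j f)"

lemma class_sum_Suc: "class_sum (Suc m) f = class_sum m f + jucys_murphy (Suc m) f"
  by (simp add: class_sum_def)

text \<open>Ordered pairs count every transposition twice and the identity \<open>m\<close> times.
  Unlike the triangular sum over x < y, this range is visibly stable under relabelling.\<close>

lemma sum_transpose_word:
  "(\<Sum>x\<in>{1..m}. \<Sum>y\<in>{1..m}. f (w \<circ> transpose x y)) = 2 * class_sum m f w + of_nat m * f w"
proof (induction m)
  case (Suc m)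
  have J: "(\<Sum>x\<in>{Suc 0..m}. f (w \<circ> transpose x (Suc m))) = jucys_murphy (Suc m) f w"
    by (simp add: jucys_murphy_apply atLeastLessThanSuc_atLeastAtMost)
  have "(\<Sum>x\<in>{1..Suc m}. \<Sum>y\<in>{1..Suc m}. f (w \<circ> transpose x y)) =
      (\<Sum>x\<in>{1..m}. \<Sum>y\<in>{1..m}. f (w \<circ> transpose x y)) + 2 * jucys_murphy (Suc m) f w + f w"
    by (simp add: sum.distrib J transpose_commute[of "Suc m"])
  also have "\<dots> = 2 * class_sum (Suc m) f w + of_nat (Suc m) * f w"
    unfolding Suc.IH class_sum_Suc plus_fun_apply by (simp add: algebra_simps)
  finally show ?case .
qed (simp add: class_sum_def)

lemma transpose_comp_perm: "inj \<sigma> \<Longrightarrow> transpose (\<sigma> x) (\<sigma> y) \<circ> \<sigma> = \<sigma> \<circ> transpose x y"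
  by (auto simp: fun_eq_iff transpose_def inj_eq)

text \<open>Conjugation by \<open>\<sigma>\<close> only relabels the ordered pairs of
  positions.\<close>

lemma class_sum_act:
  assumes "\<sigma> permutes {1..m}"
  shows "class_sum m (act \<sigma> f) = act \<sigma> (class_sum m f)"
proof
  fix w
  have bij: "bij \<sigma>" and inj: "inj \<sigma>"
    using assms permutes_bij permutes_inj by blast+
  have "(\<Sum>x\<in>{1..m}. \<Sum>y\<in>{1..m}. act \<sigma> f (w \<circ> transpose x y)) =
      (\<Sum>x\<in>{1..m}. \<Sum>y\<in>{1..m}. f (w \<circ> transpose (\<sigma> x) (\<sigma> y) \<circ> \<sigma>))"
    unfolding act_apply[OF bij]
    by (subst sum.permute[OF assms], intro sum.cong refl, subst sum.permute[OF assms])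
       (simp add: o_def)
  also have "\<dots> = (\<Sum>x\<in>{1..m}. \<Sum>y\<in>{1..m}. f (w \<circ> \<sigma> \<circ> transpose x y))"
    by (simp add: comp_assoc transpose_comp_perm[OF inj])
  finally have "2 * class_sum m (act \<sigma> f) w + of_nat m * act \<sigma> f w =
      2 * class_sum m f (w \<circ> \<sigma>) + of_nat m * f (w \<circ> \<sigma>)"
    unfolding sum_transpose_word .
  then show "class_sum m (act \<sigma> f) w = act \<sigma> (class_sum m f) w"
    by (simp add: act_apply[OF bij])
qed

lemma act_add: "act \<sigma> (f + g) = act \<sigma> f + act \<sigma> g"
  by (simp add: act_def fun_eq_iff)

lemma jucys_murphy_add: "jucys_murphy j (f + g) = jucys_murphy j f + jucys_murphy j g"
  by (simp add: fun_eq_iff jucys_murphy_apply sum.distrib)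

lemma jucys_murphy_cscale: "jucys_murphy j (cscale c f) = cscale c (jucys_murphy j f)"
  by (simp add: fun_eq_iff jucys_murphy_apply cscale_apply sum_distrib_left)

lemma jucys_murphy_zero: "jucys_murphy j 0 = 0"
  by (simp add: fun_eq_iff jucys_murphy_apply)

lemma jucys_murphy_sum: "jucys_murphy j (\<Sum>x\<in>A. F x) = (\<Sum>x\<in>A. jucys_murphy j (F x))"
  by (induction A rule: infinite_finite_induct)
    (simp_all only: not_False_eq_True sum.infinite sum.empty sum.insert jucys_murphy_add jucys_murphy_zero)

lemma class_sum_add: "class_sum j (f + g) = class_sum j f + class_sum j g"
  by (simp add: class_sum_def jucys_murphy_add sum.distrib)

lemma class_sum_cscale: "class_sum j (cscale c f) = cscale c (class_sum j f)"
  by (simp add: class_sum_def jucys_murphy_cscale cfun.scale_sum_right)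

lemma class_sum_zero: "class_sum j 0 = 0"
  by (simp add: class_sum_def jucys_murphy_zero)

lemma class_sum_sum: "class_sum j (\<Sum>x\<in>A. F x) = (\<Sum>x\<in>A. class_sum j (F x))"
  by (induction A rule: infinite_finite_induct)
    (simp_all only: not_False_eq_True sum.infinite sum.empty sum.insert class_sum_add class_sum_zero)

text \<open>The Jucys-Murphy element is the difference of two consecutive class sums, and both
  commute with permutations of the first \<open>m\<close> positions.\<close>

lemma jucys_murphy_act:
  assumes "\<sigma> permutes {1..m}"
  shows "jucys_murphy (Suc m) (act \<sigma> f) = act \<sigma> (jucys_murphy (Suc m) f)"
proof -
  have "\<sigma> permutes {1..Suc m}" using assms by (rule permutes_subset) auto
  from class_sum_act[OF this, of f] show ?thesis
    by (simp add: class_sum_Suc act_add class_sum_act[OF assms])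
qed

lemma class_sum_jucys_murphy:
  assumes "j \<le> m"
  shows "class_sum j (jucys_murphy (Suc m) f) = jucys_murphy (Suc m) (class_sum j f)"
proof -
  have "act (transpose x y) (jucys_murphy (Suc m) f) = jucys_murphy (Suc m) (act (transpose x y) f)"
    if "y \<in> {1..j}" "x \<in> {1..<y}" for x y
    using that assms by (intro jucys_murphy_act[symmetric] permutes_swap_id) auto
  then have "class_sum j (jucys_murphy (Suc m) f) =
      (\<Sum>y\<in>{1..j}. \<Sum>x\<in>{1..<y}. jucys_murphy (Suc m) (act (transpose x y) f))"
    unfolding class_sum_def jucys_murphy_def[of _ "jucys_murphy (Suc m) f"]
    by (intro sum.cong refl) blast
  also have "\<dots> = jucys_murphy (Suc m) (class_sum j f)"
    by (simp only: class_sum_def jucys_murphy_sum[of "Suc m"] jucys_murphy_def[of _ f])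
  finally show ?thesis .
qed

text \<open>The antisymmetrizer of three positions vanishes on words in two letters.\<close>

lemma two_letter_relation:
  assumes "w x \<in> {1, 2}" "w y \<in> {1, 2}" "w z \<in> {1, 2}" "x \<noteq> y" "x \<noteq> z" "y \<noteq> z"
  shows "f (w \<circ> transpose x z \<circ> transpose y z) + f (w \<circ> transpose y z \<circ> transpose x z) + f w =
    f (w \<circ> transpose x y) + f (w \<circ> transpose x z) + (f (w \<circ> transpose y z) :: complex)"
proof -
  consider "w x = w y" | "w x = w z" | "w y = w z" using assms by auto
  then show ?thesis
  proof cases
    case 1
    have "w \<circ> transpose x z \<circ> transpose y z = w \<circ> transpose x z"
      "w \<circ> transpose y z \<circ> transpose x z = w \<circ> transpose y z" "w \<circ> transpose x y = w"
      using 1 assms by (auto simp: fun_eq_iff transpose_def)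
    then show ?thesis by (simp add: algebra_simps)
  next
    case 2
    have "w \<circ> transpose x z \<circ> transpose y z = w \<circ> transpose y z"
      "w \<circ> transpose y z \<circ> transpose x z = w \<circ> transpose x y" "w \<circ> transpose x z = w"
      using 2 assms by (auto simp: fun_eq_iff transpose_def)
    then show ?thesis by (simp add: algebra_simps)
  next
    case 3
    have "w \<circ> transpose x z \<circ> transpose y z = w \<circ> transpose x y"
      "w \<circ> transpose y z \<circ> transpose x z = w \<circ> transpose x z" "w \<circ> transpose y z = w"
      using 3 assms by (auto simp: fun_eq_iff transpose_def)
    then show ?thesis by (simp add: algebra_simps)
  qed
qed

text \<open>The square is a sum of products (x z)(y z) over ordered pairs; adding it to itself with
  the factors in the other order makes \<open>two_letter_relation\<close> applicable, which leaves
  single transpositions: those avoiding z give the class sum, the others the Jucys-Murphy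
  element.\<close>

lemma jucys_murphy_square:
  assumes "\<And>x. x \<in> {1..Suc i} \<Longrightarrow> w x \<in> {1, 2}"
  shows "2 * jucys_murphy (Suc i) (jucys_murphy (Suc i) f) w =
    2 * class_sum i f w + (2 * of_nat i - 2) * jucys_murphy (Suc i) f w +
    (3 * of_nat i - of_nat i ^ 2) * f w"
proof -
  define z where "z = Suc i"
  have I: "{Suc 0..<z} = {Suc 0..i}" by (auto simp: z_def)
  define A where "A = jucys_murphy z (jucys_murphy z f) w"
  define J where "J = jucys_murphy z f w"
  have A1: "A = (\<Sum>x\<in>{1..i}. \<Sum>y\<in>{1..i}. f (w \<circ> transpose x z \<circ> transpose y z))"
    by (simp add: A_def jucys_murphy_apply I)
  then have A2: "A = (\<Sum>x\<in>{1..i}. \<Sum>y\<in>{1..i}. f (w \<circ> transpose y z \<circ> transpose x z))"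
    by (subst sum.swap)
  have J1: "J = (\<Sum>x\<in>{1..i}. f (w \<circ> transpose x z))"
    by (simp add: J_def jucys_murphy_apply I)
  \<comment> \<open>For x = y the three positions are not distinct and the relation fails; the
    \<open>if\<close> term is the discrepancy.\<close>
  have rel: "f (w \<circ> transpose x z \<circ> transpose y z) + f (w \<circ> transpose y z \<circ> transpose x z) + f w =
      f (w \<circ> transpose x y) + f (w \<circ> transpose x z) + f (w \<circ> transpose y z) +
      (if y = x then 2 * f w - 2 * f (w \<circ> transpose x z) else 0)"
    if "x \<in> {1..i}" "y \<in> {1..i}" for x y
  proof (cases "x = y")
    case True
    then show ?thesis by (simp add: comp_assoc)
  next
    case False
    then show ?thesis using two_letter_relation[of w x y z f] assms that by (auto simp: z_def)
  qed
  have "(\<Sum>x\<in>{1..i}. \<Sum>y\<in>{1..i}.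
        f (w \<circ> transpose x z \<circ> transpose y z) + f (w \<circ> transpose y z \<circ> transpose x z) + f w) =
      (\<Sum>x\<in>{1..i}. \<Sum>y\<in>{1..i}.
        f (w \<circ> transpose x y) + f (w \<circ> transpose x z) + f (w \<circ> transpose y z) +
        (if y = x then 2 * f w - 2 * f (w \<circ> transpose x z) else 0))"
    using rel by (intro sum.cong refl) blast
  then have "A + A + of_nat i * (of_nat i * f w) =
      2 * class_sum i f w + of_nat i * f w + of_nat i * J + of_nat i * J + (of_nat i * (2 * f w) - 2 * J)"
    by (simp add: sum.distrib sum_subtractf sum_distrib_left[symmetric]
        A1[unfolded One_nat_def, symmetric] A2[unfolded One_nat_def, symmetric]
        J1[unfolded One_nat_def, symmetric] sum_transpose_word[unfolded One_nat_def])
  then show ?thesis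
    unfolding A_def[symmetric] J_def[symmetric] z_def[symmetric]
    by (simp add: algebra_simps power2_eq_square)
qed

lemma words_comp:
  assumes "w \<in> words n k" "\<sigma> permutes {1..n}"
  shows "w \<circ> \<sigma> \<in> words n k"
proof -
  have "\<sigma> ` {j \<in> {1..n}. w (\<sigma> j) = 1} = {j \<in> {1..n}. w j = 1}" (is "\<sigma> ` ?A = ?B")
  proof
    show "\<sigma> ` ?A \<subseteq> ?B" using permutes_in_image[OF assms(2)] by auto
    show "?B \<subseteq> \<sigma> ` ?A"
    proof
      fix j assume "j \<in> ?B"
      then show "j \<in> \<sigma> ` ?A"
        using permutes_in_image[OF permutes_inv[OF assms(2)]] permutes_inverses(1)[OF assms(2)]
        by (intro image_eqI[of _ _ "inv \<sigma> j"]) auto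
    qed
  qed
  then have "bij_betw \<sigma> {j \<in> {1..n}. w (\<sigma> j) = 1} {j \<in> {1..n}. w j = 1}"
    using permutes_inj_on[OF assms(2)] by (auto simp: bij_betw_def)
  then have "card {j \<in> {1..n}. w (\<sigma> j) = 1} = card {j \<in> {1..n}. w j = 1}"
    by (rule bij_betw_same_card)
  moreover have "w \<circ> \<sigma> \<in> {1..n} \<rightarrow>\<^sub>E {1, 2}"
    using assms permutes_in_image[OF assms(2)] permutes_not_in[OF assms(2)]
    by (auto simp: words_def PiE_iff extensional_def)
  ultimately show ?thesis using assms(1) by (simp add: words_def)
qed

lemma finite_words: "finite (words n k)"
  unfolding words_def by (rule finite_subset[OF _ finite_PiE[of "{1..n}" "\<lambda>_. {1, 2}"]]) auto

lemma card_words: "card (words n k) = n choose k"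
proof -
  have "bij_betw (\<lambda>w. {j \<in> {1..n}. w j = 1}) (words n k) {S. S \<subseteq> {1..n} \<and> card S = k}"
  proof (rule bij_betw_byWitness[where f' = "\<lambda>S. \<lambda>j\<in>{1..n}. if j \<in> S then 1 else 2"])
    show "\<forall>w\<in>words n k. (\<lambda>j\<in>{1..n}. if j \<in> {j \<in> {1..n}. w j = 1} then 1 else 2) = w"
      by (fastforce simp: words_def PiE_iff extensional_def fun_eq_iff)
    show "\<forall>S\<in>{S. S \<subseteq> {1..n} \<and> card S = k}.
        {j \<in> {1..n}. (\<lambda>j\<in>{1..n}. if j \<in> S then 1 else 2::nat) j = 1} = S"
      by auto
    have "{j \<in> {1..n}. (\<lambda>j\<in>{1..n}. if j \<in> S then 1 else 2::nat) j = 1} = S" if "S \<subseteq> {1..n}" for S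
      using that by auto
    then show "(\<lambda>S. \<lambda>j\<in>{1..n}. if j \<in> S then 1 else 2) ` {S. S \<subseteq> {1..n} \<and> card S = k}
        \<subseteq> words n k"
      by (auto simp: words_def)
    show "(\<lambda>w. {j \<in> {1..n}. w j = 1}) ` words n k \<subseteq> {S. S \<subseteq> {1..n} \<and> card S = k}"
      by (auto simp: words_def)
  qed
  then show ?thesis using n_subsets[of "{1..n}" k] by (simp add: bij_betw_same_card)
qed

section \<open>Polytabloids of diagrams with two rows\<close>

text \<open>The tabloid of a diagram with two rows whose second row is \<open>S\<close>.\<close>

definition chi :: "nat \<Rightarrow> nat set \<Rightarrow> word" where
  "chi m S = (\<lambda>j\<in>{1..m}. if j \<in> S then 1 else 0)"

text \<open>The sum of the contents of a diagram with rows of lengths \<open>p\<close> and \<open>q\<close>.\<close>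

definition content_sum :: "nat \<Rightarrow> nat \<Rightarrow> complex" where
  "content_sum p q = (of_nat p * (of_nat p - 1) + of_nat q * (of_nat q - 3)) / 2"

lemma two_content_sum:
  "2 * content_sum p q = of_nat p ^ 2 + of_nat q ^ 2 - of_nat p - 3 * of_nat q"
  by (simp add: content_sum_def field_simps power2_eq_square)

lemma chi_comp:
  assumes "\<sigma> permutes {1..m}"
  shows "chi m S \<circ> \<sigma> = chi m (inv \<sigma> ` S)"
proof
  fix j
  have "\<sigma> j \<in> S \<longleftrightarrow> j \<in> inv \<sigma> ` S"
    using permutes_inverses[OF assms] by (metis image_iff)
  moreover have "\<sigma> j \<in> {1..m} \<longleftrightarrow> j \<in> {1..m}" by (rule permutes_in_image[OF assms])
  ultimately show "(chi m S \<circ> \<sigma>) j = chi m (inv \<sigma> ` S) j"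
    by (simp add: chi_def)
qed

lemma inv_transpose: "inv (transpose x y) = transpose x y"
  by (rule inv_equality) auto

lemma transpose_permutes: "x \<in> A \<Longrightarrow> y \<in> A \<Longrightarrow> transpose x y permutes A"
  by (rule permutes_swap_id)

lemma chi_transpose:
  assumes "x \<in> {1..m}" "y \<in> {1..m}"
  shows "chi m S \<circ> transpose x y = chi m (transpose x y ` S)"
  by (simp only: chi_comp[OF transpose_permutes[OF assms]] inv_transpose)

lemma sum_swap3:
  "(\<Sum>x\<in>A. \<Sum>y\<in>B. \<Sum>z\<in>C. f x y z) = (\<Sum>z\<in>C. \<Sum>x\<in>A. \<Sum>y\<in>B. f x y z)"
proof -
  have "(\<Sum>x\<in>A. \<Sum>y\<in>B. \<Sum>z\<in>C. f x y z) = (\<Sum>x\<in>A. \<Sum>z\<in>C. \<Sum>y\<in>B. f x y z)"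
    by (intro sum.cong refl sum.swap)
  also have "\<dots> = (\<Sum>z\<in>C. \<Sum>x\<in>A. \<Sum>y\<in>B. f x y z)" by (rule sum.swap)
  finally show ?thesis .
qed

lemma sum_permute2:
  assumes "\<pi> permutes A"
  shows "(\<Sum>x\<in>A. \<Sum>y\<in>A. f (\<pi> x) (\<pi> y)) = (\<Sum>x\<in>A. \<Sum>y\<in>A. f x y)"
proof -
  have "(\<Sum>y\<in>A. f (\<pi> x) (\<pi> y)) = (\<Sum>y\<in>A. f (\<pi> x) y)" for x
    using sum.permute[OF assms, of "f (\<pi> x)"] by (simp add: o_def)
  then show ?thesis
    using sum.permute[OF assms, of "\<lambda>x. \<Sum>y\<in>A. f x y"] by (simp add: o_def)
qed

text \<open>The column antisymmetrizer of \<open>t\<close> applied to an arbitrary row assignment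
  \<open>u\<close>. Polytabloids are the case \<open>u = tabloid m t\<close>; the general case is
  needed because a transposition moves the tabloid while the columns stay those of
  \<open>t\<close>.\<close>

definition column_sum :: "nat \<Rightarrow> (nat \<Rightarrow> nat \<times> nat) \<Rightarrow> word \<Rightarrow> word \<Rightarrow> complex" where
  "column_sum m t u w =
     (\<Sum>\<pi>\<in>column_stabilizer m t. of_int (sign \<pi>) * (if w = u \<circ> \<pi> then 1 else 0))"

lemma column_stabilizer_permutes: "\<pi> \<in> column_stabilizer m t \<Longrightarrow> \<pi> permutes {1..m}"
  by (simp add: column_stabilizer_def)

lemma column_stabilizer_comp:
  assumes "\<pi> \<in> column_stabilizer m t" "\<rho> \<in> column_stabilizer m t"
  shows "\<pi> \<circ> \<rho> \<in> column_stabilizer m t"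
  using assms permutes_in_image[of \<rho> "{1..m}"]
  by (auto simp: column_stabilizer_def intro: permutes_compose)

lemma column_stabilizer_inv:
  assumes "\<pi> \<in> column_stabilizer m t"
  shows "inv \<pi> \<in> column_stabilizer m t"
proof -
  have perm: "\<pi> permutes {1..m}" using assms by (rule column_stabilizer_permutes)
  have "snd (t (inv \<pi> j)) = snd (t j)" if "j \<in> {1..m}" for j
  proof -
    have "inv \<pi> j \<in> {1..m}" using permutes_in_image[OF permutes_inv[OF perm]] that by blast
    then have "snd (t (\<pi> (inv \<pi> j))) = snd (t (inv \<pi> j))"
      using assms by (auto simp: column_stabilizer_def)
    then show ?thesis by (simp add: permutes_inverses(1)[OF perm])
  qed
  then show ?thesis using permutes_inv[OF perm] by (simp add: column_stabilizer_def)
qed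

lemma column_stabilizer_transpose:
  assumes "x \<in> {1..m}" "y \<in> {1..m}" "snd (t x) = snd (t y)"
  shows "transpose x y \<in> column_stabilizer m t"
  using assms transpose_permutes[OF assms(1,2)]
  by (auto simp: column_stabilizer_def transpose_def)

lemma id_column_stabilizer: "id \<in> column_stabilizer m t"
  by (simp add: column_stabilizer_def permutes_id)

lemma finite_column_stabilizer: "finite (column_stabilizer m t)"
  by (rule finite_subset[OF _ finite_permutations[of "{1..m}"]]) (auto simp: column_stabilizer_def)

lemma column_stabilizer_permutation: "\<pi> \<in> column_stabilizer m t \<Longrightarrow> permutation \<pi>"
  using column_stabilizer_permutes permutation_permutes finite_atLeastAtMost by blast

lemma bij_betw_column_stabilizer_comp:
  assumes "\<tau> \<in> column_stabilizer m t"
  shows "bij_betw ((\<circ>) \<tau>) (column_stabilizer m t) (column_stabilizer m t)"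
proof (rule bij_betw_byWitness[where f' = "(\<circ>) (inv \<tau>)"])
  have "\<tau> permutes {1..m}" using assms by (rule column_stabilizer_permutes)
  note inv = permutes_inv_o[OF this]
  show "\<forall>\<pi>\<in>column_stabilizer m t. inv \<tau> \<circ> (\<tau> \<circ> \<pi>) = \<pi>"
    "\<forall>\<pi>\<in>column_stabilizer m t. \<tau> \<circ> (inv \<tau> \<circ> \<pi>) = \<pi>"
    by (simp_all add: comp_assoc[symmetric] inv)
qed (use assms column_stabilizer_comp column_stabilizer_inv in blast)+

text \<open>Composition with \<open>\<tau>\<close> permutes the column stabilizer. The main use: an
  assignment fixed by an odd column permutation is annihilated.\<close>

lemma column_sum_comp:
  assumes "\<tau> \<in> column_stabilizer m t"
  shows "column_sum m t (u \<circ> \<tau>) w = of_int (sign \<tau>) * column_sum m t u w"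
proof -
  define g where "g \<pi> = (of_int (sign \<tau>) * (of_int (sign \<pi>) * (if w = u \<circ> \<pi> then 1 else 0)) :: complex)"
    for \<pi>
  have "g (\<tau> \<circ> \<pi>) = of_int (sign \<pi>) * (if w = u \<circ> \<tau> \<circ> \<pi> then 1 else 0)"
    if "\<pi> \<in> column_stabilizer m t" for \<pi>
  proof -
    have "sign (\<tau> \<circ> \<pi>) = sign \<tau> * sign \<pi>"
      using assms that column_stabilizer_permutation by (intro sign_compose) auto
    then have "of_int (sign \<tau>) * of_int (sign (\<tau> \<circ> \<pi>)) = (of_int (sign \<pi>) :: complex)"
      by (metis mult.assoc mult_1 of_int_mult sign_idempotent)
    then show ?thesis by (simp add: g_def comp_assoc)
  qed
  then have "column_sum m t (u \<circ> \<tau>) w = (\<Sum>\<pi>\<in>column_stabilizer m t. g (\<tau> \<circ> \<pi>))"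
    by (simp add: column_sum_def)
  also have "\<dots> = (\<Sum>\<pi>\<in>column_stabilizer m t. g \<pi>)"
    by (rule sum.reindex_bij_betw[OF bij_betw_column_stabilizer_comp[OF assms]])
  finally show ?thesis by (simp add: g_def column_sum_def sum_distrib_left)
qed

text \<open>\<open>act_word\<close> composes with inverses; since a permutation and its inverse have
  the same sign, the sum may be taken over inverses instead.\<close>

lemma polytabloid_apply: "polytabloid m t w = column_sum m t (tabloid m t) w"
proof -
  have bij: "bij_betw inv (column_stabilizer m t) (column_stabilizer m t)"
    by (rule bij_betw_byWitness[where f' = inv])
       (auto simp: column_stabilizer_inv permutes_inv_inv[OF column_stabilizer_permutes])
  have "polytabloid m t w =
      (\<Sum>\<pi>\<in>column_stabilizer m t.
        of_int (sign \<pi>) * (if w = tabloid m t \<circ> inv \<pi> then 1 else 0))"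
    by (simp add: polytabloid_def sum_fun_apply cscale_apply delta_def act_word_def)
  also have "\<dots> = (\<Sum>\<pi>\<in>column_stabilizer m t.
        of_int (sign (inv \<pi>)) * (if w = tabloid m t \<circ> inv \<pi> then 1 else 0))"
    by (intro sum.cong refl) (simp add: sign_inverse column_stabilizer_permutation)
  also have "\<dots> = column_sum m t (tabloid m t) w"
    unfolding column_sum_def by (rule sum.reindex_bij_betw[OF bij])
  finally show ?thesis .
qed

lemma sum_two_row:
  "(\<Sum>b\<in>two_row p q. F b) = (\<Sum>c<p. F (0, c)) + (\<Sum>c<q. F (1, c) :: 'a::comm_monoid_add)"
proof -
  have "(\<Sum>b\<in>two_row p q. F b) = (\<Sum>b\<in>{0} \<times> {..<p}. F b) + (\<Sum>b\<in>{1} \<times> {..<q}. F b)"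
    unfolding two_row_def by (rule sum.union_disjoint) auto
  also have "(\<Sum>b\<in>{0} \<times> {..<p}. F b) = (\<Sum>c<p. F (0, c))"
    by (simp add: sum.cartesian_product[of "\<lambda>r c. F (r, c)", simplified, symmetric])
  also have "(\<Sum>b\<in>{1} \<times> {..<q}. F b) = (\<Sum>c<q. F (1, c))"
    using sum.cartesian_product[of "\<lambda>r c. F (r, c)" "{..<q}" "{1}"] by simp
  finally show ?thesis .
qed

lemma card_two_row: "card (two_row p q) = p + q"
  using sum_two_row[of "\<lambda>_. 1::nat" p q] by simp

lemma tableau_in: "t \<in> tableaux m \<nu> \<Longrightarrow> x \<in> {1..m} \<Longrightarrow> t x \<in> \<nu>"
  by (auto simp: tableaux_def bij_betw_def)

lemma tabloid_transpose:
  assumes "x \<in> {1..m}" "y \<in> {1..m}" "fst (t x) = fst (t y)"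
  shows "tabloid m t \<circ> transpose x y = tabloid m t"
  using assms by (auto simp: fun_eq_iff tabloid_def transpose_def)

text \<open>Entries in one row leave the tabloid unchanged, and entries in one column give the sign.
  Otherwise let x be in the first row, y in the second, and z the entry above y, which exists
  because \<open>q \<le> p\<close>. After the exchange y and z both carry the first row, so an odd
  column permutation fixes the assignment and the sum is 0.\<close>

lemma column_sum_transpose:
  assumes t: "t \<in> tableaux m (two_row p q)" and "q \<le> p" and x: "x \<in> {1..m}" and y: "y \<in> {1..m}"
  shows "column_sum m t (tabloid m t \<circ> transpose x y) w =
    (if fst (t x) = fst (t y) then 1 else if snd (t x) = snd (t y) then - 1 else 0) *
    polytabloid m t w"
proof -
  have swap: "column_sum m t (u \<circ> transpose x y) w = - column_sum m t u w"
    if "x \<in> {1..m}" "y \<in> {1..m}" "snd (t x) = snd (t y)" "x \<noteq> y" for x y u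
    using column_sum_comp[OF column_stabilizer_transpose[of x m y t]] that
    by (simp add: sign_swap_id)
  have zero: "column_sum m t (tabloid m t \<circ> transpose x y) w = 0"
    if x: "x \<in> {1..m}" and y: "y \<in> {1..m}" and r: "fst (t x) = 0" "fst (t y) = 1"
      and c: "snd (t x) \<noteq> snd (t y)" for x y
  proof -
    have "snd (t y) < q" using tableau_in[OF t y] r by (auto simp: two_row_def)
    then have "(0, snd (t y)) \<in> two_row p q" using \<open>q \<le> p\<close> by (auto simp: two_row_def)
    moreover have "t ` {1..m} = two_row p q"
      using t by (simp add: tableaux_def bij_betw_imp_surj_on)
    ultimately have "(0, snd (t y)) \<in> t ` {1..m}" by simp
    then obtain z where z: "z \<in> {1..m}" "(0, snd (t y)) = t z" by (elim imageE)
    have tz: "fst (t z) = 0" "snd (t z) = snd (t y)" by (simp_all add: z(2)[symmetric])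
    have ne: "z \<noteq> x" "z \<noteq> y" "x \<noteq> y" using tz c r by auto
    have "tabloid m t \<circ> transpose x y \<circ> transpose z y = tabloid m t \<circ> transpose x y"
      using x y z(1) tz ne r by (auto simp add: fun_eq_iff tabloid_def transpose_def)
    then have "column_sum m t (tabloid m t \<circ> transpose x y) w =
        - column_sum m t (tabloid m t \<circ> transpose x y) w"
      using swap[of z y "tabloid m t \<circ> transpose x y"] z(1) tz y ne by simp
    then show ?thesis by simp
  qed
  have "fst (t x) = 0 \<or> fst (t x) = 1" "fst (t y) = 0 \<or> fst (t y) = 1"
    using tableau_in[OF t x] tableau_in[OF t y] by (auto simp: two_row_def)
  then consider "fst (t x) = fst (t y)" | "fst (t x) \<noteq> fst (t y)" "snd (t x) = snd (t y)"
    | "snd (t x) \<noteq> snd (t y)" "fst (t x) = 0" "fst (t y) = 1"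
    | "snd (t x) \<noteq> snd (t y)" "fst (t x) = 1" "fst (t y) = 0"
    by metis
  then show ?thesis
  proof cases
    case 1
    then show ?thesis using tabloid_transpose[OF x y] by (simp add: polytabloid_apply)
  next
    case 2
    then have "x \<noteq> y" by auto
    then show ?thesis using swap[OF x y] 2 by (simp add: polytabloid_apply)
  next
    case 3
    then show ?thesis using zero[OF x y] by simp
  next
    case 4
    then show ?thesis using zero[OF y x] by (simp add: transpose_commute)
  qed
qed

text \<open>Moving a transposition past a column permutation conjugates it, so the transpositions
  can be made to act on the tabloid itself. By \<open>column_sum_transpose\<close> the scalar counts
  ordered pairs of boxes: p^2 + q^2 in a common row, minus 2 q in a common column but different
  rows. Removing the diagonal, p + q, leaves twice the sum of contents.\<close>

lemma class_sum_polytabloid: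
  assumes t: "t \<in> tableaux m (two_row p q)" and "q \<le> p"
  shows "class_sum m (polytabloid m t) = cscale (content_sum p q) (polytabloid m t)"
proof
  fix w
  let ?N = "{1..m}" and ?C = "column_stabilizer m t" and ?u = "tabloid m t"
  define ind where "ind u = (if w = u then 1 else 0 :: complex)" for u :: word
  have m: "m = p + q"
    using bij_betw_same_card[of t ?N "two_row p q"] t by (simp add: tableaux_def card_two_row)
  have "(\<Sum>x\<in>?N. \<Sum>y\<in>?N. polytabloid m t (w \<circ> transpose x y)) =
      (\<Sum>x\<in>?N. \<Sum>y\<in>?N. \<Sum>\<pi>\<in>?C. of_int (sign \<pi>) * ind (?u \<circ> transpose (\<pi> x) (\<pi> y) \<circ> \<pi>))"
  proof (intro sum.cong refl)
    fix x y
    have "w \<circ> transpose x y = ?u \<circ> \<pi> \<longleftrightarrow> w = ?u \<circ> transpose (\<pi> x) (\<pi> y) \<circ> \<pi>"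
      if "\<pi> \<in> ?C" for \<pi>
    proof -
      have "inj \<pi>" using column_stabilizer_permutes[OF that] permutes_inj by blast
      then have "?u \<circ> transpose (\<pi> x) (\<pi> y) \<circ> \<pi> = ?u \<circ> \<pi> \<circ> transpose x y"
        by (simp add: comp_assoc transpose_comp_perm)
      moreover have "w \<circ> transpose x y \<circ> transpose x y = w" by (simp add: comp_assoc)
      moreover have "?u \<circ> \<pi> \<circ> transpose x y \<circ> transpose x y = ?u \<circ> \<pi>" by (simp add: comp_assoc)
      ultimately show ?thesis by metis
    qed
    then show "polytabloid m t (w \<circ> transpose x y) =
        (\<Sum>\<pi>\<in>?C. of_int (sign \<pi>) * ind (?u \<circ> transpose (\<pi> x) (\<pi> y) \<circ> \<pi>))"
      by (simp add: polytabloid_apply column_sum_def ind_def)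
  qed
  also have "\<dots> = (\<Sum>\<pi>\<in>?C. \<Sum>x\<in>?N. \<Sum>y\<in>?N. of_int (sign \<pi>) * ind (?u \<circ> transpose (\<pi> x) (\<pi> y) \<circ> \<pi>))"
    by (rule sum_swap3)
  also have "\<dots> = (\<Sum>\<pi>\<in>?C. \<Sum>x\<in>?N. \<Sum>y\<in>?N. of_int (sign \<pi>) * ind (?u \<circ> transpose x y \<circ> \<pi>))"
  proof (rule sum.cong[OF refl])
    fix \<pi> assume "\<pi> \<in> ?C"
    note perm = column_stabilizer_permutes[OF this]
    show "(\<Sum>x\<in>?N. \<Sum>y\<in>?N. of_int (sign \<pi>) * ind (?u \<circ> transpose (\<pi> x) (\<pi> y) \<circ> \<pi>)) =
      (\<Sum>x\<in>?N. \<Sum>y\<in>?N. of_int (sign \<pi>) * ind (?u \<circ> transpose x y \<circ> \<pi>))"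
      by (rule sum_permute2[OF perm, of "\<lambda>x y. of_int (sign \<pi>) * ind (?u \<circ> transpose x y \<circ> \<pi>)"])
  qed
  also have "\<dots> = (\<Sum>x\<in>?N. \<Sum>y\<in>?N. column_sum m t (?u \<circ> transpose x y) w)"
    unfolding column_sum_def ind_def by (rule sum_swap3[symmetric])
  also have "\<dots> = (\<Sum>x\<in>?N. \<Sum>y\<in>?N.
      (if fst (t x) = fst (t y) then 1 else if snd (t x) = snd (t y) then - 1 else 0)) *
      polytabloid m t w"
    by (simp add: column_sum_transpose[OF assms] sum_distrib_right)
  also have "(\<Sum>x\<in>?N. \<Sum>y\<in>?N.
      (if fst (t x) = fst (t y) then 1 else if snd (t x) = snd (t y) then - 1 else 0 :: complex)) =
      (\<Sum>b\<in>two_row p q. \<Sum>b'\<in>two_row p q.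
        (if fst b = fst b' then 1 else if snd b = snd b' then - 1 else 0))"
  proof -
    have bij: "bij_betw t ?N (two_row p q)" using t by (simp add: tableaux_def)
    show ?thesis
      unfolding sum.reindex_bij_betw[OF bij, symmetric] by (rule refl)
  qed
  also have "\<dots> = of_nat p ^ 2 + of_nat q ^ 2 - 2 * of_nat q"
  proof -
    have *: "(\<Sum>c<q. \<Sum>c'<p. if c = c' then - 1 else 0 :: complex) = - of_nat q"
      using \<open>q \<le> p\<close> by (simp add: sum.delta)
    have "(\<Sum>c<p. \<Sum>c'<q. if c = c' then - 1 else 0 :: complex) = - of_nat q"
      by (subst sum.swap, subst *[symmetric]) (intro sum.cong refl, auto)
    then show ?thesis
      using * by (simp add: sum_two_row sum.distrib power2_eq_square)
  qed
  finally have "2 * class_sum m (polytabloid m t) w + of_nat m * polytabloid m t w =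
      (of_nat p ^ 2 + of_nat q ^ 2 - 2 * of_nat q) * polytabloid m t w"
    unfolding sum_transpose_word .
  then have "2 * class_sum m (polytabloid m t) w = 2 * content_sum p q * polytabloid m t w"
    unfolding two_content_sum by (simp add: m algebra_simps)
  then show "class_sum m (polytabloid m t) w = cscale (content_sum p q) (polytabloid m t) w"
    by (simp add: cscale_apply)
qed

lemma class_sum_span:
  assumes "v \<in> cfun.span A" "\<And>u. u \<in> A \<Longrightarrow> class_sum m u = cscale c u"
  shows "class_sum m v = cscale c v"
  using assms(1)
proof (induction rule: cfun.span_induct_alt)
  case base
  show ?case by (simp only: class_sum_zero cfun.scale_zero_right)
next
  case (step b x y)
  then show ?case
    by (simp only: class_sum_add class_sum_cscale assms(2) cfun.scale_right_distrib
        cfun.scale_left_commute)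
qed

lemma class_sum_specht:
  assumes "v \<in> specht m (two_row p q)" "q \<le> p"
  shows "class_sum m v = cscale (content_sum p q) v"
  using assms(1) unfolding specht_def
  by (rule class_sum_span) (use class_sum_polytabloid assms(2) in blast)

section \<open>The kernel of \<open>down\<close> inside the Specht module\<close>

lemma permutes_transfer_set:
  assumes "finite N" "S \<subseteq> N" "U \<subseteq> N" "card S = card U"
  obtains \<sigma> where "\<sigma> permutes N" "\<sigma> ` S = U"
proof -
  have fin: "finite S" "finite U" using assms finite_subset by blast+
  obtain f where f: "bij_betw f S U" using finite_same_card_bij fin assms(4) by blast
  have "card (N - S) = card (N - U)" using assms fin by (simp add: card_Diff_subset)
  then obtain g where g: "bij_betw g (N - S) (N - U)"
    using finite_same_card_bij assms(1) by (meson finite_Diff)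
  define \<sigma> where "\<sigma> j = (if j \<in> S then f j else if j \<in> N then g j else j)" for j
  have fS: "bij_betw \<sigma> S U"
    using f by (rule bij_betw_cong[THEN iffD1, rotated]) (simp add: \<sigma>_def)
  have gS: "bij_betw \<sigma> (N - S) (N - U)"
    using g by (rule bij_betw_cong[THEN iffD1, rotated]) (simp add: \<sigma>_def)
  have "bij_betw \<sigma> (S \<union> (N - S)) (U \<union> (N - U))"
    by (rule bij_betw_combine[OF fS gS]) blast
  then have "bij_betw \<sigma> N N" using assms(2,3) by (simp add: Un_absorb1)
  moreover have "\<sigma> j = j" if "j \<notin> N" for j
    using that assms(2) by (auto simp: \<sigma>_def)
  ultimately have "\<sigma> permutes N" by (rule bij_imp_permutes)
  then show thesis using that fS by (simp add: bij_betw_imp_surj_on)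
qed

text \<open>Columns have at most two boxes, so a column permutation is a product of disjoint
  transpositions, one for each flipped column; \<open>j\<close> counts these by their upper entries.
  The induction undoes one flip at a time.\<close>

lemma sign_column_stabilizer:
  assumes t: "t \<in> tableaux m (two_row p q)" and "\<pi> \<in> column_stabilizer m t"
    and "card {x \<in> {1..m}. fst (t x) = 0 \<and> fst (t (\<pi> x)) = 1} = j"
  shows "sign \<pi> = (- 1) ^ j"
  using assms(2,3)
proof (induction j arbitrary: \<pi>)
  case 0
  note perm = column_stabilizer_permutes[OF 0(1)]
  have bij: "bij_betw t {1..m} (two_row p q)" using t by (simp add: tableaux_def)
  have row: "fst (t x) = 0 \<or> fst (t x) = 1" if "x \<in> {1..m}" for x
    using tableau_in[OF t that] by (auto simp: two_row_def)
  have up: "fst (t (\<pi> x)) = 0" if "x \<in> {1..m}" "fst (t x) = 0" for x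
  proof -
    have "{x \<in> {1..m}. fst (t x) = 0 \<and> fst (t (\<pi> x)) = 1} = {}" using 0(2) by simp
    then show ?thesis using row[of "\<pi> x"] permutes_in_image[OF perm, of x] that by blast
  qed
  have col: "snd (t (\<pi> x)) = snd (t x)" if "x \<in> {1..m}" for x
    using 0(1) that by (simp add: column_stabilizer_def)
  have fix0: "\<pi> x = x" if "x \<in> {1..m}" "fst (t x) = 0" for x
  proof -
    have "t (\<pi> x) = t x" using up[OF that] col[OF that(1)] that(2) by (simp add: prod_eq_iff)
    then show ?thesis
      using bij permutes_in_image[OF perm, of x] that(1)
      unfolding bij_betw_def by (meson inj_onD)
  qed
  have fix1: "\<pi> x = x" if x: "x \<in> {1..m}" "fst (t x) = 1" for x
  proof -
    have \<pi>x: "\<pi> x \<in> {1..m}" using permutes_in_image[OF perm, of x] x by simp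
    show ?thesis
    proof (cases "fst (t (\<pi> x)) = 0")
      case True
      then have "\<pi> (\<pi> x) = \<pi> x" using fix0 \<pi>x by blast
      then show ?thesis using permutes_inj[OF perm] by (simp add: inj_eq)
    next
      case False
      then have "t (\<pi> x) = t x" using row[OF \<pi>x] col[OF x(1)] x(2) by (simp add: prod_eq_iff)
      then show ?thesis
        using bij \<pi>x x(1) unfolding bij_betw_def by (meson inj_onD)
    qed
  qed
  have "\<pi> x = x" for x
    using fix0[of x] fix1[of x] row[of x] permutes_not_in[OF perm, of x] by metis
  then have "\<pi> = id" by auto
  then show ?case by simp
next
  case (Suc j)
  note perm = column_stabilizer_permutes[OF Suc.prems(1)]
  have bij: "bij_betw t {1..m} (two_row p q)" using t by (simp add: tableaux_def)
  let ?A = "\<lambda>\<pi>. {x \<in> {1..m}. fst (t x) = 0 \<and> fst (t (\<pi> x)) = 1}"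
  have "?A \<pi> \<noteq> {}" using Suc.prems(2) by (metis card.empty nat.distinct(1))
  then obtain x where x: "x \<in> {1..m}" "fst (t x) = 0" "fst (t (\<pi> x)) = 1" by blast
  define y where "y = \<pi> x"
  have y: "y \<in> {1..m}" using permutes_in_image[OF perm] x y_def by blast
  have col: "snd (t (\<pi> z)) = snd (t z)" if "z \<in> {1..m}" for z
    using Suc.prems(1) that by (simp add: column_stabilizer_def)
  have "y \<noteq> x" using x y_def by auto
  have sxy: "snd (t x) = snd (t y)" using col[OF x(1)] y_def by simp
  define \<tau> where "\<tau> = transpose x y"
  have \<tau>: "\<tau> \<in> column_stabilizer m t"
    unfolding \<tau>_def using x(1) y sxy by (rule column_stabilizer_transpose)
  \<comment> \<open>The column contains no third entry: \<open>\<pi> y\<close> differs from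
    \<open>y\<close> and lies in its column, so it must be the upper entry \<open>x\<close>.\<close>
  have \<pi>y: "\<pi> y = x"
  proof -
    have \<pi>y_in: "\<pi> y \<in> {1..m}" using permutes_in_image[OF perm] y by blast
    have "\<pi> y \<noteq> y" using permutes_inj[OF perm] \<open>y \<noteq> x\<close> y_def by (metis inj_eq)
    then have "t (\<pi> y) \<noteq> t y"
      using bij \<pi>y_in y unfolding bij_betw_def by (meson inj_onD)
    then have "fst (t (\<pi> y)) \<noteq> 1"
      using col[OF y] x(3) y_def by (metis prod_eqI)
    then have "fst (t (\<pi> y)) = 0"
      using tableau_in[OF t \<pi>y_in] by (auto simp: two_row_def)
    then have "t (\<pi> y) = t x" using x(2) sxy col[OF y] by (simp add: prod_eq_iff)
    then show ?thesis
      using bij \<pi>y_in x(1) unfolding bij_betw_def by (meson inj_onD)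
  qed
  have "?A (\<tau> \<circ> \<pi>) = ?A \<pi> - {x}"
  proof -
    have same: "fst (t ((\<tau> \<circ> \<pi>) z)) = fst (t (\<pi> z))" if "z \<noteq> x" "fst (t z) = 0" for z
    proof -
      have "\<pi> z \<noteq> y" using that(1) permutes_inj[OF perm] y_def by (metis inj_eq)
      moreover have "\<pi> z \<noteq> x" using that(2) x(3) \<pi>y permutes_inj[OF perm] y_def
        by (metis inj_eq zero_neq_one)
      ultimately show ?thesis by (simp add: \<tau>_def transpose_def)
    qed
    have at_x: "fst (t ((\<tau> \<circ> \<pi>) x)) = 0" using x(2) by (simp add: \<tau>_def y_def[symmetric])
    show ?thesis
    proof (rule set_eqI)
      fix z
      show "z \<in> ?A (\<tau> \<circ> \<pi>) \<longleftrightarrow> z \<in> ?A \<pi> - {x}"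
      proof (cases "z = x")
        case True
        then show ?thesis using at_x by simp
      next
        case False
        then show ?thesis using same[of z] by auto
      qed
    qed
  qed
  moreover have "finite (?A \<pi>)" by simp
  moreover have "x \<in> ?A \<pi>" using x by blast
  ultimately have "card (?A (\<tau> \<circ> \<pi>)) = j"
    using Suc.prems(2) by (simp only: card_Diff_singleton diff_Suc_1)
  then have IH: "sign (\<tau> \<circ> \<pi>) = (- 1) ^ j"
    using column_stabilizer_comp[OF \<tau> Suc.prems(1)] Suc.IH by blast
  have "sign (\<tau> \<circ> \<pi>) = sign \<tau> * sign \<pi>"
    using \<tau> Suc.prems(1) column_stabilizer_permutation by (intro sign_compose) auto
  moreover have "sign \<tau> = - 1" using \<open>y \<noteq> x\<close> by (auto simp: \<tau>_def sign_swap_id)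
  ultimately show ?case using IH by simp
qed

lemma tableau_comp_permutation:
  assumes "t \<in> tableaux m \<nu>" "\<sigma> permutes {1..m}"
  shows "t \<circ> \<sigma> \<in> tableaux m \<nu>"
  using assms permutes_imp_bij bij_betw_trans by (fastforce simp: tableaux_def)

lemma tabloid_comp_permutation:
  assumes "\<sigma> permutes {1..m}"
  shows "tabloid m (t \<circ> \<sigma>) = tabloid m t \<circ> \<sigma>"
  using permutes_in_image[OF assms] by (auto simp: fun_eq_iff tabloid_def)

text \<open>The column stabilizer of \<open>t \<circ> \<sigma>\<close> is a conjugate of that of
  \<open>t\<close>, with the same signs. All tableaux are thereby referred to the column stabilizer
  of one fixed tableau.\<close>

lemma polytabloid_comp_permutation:
  assumes \<sigma>: "\<sigma> permutes {1..m}"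
  shows "polytabloid m (t \<circ> \<sigma>) w =
    (\<Sum>\<rho>\<in>column_stabilizer m t. of_int (sign \<rho>) * (if w = tabloid m t \<circ> \<rho> \<circ> \<sigma> then 1 else 0))"
proof -
  note inv = permutes_inv_o[OF \<sigma>]
  have bij: "bij_betw (\<lambda>\<rho>. inv \<sigma> \<circ> \<rho> \<circ> \<sigma>) (column_stabilizer m t) (column_stabilizer m (t \<circ> \<sigma>))"
  proof (rule bij_betw_byWitness[where f' = "\<lambda>\<rho>. \<sigma> \<circ> \<rho> \<circ> inv \<sigma>"])
    show "\<forall>\<rho>\<in>column_stabilizer m t. \<sigma> \<circ> (inv \<sigma> \<circ> \<rho> \<circ> \<sigma>) \<circ> inv \<sigma> = \<rho>"
      using permutes_inverses[OF \<sigma>] by (simp add: fun_eq_iff)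
    show "\<forall>\<rho>\<in>column_stabilizer m (t \<circ> \<sigma>). inv \<sigma> \<circ> (\<sigma> \<circ> \<rho> \<circ> inv \<sigma>) \<circ> \<sigma> = \<rho>"
      using permutes_inverses[OF \<sigma>] by (simp add: fun_eq_iff)
    show "(\<lambda>\<rho>. inv \<sigma> \<circ> \<rho> \<circ> \<sigma>) ` column_stabilizer m t \<subseteq> column_stabilizer m (t \<circ> \<sigma>)"
    proof (intro image_subsetI)
      fix \<rho> assume \<rho>: "\<rho> \<in> column_stabilizer m t"
      have "inv \<sigma> \<circ> \<rho> \<circ> \<sigma> permutes {1..m}"
        using \<sigma> column_stabilizer_permutes[OF \<rho>] by (intro permutes_compose permutes_inv)
      moreover have "snd ((t \<circ> \<sigma>) ((inv \<sigma> \<circ> \<rho> \<circ> \<sigma>) j)) = snd ((t \<circ> \<sigma>) j)" if "j \<in> {1..m}" for j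
        using \<rho> permutes_in_image[OF \<sigma>, of j] that permutes_inverses[OF \<sigma>]
        by (simp add: column_stabilizer_def)
      ultimately show "inv \<sigma> \<circ> \<rho> \<circ> \<sigma> \<in> column_stabilizer m (t \<circ> \<sigma>)"
        by (simp only: column_stabilizer_def mem_Collect_eq) blast
    qed
    show "(\<lambda>\<rho>. \<sigma> \<circ> \<rho> \<circ> inv \<sigma>) ` column_stabilizer m (t \<circ> \<sigma>) \<subseteq> column_stabilizer m t"
    proof (intro image_subsetI)
      fix \<rho> assume \<rho>: "\<rho> \<in> column_stabilizer m (t \<circ> \<sigma>)"
      have "\<sigma> \<circ> \<rho> \<circ> inv \<sigma> permutes {1..m}"
        using \<sigma> column_stabilizer_permutes[OF \<rho>] by (intro permutes_compose permutes_inv)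
      moreover have "snd (t ((\<sigma> \<circ> \<rho> \<circ> inv \<sigma>) j)) = snd (t j)" if "j \<in> {1..m}" for j
      proof -
        have "inv \<sigma> j \<in> {1..m}" using permutes_in_image[OF permutes_inv[OF \<sigma>]] that by blast
        then have "snd ((t \<circ> \<sigma>) (\<rho> (inv \<sigma> j))) = snd ((t \<circ> \<sigma>) (inv \<sigma> j))"
          using \<rho> by (simp add: column_stabilizer_def)
        then show ?thesis by (simp add: permutes_inverses[OF \<sigma>])
      qed
      ultimately show "\<sigma> \<circ> \<rho> \<circ> inv \<sigma> \<in> column_stabilizer m t"
        by (simp only: column_stabilizer_def mem_Collect_eq) blast
    qed
  qed
  have "polytabloid m (t \<circ> \<sigma>) w = (\<Sum>\<rho>\<in>column_stabilizer m t.
      of_int (sign (inv \<sigma> \<circ> \<rho> \<circ> \<sigma>)) * (if w = tabloid m t \<circ> \<sigma> \<circ> (inv \<sigma> \<circ> \<rho> \<circ> \<sigma>) then 1 else 0))"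
    unfolding polytabloid_apply column_sum_def tabloid_comp_permutation[OF \<sigma>]
    by (rule sum.reindex_bij_betw[OF bij, symmetric])
  also have "\<dots> = (\<Sum>\<rho>\<in>column_stabilizer m t.
      of_int (sign \<rho>) * (if w = tabloid m t \<circ> \<rho> \<circ> \<sigma> then 1 else 0))"
  proof (rule sum.cong[OF refl])
    fix \<rho> assume \<rho>: "\<rho> \<in> column_stabilizer m t"
    have p\<sigma>: "permutation \<sigma>" using \<sigma> permutation_permutes finite_atLeastAtMost by blast
    have "sign (inv \<sigma> \<circ> \<rho> \<circ> \<sigma>) = sign (inv \<sigma>) * sign \<rho> * sign \<sigma>"
      using p\<sigma> column_stabilizer_permutation[OF \<rho>]
      by (simp add: sign_compose permutation_compose permutation_inverse)
    also have "\<dots> = sign \<rho>" using p\<sigma> by (simp add: sign_inverse mult_ac sign_idempotent)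
    finally have "sign (inv \<sigma> \<circ> \<rho> \<circ> \<sigma>) = sign \<rho>" .
    moreover have "tabloid m t \<circ> \<sigma> \<circ> (inv \<sigma> \<circ> \<rho> \<circ> \<sigma>) = tabloid m t \<circ> \<rho> \<circ> \<sigma>"
      by (simp add: fun_eq_iff permutes_inverses[OF \<sigma>])
    ultimately show "of_int (sign (inv \<sigma> \<circ> \<rho> \<circ> \<sigma>)) *
        (if w = tabloid m t \<circ> \<sigma> \<circ> (inv \<sigma> \<circ> \<rho> \<circ> \<sigma>) then 1 else 0) =
        (of_int (sign \<rho>) * (if w = tabloid m t \<circ> \<rho> \<circ> \<sigma> then 1 else 0) :: complex)"
      by simp
  qed
  finally show ?thesis .
qed

lemma down_image:
  assumes "\<sigma> permutes N" "R \<subseteq> N"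
  shows "down N (\<lambda>S. f (\<sigma> ` S)) R = down N f (\<sigma> ` R)"
proof -
  have "\<sigma> ` (N - R) = N - \<sigma> ` R"
    using permutes_image[OF assms(1)] permutes_inj[OF assms(1)] by (metis image_set_diff)
  then have "bij_betw \<sigma> (N - R) (N - \<sigma> ` R)"
    using permutes_inj_on[OF assms(1)] by (simp add: bij_betw_def)
  then show ?thesis
    unfolding down_def by (subst sum.reindex_bij_betw[symmetric]) (simp_all add: image_insert)
qed

lemma tabloid_eq_chi:
  assumes "t \<in> tableaux m (two_row p q)"
  shows "tabloid m t = chi m {x \<in> {1..m}. fst (t x) = 1}"
proof -
  have "fst (t x) = 0 \<or> fst (t x) = 1" if "x \<in> {1..m}" for x
    using tableau_in[OF assms that] by (auto simp: two_row_def)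
  then show ?thesis by (auto simp: fun_eq_iff tabloid_def chi_def)
qed

lemma card_second_row:
  assumes t: "t \<in> tableaux m (two_row p q)"
  shows "card {x \<in> {1..m}. fst (t x) = 1} = q"
proof -
  let ?S = "{x \<in> {1..m}. fst (t x) = 1}"
  have img: "t ` {1..m} = two_row p q" and inj: "inj_on t {1..m}"
    using t by (simp_all add: tableaux_def bij_betw_def)
  have "t ` ?S = {1} \<times> {..<q}"
  proof
    show "t ` ?S \<subseteq> {1} \<times> {..<q}"
    proof (rule image_subsetI)
      fix x assume "x \<in> ?S"
      then have "t x \<in> two_row p q" "fst (t x) = 1" using tableau_in[OF t, of x] by simp_all
      then show "t x \<in> {1} \<times> {..<q}" by (cases "t x") (simp add: two_row_def)
    qed
    show "{1} \<times> {..<q} \<subseteq> t ` ?S"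
    proof
      fix b assume b: "b \<in> {1::nat} \<times> {..<q}"
      then have "b \<in> t ` {1..m}" unfolding img by (auto simp: two_row_def)
      then obtain x where "x \<in> {1..m}" "b = t x" by (elim imageE)
      moreover have "fst b = 1" using b by auto
      ultimately show "b \<in> t ` ?S" by simp
    qed
  qed
  moreover have "card (t ` ?S) = card ?S"
    by (intro card_image inj_on_subset[OF inj]) auto
  ultimately show ?thesis by simp
qed

text \<open>The function \<open>h\<close> is recovered, up to a factor, by summing the polytabloids of all tableaux
  \<open>t \<circ> \<sigma>\<close> weighted with the values of \<open>h\<close> at their tabloids: evaluated at \<open>w\<close>, this is an
  alternating sum of values of the spherical function obtained by averaging \<open>h\<close> over the
  stabilizer of \<open>w\<close>, and the signs cancel those in \<open>spherical_eq\<close>.\<close>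

lemma kernel_in_specht:
  assumes "2 * a \<le> m"
    and supp: "\<And>w. w \<notin> chi m ` {S. S \<subseteq> {1..m} \<and> card S = a} \<Longrightarrow> h w = 0"
    and ker: "\<And>R. R \<subseteq> {1..m} \<Longrightarrow> Suc (card R) = a \<Longrightarrow> down {1..m} (\<lambda>S. h (chi m S)) R = 0"
  shows "h \<in> specht m (two_row (m - a) a)"
proof -
  let ?N = "{1..m}" and ?\<nu> = "two_row (m - a) a"
  define G where "G = {\<sigma>. \<sigma> permutes ?N}"
  have finG: "finite G" unfolding G_def by (rule finite_permutations) simp
  have "finite ?\<nu>" by (simp add: two_row_def)
  moreover have "card ?\<nu> = card ?N" using assms(1) by (simp add: card_two_row)
  ultimately obtain t where bij: "bij_betw t ?N ?\<nu>"
    using finite_same_card_bij[of ?N ?\<nu>] by auto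
  then have t: "t \<in> tableaux m ?\<nu>" by (simp add: tableaux_def)
  let ?C = "column_stabilizer m t"
  define S0 where "S0 = {x \<in> ?N. fst (t x) = 1}"
  have row: "fst (t x) = 0 \<or> fst (t x) = 1" if "x \<in> ?N" for x
    using tableau_in[OF t that] by (auto simp: two_row_def)
  have w0: "tabloid m t = chi m S0"
    unfolding S0_def by (rule tabloid_eq_chi[OF t])
  have S0: "S0 \<subseteq> ?N" by (auto simp: S0_def)
  have cS0: "card S0 = a" unfolding S0_def by (rule card_second_row[OF t])
  \<comment> \<open>Passing to \<open>inv \<rho>\<close> converts the count of flipped columns into
    the size of a set difference, the parameter of \<open>spherical_eq\<close>.\<close>
  have sign: "sign \<rho> = (- 1) ^ card (\<rho> ` S0 - S0)" if \<rho>: "\<rho> \<in> ?C" for \<rho>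
  proof -
    note perm = column_stabilizer_permutes[OF \<rho>]
    have "{x \<in> ?N. fst (t x) = 0 \<and> fst (t (inv \<rho> x)) = 1} = \<rho> ` S0 - S0"
    proof (intro set_eqI iffI)
      fix x assume x: "x \<in> {x \<in> ?N. fst (t x) = 0 \<and> fst (t (inv \<rho> x)) = 1}"
      then have "inv \<rho> x \<in> S0"
        using permutes_in_image[OF permutes_inv[OF perm], of x] by (simp add: S0_def)
      then have "\<rho> (inv \<rho> x) \<in> \<rho> ` S0" by blast
      then show "x \<in> \<rho> ` S0 - S0" using x permutes_inverses(1)[OF perm] by (simp add: S0_def)
    next
      fix x assume x: "x \<in> \<rho> ` S0 - S0"
      then obtain y where y: "y \<in> S0" "x = \<rho> y" by blast
      then have "x \<in> ?N" using permutes_in_image[OF perm, of y] S0 by blast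
      then show "x \<in> {x \<in> ?N. fst (t x) = 0 \<and> fst (t (inv \<rho> x)) = 1}"
        using x y row permutes_inverses(2)[OF perm] by (auto simp: S0_def)
    qed
    then have "sign (inv \<rho>) = (- 1) ^ card (\<rho> ` S0 - S0)"
      using sign_column_stabilizer[OF t column_stabilizer_inv[OF \<rho>]] by metis
    then show ?thesis using column_stabilizer_permutation[OF \<rho>] by (simp add: sign_inverse)
  qed
  \<comment> \<open>For fixed \<open>w\<close>, this sums the translates of \<open>h\<close> over
    all \<open>\<sigma>\<close> that carry the tabloid of \<open>t\<close> to \<open>w\<close>. The
    result is invariant under the stabilizer of \<open>S0\<close>, is killed by \<open>down\<close>
    like \<open>h\<close>, and at \<open>S0\<close> every summand equals \<open>h w\<close>.\<close>
  define H where "H w Q = (\<Sum>\<sigma>\<in>G. if w = chi m S0 \<circ> \<sigma> then h (chi m (inv \<sigma> ` Q)) else 0)" for w Q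
  have H_inv: "H w (transpose x y ` Q) = H w Q"
    if "x \<in> ?N" "y \<in> ?N" "x \<in> S0 \<longleftrightarrow> y \<in> S0" for w x y Q
  proof -
    let ?\<tau> = "transpose x y"
    have perm: "?\<tau> permutes ?N" using that(1,2) by (rule transpose_permutes)
    have "fst (t x) = fst (t y)"
      using row[OF that(1)] row[OF that(2)] that by (auto simp: S0_def)
    then have fixed: "chi m S0 \<circ> ?\<tau> = chi m S0"
      using tabloid_transpose[OF that(1,2)] by (simp only: w0[symmetric])
    have "H w (?\<tau> ` Q) =
        (\<Sum>\<sigma>\<in>G. if w = chi m S0 \<circ> (?\<tau> \<circ> \<sigma>) then h (chi m (inv (?\<tau> \<circ> \<sigma>) ` ?\<tau> ` Q)) else 0)"
      unfolding H_def G_def by (rule setum_permutations_compose_left[OF perm])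
    also have "\<dots> = H w Q"
      unfolding H_def
    proof (rule sum.cong[OF refl])
      fix \<sigma> assume "\<sigma> \<in> G"
      then have "bij \<sigma>" by (auto simp: G_def permutes_bij)
      then have "inv (?\<tau> \<circ> \<sigma>) = inv \<sigma> \<circ> ?\<tau>"
        by (simp add: o_inv_distrib inv_transpose)
      then have "inv (?\<tau> \<circ> \<sigma>) ` ?\<tau> ` Q = inv \<sigma> ` Q"
        by (simp add: image_comp comp_assoc)
      then show "(if w = chi m S0 \<circ> (?\<tau> \<circ> \<sigma>) then h (chi m (inv (?\<tau> \<circ> \<sigma>) ` ?\<tau> ` Q)) else 0) =
          (if w = chi m S0 \<circ> \<sigma> then h (chi m (inv \<sigma> ` Q)) else 0)"
        by (simp add: comp_assoc[symmetric] fixed)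
    qed
    finally show ?thesis .
  qed
  have H_ker: "down ?N (H w) R = 0" if R: "R \<subseteq> ?N" "Suc (card R) = a" for w R
  proof -
    have "down ?N (H w) R = (\<Sum>\<sigma>\<in>G. if w = chi m S0 \<circ> \<sigma>
        then down ?N (\<lambda>S. h (chi m (inv \<sigma> ` S))) R else 0)"
      unfolding down_def H_def by (subst sum.swap) (intro sum.cong refl, simp)
    also have "\<dots> = 0"
    proof (intro sum.neutral ballI)
      fix \<sigma> assume "\<sigma> \<in> G"
      then have perm: "inv \<sigma> permutes ?N" by (simp add: G_def permutes_inv)
      have "inv \<sigma> ` R \<subseteq> ?N" using R permutes_image[OF perm] by blast
      moreover have "card (inv \<sigma> ` R) = card R"
        using permutes_inj_on[OF perm] by (rule card_image)
      ultimately have "down ?N (\<lambda>S. h (chi m S)) (inv \<sigma> ` R) = 0" using ker R by simp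
      then show "(if w = chi m S0 \<circ> \<sigma> then down ?N (\<lambda>S. h (chi m (inv \<sigma> ` S))) R else 0) = 0"
        using down_image[OF perm R(1), of "\<lambda>S. h (chi m S)"] by simp
    qed
    finally show ?thesis .
  qed
  \<comment> \<open>The sum that remains once the signs have cancelled; its terms are nonnegative
    and the identity contributes 1, so it cannot vanish.\<close>
  define c where "c = (\<Sum>\<rho>\<in>?C. 1 / real ((m - a) choose card (\<rho> ` S0 - S0)))"
  have "c \<ge> 1"
  proof -
    have "1 = (\<Sum>\<rho>\<in>{id}. 1 / real ((m - a) choose card (\<rho> ` S0 - S0)))" by simp
    also have "\<dots> \<le> c"
      unfolding c_def by (rule sum_mono2) (auto simp: finite_column_stabilizer id_column_stabilizer)
    finally show ?thesis .
  qed
  \<comment> \<open>The order of the stabilizer of \<open>S0\<close>. By transitivity on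
    \<open>a\<close>-subsets, every tabloid \<open>w\<close> is reached by this same number of
    permutations.\<close>
  define n where "n = card {\<sigma> \<in> G. chi m S0 = chi m S0 \<circ> \<sigma>}"
  have "n > 0"
    unfolding n_def using finG by (subst card_gt_0_iff) (auto simp: G_def intro: exI[of _ id] permutes_id)
  have H_S0: "H w S0 = of_nat n * h w" for w
  proof -
    have "H w S0 = (\<Sum>\<sigma>\<in>G. if w = chi m S0 \<circ> \<sigma> then h w else 0)"
      unfolding H_def by (intro sum.cong refl) (auto simp: G_def chi_comp)
    also have "\<dots> = of_nat (card {\<sigma> \<in> G. w = chi m S0 \<circ> \<sigma>}) * h w"
      by (simp only: sum.inter_filter[OF finG, symmetric] sum_constant)
    also have "\<dots> = of_nat n * h w"
    proof (cases "w \<in> chi m ` {S. S \<subseteq> ?N \<and> card S = a}")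
      case True
      then obtain S where S: "S \<subseteq> ?N" "card S = a" "w = chi m S" by blast
      obtain \<sigma> where \<sigma>: "\<sigma> permutes ?N" "\<sigma> ` S0 = S"
        using permutes_transfer_set[of ?N S0 S] S0 S cS0 by auto
      then have w: "w = chi m S0 \<circ> inv \<sigma>"
        using S by (simp add: chi_comp permutes_inv permutes_inv_inv)
      have "bij_betw (\<lambda>\<rho>. \<rho> \<circ> inv \<sigma>) {\<rho> \<in> G. chi m S0 = chi m S0 \<circ> \<rho>} {\<rho> \<in> G. w = chi m S0 \<circ> \<rho>}"
      proof (rule bij_betw_byWitness[where f' = "\<lambda>\<rho>. \<rho> \<circ> \<sigma>"])
        show "(\<lambda>\<rho>. \<rho> \<circ> inv \<sigma>) ` {\<rho> \<in> G. chi m S0 = chi m S0 \<circ> \<rho>} \<subseteq> {\<rho> \<in> G. w = chi m S0 \<circ> \<rho>}"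
        proof (intro image_subsetI)
          fix \<rho> assume \<rho>: "\<rho> \<in> {\<rho> \<in> G. chi m S0 = chi m S0 \<circ> \<rho>}"
          then have "\<rho> \<circ> inv \<sigma> \<in> G"
            using permutes_compose[OF permutes_inv[OF \<sigma>(1)]] by (simp add: G_def)
          moreover have "w = chi m S0 \<circ> (\<rho> \<circ> inv \<sigma>)"
            using \<rho> unfolding w by (simp add: comp_assoc[symmetric])
          ultimately show "\<rho> \<circ> inv \<sigma> \<in> {\<rho> \<in> G. w = chi m S0 \<circ> \<rho>}" by blast
        qed
        show "(\<lambda>\<rho>. \<rho> \<circ> \<sigma>) ` {\<rho> \<in> G. w = chi m S0 \<circ> \<rho>} \<subseteq> {\<rho> \<in> G. chi m S0 = chi m S0 \<circ> \<rho>}"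
        proof (intro image_subsetI)
          fix \<rho> assume \<rho>: "\<rho> \<in> {\<rho> \<in> G. w = chi m S0 \<circ> \<rho>}"
          then have "\<rho> \<circ> \<sigma> \<in> G"
            using permutes_compose[OF \<sigma>(1)] by (simp add: G_def)
          moreover have "chi m S0 \<circ> (\<rho> \<circ> \<sigma>) = w \<circ> \<sigma>"
            using \<rho> by (simp add: comp_assoc[symmetric])
          moreover have "w \<circ> \<sigma> = chi m S0"
            unfolding w by (simp add: comp_assoc permutes_inv_o[OF \<sigma>(1)])
          ultimately show "\<rho> \<circ> \<sigma> \<in> {\<rho> \<in> G. chi m S0 = chi m S0 \<circ> \<rho>}" by simp
        qed
      qed (simp_all add: comp_assoc permutes_inv_o[OF \<sigma>(1)])
      then show ?thesis by (simp add: n_def bij_betw_same_card)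
    qed (simp add: supp)
    finally show ?thesis .
  qed
  define h' where "h' = (\<Sum>\<sigma>\<in>G. cscale (h (chi m S0 \<circ> \<sigma>)) (polytabloid m (t \<circ> \<sigma>)))"
  have h'_in: "h' \<in> specht m ?\<nu>"
    unfolding h'_def specht_def
    using tableau_comp_permutation[OF t]
    by (intro cfun.span_sum cfun.span_scale cfun.span_base) (auto simp: G_def)
  have h'_eq: "h' w = of_real c * of_nat n * h w" for w
  proof -
    have "h' w = (\<Sum>\<sigma>\<in>G. \<Sum>\<rho>\<in>?C. of_int (sign \<rho>) *
        (if w = chi m S0 \<circ> (\<rho> \<circ> \<sigma>) then h (chi m S0 \<circ> \<sigma>) else 0))"
      unfolding h'_def sum_fun_apply cscale_apply
      by (intro sum.cong refl)
         (simp add: G_def polytabloid_comp_permutation sum_distrib_left w0 comp_assoc mult_ac if_distrib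
           cong: if_cong)
    also have "\<dots> = (\<Sum>\<rho>\<in>?C. of_int (sign \<rho>) * H w (\<rho> ` S0))"
    proof (subst sum.swap, rule sum.cong[OF refl])
      fix \<rho> assume \<rho>: "\<rho> \<in> ?C"
      note perm = column_stabilizer_permutes[OF \<rho>]
      have "H w (\<rho> ` S0) =
          (\<Sum>\<sigma>\<in>G. if w = chi m S0 \<circ> (\<rho> \<circ> \<sigma>) then h (chi m (inv (\<rho> \<circ> \<sigma>) ` \<rho> ` S0)) else 0)"
        unfolding H_def G_def by (rule setum_permutations_compose_left[OF perm])
      also have "\<dots> = (\<Sum>\<sigma>\<in>G. if w = chi m S0 \<circ> (\<rho> \<circ> \<sigma>) then h (chi m S0 \<circ> \<sigma>) else 0)"
      proof (rule sum.cong[OF refl])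
        fix \<sigma> assume "\<sigma> \<in> G"
        then have \<sigma>: "\<sigma> permutes ?N" by (simp add: G_def)
        have "inv (\<rho> \<circ> \<sigma>) = inv \<sigma> \<circ> inv \<rho>"
          using permutes_bij[OF \<sigma>] permutes_bij[OF perm] by (simp add: o_inv_distrib)
        then have "inv (\<rho> \<circ> \<sigma>) ` \<rho> ` S0 = inv \<sigma> ` S0"
          by (simp add: image_image permutes_inverses(2)[OF perm])
        then show "(if w = chi m S0 \<circ> (\<rho> \<circ> \<sigma>) then h (chi m (inv (\<rho> \<circ> \<sigma>) ` \<rho> ` S0)) else 0) =
            (if w = chi m S0 \<circ> (\<rho> \<circ> \<sigma>) then h (chi m S0 \<circ> \<sigma>) else 0)"
          by (simp only: chi_comp[OF \<sigma>])
      qed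
      finally show "(\<Sum>\<sigma>\<in>G. of_int (sign \<rho>) *
          (if w = chi m S0 \<circ> (\<rho> \<circ> \<sigma>) then h (chi m S0 \<circ> \<sigma>) else 0)) =
          of_int (sign \<rho>) * H w (\<rho> ` S0)"
        by (simp only: sum_distrib_left)
    qed
    also have "\<dots> = (\<Sum>\<rho>\<in>?C. of_real (1 / real ((m - a) choose card (\<rho> ` S0 - S0))) * H w S0)"
    proof (rule sum.cong[OF refl])
      fix \<rho> assume \<rho>: "\<rho> \<in> ?C"
      note perm = column_stabilizer_permutes[OF \<rho>]
      define j where "j = card (\<rho> ` S0 - S0)"
      have "\<rho> ` S0 \<subseteq> ?N" using S0 permutes_image[OF perm] by blast
      moreover have "card (\<rho> ` S0) = a" using card_image[OF permutes_inj_on[OF perm]] cS0 by simp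
      ultimately have "H w (\<rho> ` S0) = (- 1) ^ j * H w S0 / of_nat ((card ?N - a) choose j)"
        using H_inv H_ker by (intro spherical_eq[OF _ S0 cS0]) (auto simp: j_def)
      \<comment> \<open>The sign of the column permutation cancels the alternating sign of the
        spherical function.\<close>
      moreover have "of_int (sign \<rho>) * (- 1) ^ j = (1::complex)"
        using sign[OF \<rho>] by (simp add: j_def power_add[symmetric])
      ultimately show "of_int (sign \<rho>) * H w (\<rho> ` S0) =
          of_real (1 / real ((m - a) choose card (\<rho> ` S0 - S0))) * H w S0"
        unfolding j_def[symmetric] by (simp add: mult.assoc[symmetric])
    qed
    also have "\<dots> = of_real c * H w S0"
      by (simp only: c_def of_real_sum sum_distrib_right)
    finally show ?thesis by (simp only: H_S0 mult.assoc)
  qed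
  have "of_real c * of_nat n \<noteq> (0::complex)" using \<open>c \<ge> 1\<close> \<open>n > 0\<close> by simp
  then have "h = cscale (1 / (of_real c * of_nat n)) h'"
    by (simp add: fun_eq_iff cscale_apply h'_eq)
  then show ?thesis using h'_in unfolding specht_def by (metis cfun.span_scale)
qed

section \<open>Isotypic components\<close>

text \<open>The double sum of transpositions is evaluated twice: through the eigenvalue, and through
  \<open>sum_transpose_image\<close>. Solving for the exchange sum gives
  \<open>ladder_coeff\<close>. The encoding \<open>enc\<close> of subsets is left abstract because
  the lemma is applied both to tabloids and to words with a fixed suffix.\<close>

lemma ladder_eigen_class_sum:
  assumes enc: "\<And>x y S. x \<in> {1..m} \<Longrightarrow> y \<in> {1..m} \<Longrightarrow> S \<subseteq> {1..m} \<Longrightarrow>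
      enc S \<circ> transpose x y = enc (transpose x y ` S)"
    and f: "class_sum m f = cscale (content_sum (m - a) a) f" and "a \<le> m"
  shows "ladder_eigen {1..m} a (\<lambda>S. f (enc S))"
  unfolding ladder_eigen_def
proof (intro allI impI)
  fix S :: "nat set" assume S: "S \<subseteq> {1..m}"
  let ?N = "{1..m}" and ?g = "\<lambda>S. f (enc S)"
  define s where "s = card S"
  have "card S \<le> card ?N" using S by (intro card_mono) auto
  then have s: "s \<le> m" by (simp add: s_def)
  have card: "card (?N - S) = m - s"
    using S finite_subset[OF S] by (simp add: card_Diff_subset s_def)
  define X where "X = (\<Sum>y\<in>S. \<Sum>x\<in>?N - S. ?g (insert x (S - {y})))"
  have "(\<Sum>x\<in>?N. \<Sum>y\<in>?N. ?g (transpose x y ` S)) = (\<Sum>x\<in>?N. \<Sum>y\<in>?N. f (enc S \<circ> transpose x y))"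
    using enc S by (intro sum.cong refl) simp
  also have "\<dots> = 2 * content_sum (m - a) a * ?g S + of_nat m * ?g S"
    unfolding sum_transpose_word by (simp add: f cscale_apply)
  finally have "(of_nat s ^ 2 + of_nat (m - s) ^ 2) * ?g S + 2 * X =
      2 * content_sum (m - a) a * ?g S + of_nat m * ?g S"
    unfolding sum_transpose_image[OF finite_atLeastAtMost S, of ?g] card X_def s_def .
  then have "2 * X = (2 * content_sum (m - a) a + of_nat m - of_nat s ^ 2 - of_nat (m - s) ^ 2) * ?g S"
    by (simp add: algebra_simps)
  then have "2 * (of_nat s * ?g S + X) = 2 * (ladder_coeff m a s * ?g S)"
    unfolding two_content_sum of_nat_diff[OF s] of_nat_diff[OF assms(3)]
    by (simp add: ladder_coeff_def algebra_simps power2_eq_square)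
  then have "of_nat s * ?g S + X = ladder_coeff m a s * ?g S"
    by (simp only: mult_cancel_left) simp
  then show "up (down ?N ?g) S = ladder_coeff (card ?N) a (card S) * ?g S"
    unfolding up_down[OF finite_atLeastAtMost S] X_def[symmetric] s_def[symmetric] by simp
qed

lemma linearI:
  assumes "\<And>f g. T (f + g) = T f + T g" "\<And>c f. T (cscale c f) = cscale c (T f)"
  shows "Vector_Spaces.linear cscale cscale T"
  by (intro Vector_Spaces.linear.intro cfun.vector_space_axioms module_hom.intro
      cfun.module_axioms module_hom_axioms.intro assms)

lemma linear_add: "Vector_Spaces.linear cscale cscale T \<Longrightarrow> T (f + g) = T f + T g"
  by (simp add: Vector_Spaces.linear_def module_hom_iff)

lemma linear_cscale: "Vector_Spaces.linear cscale cscale T \<Longrightarrow> T (cscale c f) = cscale c (T f)"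
  by (simp add: Vector_Spaces.linear_def module_hom_iff)

lemma linear_sum:
  assumes "Vector_Spaces.linear cscale cscale T"
  shows "T (\<Sum>x\<in>A. F x) = (\<Sum>x\<in>A. T (F x))"
proof -
  have "T 0 = 0" using linear_cscale[OF assms, of 0 0] by (simp only: cfun.scale_zero_left)
  then show ?thesis
    by (induction A rule: infinite_finite_induct)
       (simp_all only: sum.infinite sum.empty sum.insert linear_add[OF assms] not_False_eq_True)
qed

text \<open>The intertwiner carries the eigenvalue over from the Specht module. It is equivariant
  only there, so the transpositions are moved across it one at a time on a vector of that
  module.\<close>

lemma class_sum_isotypic:
  assumes "v \<in> isotypic n k m (two_row p q)" "q \<le> p"
  shows "class_sum m v = cscale (content_sum p q) v"
  using assms(1) unfolding isotypic_def
proof (rule class_sum_span)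
  fix u assume "u \<in> \<Union> {W. W \<subseteq> funs n k \<and> iso_to_specht m (two_row p q) W}"
  then obtain T s where T: "Vector_Spaces.linear cscale cscale T" and s: "s \<in> specht m (two_row p q)"
    and u: "u = T s"
    and equi: "\<And>\<sigma> v. \<sigma> permutes {1..m} \<Longrightarrow> v \<in> specht m (two_row p q) \<Longrightarrow> T (act \<sigma> v) = act \<sigma> (T v)"
    unfolding iso_to_specht_def bij_betw_def by blast
  have "act (transpose x y) (T s) = T (act (transpose x y) s)"
    if "x \<in> {1..<y}" "y \<in> {1..m}" for x y
    using that by (intro equi[symmetric] s transpose_permutes) auto
  then have "class_sum m u = (\<Sum>y\<in>{1..m}. \<Sum>x\<in>{1..<y}. T (act (transpose x y) s))"
    unfolding u class_sum_def jucys_murphy_def by (intro sum.cong refl) blast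
  also have "\<dots> = T (class_sum m s)"
    by (simp only: class_sum_def jucys_murphy_def linear_sum[OF T])
  also have "\<dots> = cscale (content_sum p q) u"
    by (simp only: class_sum_specht[OF s assms(2)] linear_cscale[OF T] u)
  finally show "class_sum m u = cscale (content_sum p q) u" .
qed

lemma span_delta:
  assumes "finite X"
  shows "cfun.span (delta ` X) = {f :: 'a \<Rightarrow> complex. \<forall>w. w \<notin> X \<longrightarrow> f w = 0}"
proof (intro equalityI subsetI)
  fix f :: "'a \<Rightarrow> complex" assume "f \<in> cfun.span (delta ` X)"
  then show "f \<in> {f. \<forall>w. w \<notin> X \<longrightarrow> f w = 0}"
    by (induction rule: cfun.span_induct_alt) (auto simp: delta_def cscale_apply split: if_splits)
next
  fix f :: "'a \<Rightarrow> complex" assume "f \<in> {f. \<forall>w. w \<notin> X \<longrightarrow> f w = 0}"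
  then have "f = (\<Sum>x\<in>X. cscale (f x) (delta x))"
    using assms by (auto simp: fun_eq_iff sum_fun_apply cscale_apply delta_def if_distrib cong: if_cong)
  then show "f \<in> cfun.span (delta ` X)"
    by (metis (no_types, lifting) cfun.span_base cfun.span_scale cfun.span_sum imageI)
qed

lemma suffix_space_iff:
  "f \<in> suffix_space n k q c \<longleftrightarrow> (\<forall>w. f w \<noteq> 0 \<longrightarrow> w \<in> words n k \<and> map w [q..<n + 1] = c)"
proof -
  have "finite {w \<in> words n k. map w [q..<n + 1] = c}" using finite_words by simp
  note span_delta[OF this]
  then show ?thesis unfolding suffix_space_def by blast
qed

lemma funs_iff: "f \<in> funs n k \<longleftrightarrow> (\<forall>w. f w \<noteq> 0 \<longrightarrow> w \<in> words n k)"
  by (auto simp: funs_def)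

lemma specht_support:
  assumes "v \<in> specht m (two_row p q)" "v w \<noteq> 0"
  shows "w \<in> chi m ` {S. S \<subseteq> {1..m} \<and> card S = q}"
proof (rule ccontr)
  assume w: "w \<notin> chi m ` {S. S \<subseteq> {1..m} \<and> card S = q}"
  have poly: "polytabloid m t w = 0" if t: "t \<in> tableaux m (two_row p q)" for t
  proof -
    have "w \<noteq> tabloid m t \<circ> \<pi>" if "\<pi> \<in> column_stabilizer m t" for \<pi>
    proof
      let ?S = "{x \<in> {1..m}. fst (t x) = 1}"
      note perm = column_stabilizer_permutes[OF that]
      assume "w = tabloid m t \<circ> \<pi>"
      then have "w = chi m (inv \<pi> ` ?S)" by (simp only: tabloid_eq_chi[OF t] chi_comp[OF perm])
      moreover have "inv \<pi> ` ?S \<subseteq> {1..m}"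
        using permutes_image[OF permutes_inv[OF perm]] by blast
      moreover have "card (inv \<pi> ` ?S) = q"
        using card_image[OF permutes_inj_on[OF permutes_inv[OF perm]]] card_second_row[OF t] by metis
      ultimately show False using w by blast
    qed
    then show ?thesis by (simp add: polytabloid_apply column_sum_def)
  qed
  have "v w = 0"
    using assms(1) unfolding specht_def
    by (induction rule: cfun.span_induct_alt) (auto simp: cscale_apply poly)
  then show False using assms(2) by simp
qed

definition ones :: "nat \<Rightarrow> word \<Rightarrow> nat set" where
  "ones m w = {j \<in> {1..m}. w j = 1}"

section \<open>A copy of the Specht module in the functions with a fixed suffix\<close>

context
  fixes n k m r a :: nat and c :: "nat list"
  assumes len: "length c = n - m" and letters: "set c \<subseteq> {1, 2}" and k: "k = r + count_list c 1"
    and a_r: "a \<le> r" and a_r_m: "a + r \<le> m" and m_n: "m \<le> n"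
begin

text \<open>Identifies \<open>r\<close>-subsets of \<open>{1..m}\<close> with the words having
  suffix \<open>c\<close>. It is total in \<open>S\<close>; for other sizes the value is not in
  \<open>words n k\<close>, where the functions in question vanish.\<close>

definition suffix_word :: "nat set \<Rightarrow> word" where
  "suffix_word S = (\<lambda>j\<in>{1..n}. if j \<le> m then (if j \<in> S then 1 else 2) else c ! (j - Suc m))"

text \<open>The equivariant map that embeds the Specht module of \<open>(m - a, a)\<close> into the functions
  supported on the words with suffix \<open>c\<close>.\<close>

definition lift :: "(word \<Rightarrow> complex) \<Rightarrow> word \<Rightarrow> complex" where
  "lift F w = (if w \<in> words n k \<and> map w [m + 1..<n + 1] = c
     then (up ^^ (r - a)) (\<lambda>S. F (chi m S)) (ones m w) else 0)"

lemma ones_suffix_word: "S \<subseteq> {1..m} \<Longrightarrow> ones m (suffix_word S) = S"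
  using m_n by (auto simp: ones_def suffix_word_def)

lemma map_suffix_word: "map (suffix_word S) [m + 1..<n + 1] = c"
  by (rule nth_equalityI) (auto simp: len suffix_word_def simp del: upt_Suc)

lemma card_suffix_ones:
  assumes "map w [m + 1..<n + 1] = c"
  shows "card {j \<in> {1..n}. w j = 1} = card (ones m w) + count_list c 1"
proof -
  have "{j \<in> {1..n}. w j = 1} = ones m w \<union> {j \<in> {m + 1..<n + 1}. w j = 1}"
    using m_n by (auto simp: ones_def)
  also have "card \<dots> = card (ones m w) + card {j \<in> {m + 1..<n + 1}. w j = 1}"
    by (rule card_Un_disjoint) (auto simp: ones_def)
  also have "card {j \<in> {m + 1..<n + 1}. w j = 1} = length (filter (\<lambda>j. w j = 1) [m + 1..<n + 1])"
    by (subst distinct_card[symmetric]) (auto simp del: upt_Suc)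
  also have "\<dots> = count_list c 1"
    unfolding assms[symmetric] count_list_eq_length_filter
    by (simp add: filter_map o_def eq_commute del: upt_Suc)
  finally show ?thesis .
qed

lemma suffix_word_in_words:
  assumes "S \<subseteq> {1..m}" "card S = r"
  shows "suffix_word S \<in> words n k"
proof -
  have "card {j \<in> {1..n}. suffix_word S j = 1} = k"
    using card_suffix_ones[OF map_suffix_word] ones_suffix_word assms k by simp
  moreover have "suffix_word S j \<in> {1, 2}" if "j \<in> {1..n}" for j
  proof (cases "j \<le> m")
    case False
    then have "c ! (j - Suc m) \<in> set c" using that len by (intro nth_mem) auto
    then show ?thesis using that False letters by (auto simp: suffix_word_def)
  qed (use that in \<open>auto simp: suffix_word_def\<close>)
  ultimately show ?thesis by (auto simp: words_def PiE_iff suffix_word_def)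
qed

lemma suffix_word_ones:
  assumes "w \<in> words n k" "map w [m + 1..<n + 1] = c"
  shows "suffix_word (ones m w) = w"
proof
  fix j
  have w: "w \<in> {1..n} \<rightarrow>\<^sub>E {1, 2}" using assms(1) by (simp add: words_def)
  consider "j \<notin> {1..n}" | "j \<in> {1..m}" | "j \<in> {m + 1..<n + 1}" using m_n by force
  then show "suffix_word (ones m w) j = w j"
  proof cases
    case 1
    then show ?thesis using w by (auto simp: suffix_word_def PiE_iff extensional_def)
  next
    case 2
    then have "j \<in> {1..n}" using m_n by simp
    then have "w j \<in> {1, 2}" using w by blast
    then show ?thesis using 2 \<open>j \<in> {1..n}\<close> by (auto simp: suffix_word_def ones_def)
  next
    case 3
    then have "c ! (j - Suc m) = w j" using 3 unfolding assms(2)[symmetric]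
      by (subst nth_map) (auto simp del: upt_Suc)
    then show ?thesis using 3 by (simp add: suffix_word_def)
  qed
qed

lemma card_ones:
  assumes "w \<in> words n k" "map w [m + 1..<n + 1] = c"
  shows "card (ones m w) = r"
  using card_suffix_ones[OF assms(2)] assms(1) k by (simp add: words_def)

lemma suffix_word_transpose:
  assumes "x \<in> {1..m}" "y \<in> {1..m}"
  shows "suffix_word S \<circ> transpose x y = suffix_word (transpose x y ` S)"
proof
  fix j
  have "transpose x y j \<in> S \<longleftrightarrow> j \<in> transpose x y ` S"
    by (metis image_iff transpose_involutory)
  moreover have "transpose x y j \<le> m \<longleftrightarrow> j \<le> m" "transpose x y j \<in> {1..n} \<longleftrightarrow> j \<in> {1..n}"
    using assms m_n by (auto simp: transpose_def)
  moreover have "transpose x y j = j" if "\<not> j \<le> m" using that assms by (auto simp: transpose_def)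
  ultimately show "(suffix_word S \<circ> transpose x y) j = suffix_word (transpose x y ` S) j"
    by (simp add: suffix_word_def)
qed

lemma lift_linear: "Vector_Spaces.linear cscale cscale lift"
proof (rule linearI)
  show "lift (f + g) = lift f + lift g" for f g
    using funpow_up_linear[of "r - a" 1 "\<lambda>S. f (chi m S)" "\<lambda>S. g (chi m S)"]
    by (simp add: fun_eq_iff lift_def)
  show "lift (cscale x f) = cscale x (lift f)" for x f
  proof -
    have "(up ^^ (r - a)) (\<lambda>S. 0) S = 0" for S :: "nat set"
      using funpow_up_linear[of "r - a" 0 "\<lambda>S. 0" "\<lambda>S. 0" S] funpow_up_linear[of "r - a" 1 "\<lambda>S. 0" "\<lambda>S. 0" S]
      by simp
    then show ?thesis
      using funpow_up_linear[of "r - a" x "\<lambda>S. f (chi m S)" "\<lambda>S. 0"]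
      by (simp add: fun_eq_iff lift_def cscale_apply)
  qed
qed

lemma lift_act:
  assumes \<sigma>: "\<sigma> permutes {1..m}"
  shows "lift (act \<sigma> F) = act \<sigma> (lift F)"
proof
  fix w
  have bij: "bij \<sigma>" using \<sigma> by (rule permutes_bij)
  have \<sigma>n: "\<sigma> permutes {1..n}" using \<sigma> m_n by (intro permutes_subset[OF \<sigma>]) auto
  have "w \<circ> \<sigma> \<in> words n k \<longleftrightarrow> w \<in> words n k"
  proof
    assume "w \<circ> \<sigma> \<in> words n k"
    then have "w \<circ> \<sigma> \<circ> inv \<sigma> \<in> words n k" using permutes_inv[OF \<sigma>n] by (rule words_comp)
    then show "w \<in> words n k" by (simp add: comp_assoc permutes_inv_o[OF \<sigma>])
  qed (rule words_comp[OF _ \<sigma>n])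
  moreover have "map (w \<circ> \<sigma>) [m + 1..<n + 1] = map w [m + 1..<n + 1]"
    by (rule map_cong[OF refl]) (use permutes_not_in[OF \<sigma>] in \<open>simp del: upt_Suc\<close>)
  moreover have "ones m (w \<circ> \<sigma>) = inv \<sigma> ` ones m w"
  proof (intro set_eqI iffI)
    fix j assume j: "j \<in> ones m (w \<circ> \<sigma>)"
    then have "\<sigma> j \<in> ones m w" using permutes_in_image[OF \<sigma>, of j] by (simp add: ones_def)
    then have "inv \<sigma> (\<sigma> j) \<in> inv \<sigma> ` ones m w" by (rule imageI)
    then show "j \<in> inv \<sigma> ` ones m w" by (simp add: permutes_inverses[OF \<sigma>])
  next
    fix j assume "j \<in> inv \<sigma> ` ones m w"
    then obtain i where "i \<in> ones m w" "j = inv \<sigma> i" by blast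
    then show "j \<in> ones m (w \<circ> \<sigma>)"
      using permutes_in_image[OF permutes_inv[OF \<sigma>], of i]
      by (simp add: ones_def permutes_inverses[OF \<sigma>])
  qed
  moreover have "(up ^^ (r - a)) (\<lambda>S. act \<sigma> F (chi m S)) (ones m w) =
      (up ^^ (r - a)) (\<lambda>S. F (chi m S)) (inv \<sigma> ` ones m w)"
    unfolding act_apply[OF bij] chi_comp[OF \<sigma>]
    by (rule funpow_up_image[OF permutes_inj[OF permutes_inv[OF \<sigma>]], of "r - a" "\<lambda>S. F (chi m S)"])
  ultimately show "lift (act \<sigma> F) w = act \<sigma> (lift F) w"
    by (simp only: act_apply[OF bij] lift_def)
qed

text \<open>An element of the Specht module is determined by its values on \<open>a\<close>-subsets,
  it satisfies the ladder condition, and \<open>up\<close> is injective from size \<open>a\<close>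
  to size \<open>r\<close> because \<open>a + r \<le> m\<close>.\<close>

lemma lift_inj_on: "inj_on lift (specht m (two_row (m - a) a))"
proof (rule inj_onI)
  fix F1 F2
  assume F: "F1 \<in> specht m (two_row (m - a) a)" "F2 \<in> specht m (two_row (m - a) a)"
    and eq: "lift F1 = lift F2"
  define F where "F = F1 + cscale (- 1) F2"
  have Fs: "F \<in> specht m (two_row (m - a) a)"
    using F unfolding F_def specht_def by (intro cfun.span_add cfun.span_scale)
  have "lift F = lift F1 + cscale (- 1) (lift F2)"
    unfolding F_def by (simp only: linear_add[OF lift_linear] linear_cscale[OF lift_linear])
  then have zero: "lift F w = 0" for w using eq by (simp add: cscale_apply)
  have a_m: "a \<le> m - a" "a \<le> m" using a_r a_r_m by simp_all
  have "class_sum m F = cscale (content_sum (m - a) a) F"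
    using Fs a_m(1) by (rule class_sum_specht)
  then have eigen: "ladder_eigen {1..m} a (\<lambda>S. F (chi m S))"
    using a_m by (intro ladder_eigen_class_sum chi_transpose)
  have "F (chi m S) = 0" if "S \<subseteq> {1..m}" "card S = a" for S
  proof (rule funpow_up_eq_0[OF _ eigen, of a "r - a"])
    show "(up ^^ (r - a)) (\<lambda>S. F (chi m S)) U = 0" if "U \<subseteq> {1..m}" "card U = a + (r - a)" for U
    proof -
      have "card U = r" using that a_r by simp
      note U = suffix_word_in_words[OF that(1) this] ones_suffix_word[OF that(1)]
      have "lift F (suffix_word U) = (up ^^ (r - a)) (\<lambda>S. F (chi m S)) U"
        by (simp only: lift_def U map_suffix_word if_True simp_thms)
      then show ?thesis by (simp only: zero)
    qed
  qed (use that a_r a_r_m in auto)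
  then have "F w = 0" for w using specht_support[OF Fs, of w] by blast
  then show "F1 = F2" by (simp add: F_def fun_eq_iff cscale_apply)
qed

text \<open>The converse of \<open>class_sum_isotypic\<close> for functions with one suffix. Going
  down to size \<open>a\<close> produces a kernel element, hence an element of the Specht module,
  and \<open>lift\<close> returns it to a nonzero multiple of \<open>v\<close>. So \<open>v\<close>
  lies in the image of \<open>lift\<close>, a copy of the Specht module.\<close>

lemma isotypic_class_sum:
  assumes v: "v \<in> suffix_space n k (m + 1) c"
    and eig: "class_sum m v = cscale (content_sum (m - a) a) v"
  shows "v \<in> isotypic n k m (two_row (m - a) a)"
proof -
  let ?N = "{1..m}" and ?\<nu> = "two_row (m - a) a" and ?A = "{S. S \<subseteq> {1..m} \<and> card S = a}"
  have a_m: "2 * a \<le> m" "a \<le> m" using a_r a_r_m by simp_all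
  define f where "f S = v (suffix_word S)" for S
  have f: "ladder_eigen ?N a f"
    unfolding f_def using suffix_word_transpose eig a_m by (intro ladder_eigen_class_sum)
  define g where "g = (down ?N ^^ (r - a)) f"
  have g: "ladder_eigen ?N a g" unfolding g_def using f by (intro ladder_eigen_funpow_down) auto
  \<comment> \<open>\<open>g\<close> has values on sets of every size; an element of the Specht
    module must live on the tabloids of size \<open>a\<close> only.\<close>
  define h where "h w = (if w \<in> chi m ` ?A then g (ones m w) else 0)" for w
  have ones_chi: "ones m (chi m S) = S" if "S \<subseteq> ?N" for S
    using that by (auto simp: ones_def chi_def)
  have h_chi: "h (chi m S) = g S" if "S \<subseteq> ?N" "card S = a" for S
    using that ones_chi[OF that(1)] by (auto simp: h_def)
  have "h \<in> specht m ?\<nu>"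
  proof (rule kernel_in_specht[OF a_m(1)])
    show "h w = 0" if "w \<notin> chi m ` ?A" for w using that by (simp add: h_def)
    fix R :: "nat set" assume R: "R \<subseteq> ?N" "Suc (card R) = a"
    then have fin: "finite R" using finite_subset by blast
    have "down ?N (\<lambda>S. h (chi m S)) R = down ?N g R"
      unfolding down_def using R fin by (intro sum.cong refl h_chi) auto
    also have "\<dots> = 0"
      using a_m(1) R by (intro ladder_eigen_eq_0[OF _ _ ladder_eigen_down[OF _ g]]) auto
    finally show "down ?N (\<lambda>S. h (chi m S)) R = 0" .
  qed
  define p where "p = (\<Prod>j=1..r - a. ladder_coeff m a (a + j))"
  have "ladder_coeff m a (a + j) \<noteq> 0" if "j \<in> {1..r - a}" for j
    using that a_r a_r_m by (intro ladder_coeff_neq_0) auto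
  then have "p \<noteq> 0" by (simp add: p_def)
  have "lift h w = p * v w" for w
  proof (cases "w \<in> words n k \<and> map w [m + 1..<n + 1] = c")
    case True
    have sub: "ones m w \<subseteq> ?N" by (auto simp: ones_def)
    have card: "card (ones m w) = a + (r - a)" using card_ones True a_r by simp
    have "(up ^^ (r - a)) (\<lambda>S. h (chi m S)) (ones m w) = (up ^^ (r - a)) g (ones m w)"
      using h_chi sub card by (intro funpow_up_cong[of ?N a]) auto
    also have "\<dots> = p * f (ones m w)"
      unfolding g_def using funpow_up_funpow_down[OF _ f sub card] by (simp add: p_def)
    also have "f (ones m w) = v w" using suffix_word_ones True by (simp add: f_def del: upt_Suc)
    finally show ?thesis using True by (simp add: lift_def del: upt_Suc)
  next
    case False
    then show ?thesis using v unfolding suffix_space_iff lift_def by auto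
  qed
  then have v_eq: "v = cscale (1 / p) (lift h)"
    using \<open>p \<noteq> 0\<close> by (simp add: fun_eq_iff cscale_apply)
  have "lift ` specht m ?\<nu> \<subseteq> funs n k"
    by (auto simp: funs_def lift_def)
  moreover have "iso_to_specht m ?\<nu> (lift ` specht m ?\<nu>)"
    unfolding iso_to_specht_def
    using lift_linear lift_act inj_on_imp_bij_betw[OF lift_inj_on] by blast
  ultimately have "lift h \<in> isotypic n k m ?\<nu>"
    unfolding isotypic_def using \<open>h \<in> specht m ?\<nu>\<close> by (intro cfun.span_base) blast
  then show ?thesis
    unfolding v_eq isotypic_def by (rule cfun.span_scale)
qed

end

section \<open>Orthogonality\<close>

lemma inner_add_left: "inner_funs n k (f + g) h = inner_funs n k f h + inner_funs n k g h"
  by (simp add: inner_funs_def sum.distrib algebra_simps)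

lemma inner_diff_left: "inner_funs n k (f - g) h = inner_funs n k f h - inner_funs n k g h"
  by (simp add: inner_funs_def sum_subtractf algebra_simps)

lemma inner_cscale_left: "inner_funs n k (cscale c f) g = c * inner_funs n k f g"
  by (simp add: inner_funs_def cscale_apply sum_distrib_left mult.assoc)

lemma inner_sum_left: "inner_funs n k (\<Sum>x\<in>A. F x) g = (\<Sum>x\<in>A. inner_funs n k (F x) g)"
  by (simp add: inner_funs_def sum_fun_apply sum_distrib_right sum.swap[of _ A])

lemma inner_commute: "inner_funs n k g f = cnj (inner_funs n k f g)"
  by (simp add: inner_funs_def mult.commute)

lemma inner_cscale_right: "inner_funs n k f (cscale c g) = cnj c * inner_funs n k f g"
  by (simp add: inner_funs_def cscale_apply sum_distrib_left mult_ac)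

lemma inner_sum_right: "inner_funs n k f (\<Sum>x\<in>A. F x) = (\<Sum>x\<in>A. inner_funs n k f (F x))"
  by (simp add: inner_funs_def sum_fun_apply sum_distrib_left sum.swap[of _ A])

text \<open>Every transposition of positions up to \<open>n\<close> is an involution of the
  orthonormal basis of delta functions, hence self-adjoint.\<close>

lemma inner_jucys_murphy:
  assumes "j \<le> n"
  shows "inner_funs n k (jucys_murphy j f) g = inner_funs n k f (jucys_murphy j g)"
proof -
  have swap: "(\<Sum>w\<in>words n k. f (w \<circ> transpose m j) * cnj (g w)) =
      (\<Sum>w\<in>words n k. f w * cnj (g (w \<circ> transpose m j)))" if "m \<in> {1..<j}" for m
  proof -
    have perm: "transpose m j permutes {1..n}" using that assms by (intro transpose_permutes) auto
    have inv: "w \<circ> transpose m j \<circ> transpose m j = w" for w :: word by (simp add: comp_assoc)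
    have "bij_betw (\<lambda>w. w \<circ> transpose m j) (words n k) (words n k)"
      by (rule bij_betw_byWitness[where f' = "\<lambda>w. w \<circ> transpose m j"])
         (auto simp: inv intro: words_comp[OF _ perm])
    from sum.reindex_bij_betw[OF this, of "\<lambda>w. f w * cnj (g (w \<circ> transpose m j))"]
    show ?thesis by (simp add: inv)
  qed
  have "inner_funs n k (jucys_murphy j f) g =
      (\<Sum>m\<in>{1..<j}. \<Sum>w\<in>words n k. f (w \<circ> transpose m j) * cnj (g w))"
    unfolding inner_funs_def jucys_murphy_apply sum_distrib_right by (rule sum.swap)
  also have "\<dots> = (\<Sum>m\<in>{1..<j}. \<Sum>w\<in>words n k. f w * cnj (g (w \<circ> transpose m j)))"
    by (rule sum.cong[OF refl swap])
  also have "\<dots> = inner_funs n k f (jucys_murphy j g)"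
    unfolding inner_funs_def jucys_murphy_apply cnj_sum sum_distrib_left by (rule sum.swap)
  finally show ?thesis .
qed

lemma inner_class_sum:
  "j \<le> n \<Longrightarrow> inner_funs n k (class_sum j f) g = inner_funs n k f (class_sum j g)"
  by (simp add: class_sum_def inner_sum_left inner_sum_right inner_jucys_murphy)

text \<open>Labels are not counted combinatorially: an orthonormal family is independent in a space
  spanned by the delta functions, and this yields both finiteness and the bound by the binomial
  coefficient.\<close>

lemma card_labels_orthonormal:
  assumes funs: "B ` L \<subseteq> funs n k"
    and orth: "\<And>l m. l \<in> L \<Longrightarrow> m \<in> L \<Longrightarrow> inner_funs n k (B l) (B m) = (if l = m then 1 else 0)"
  shows "inj_on B L" "cfun.independent (B ` L)" "finite L" "card L \<le> n choose k"
proof -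
  show inj: "inj_on B L"
  proof (rule inj_onI)
    fix l m assume lm: "l \<in> L" "m \<in> L" "B l = B m"
    show "l = m"
      using orth[OF lm(1) lm(2)] orth[OF lm(2) lm(2)] lm(3) by (auto split: if_splits)
  qed
  show indep: "cfun.independent (B ` L)"
  proof
    assume "cfun.dependent (B ` L)"
    then obtain t u v where t: "finite t" "t \<subseteq> B ` L" "(\<Sum>x\<in>t. cscale (u x) x) = 0"
      and v: "v \<in> t" "u v \<noteq> 0"
      unfolding cfun.dependent_explicit by blast
    have "inner_funs n k x v = (if x = v then 1 else 0)" if "x \<in> t" for x
    proof -
      have "x \<in> B ` L" "v \<in> B ` L" using that t(2) v(1) by (meson subsetD)+
      then obtain l m where "l \<in> L" "m \<in> L" "x = B l" "v = B m" by (elim imageE)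
      then show ?thesis using orth[of l m] inj_on_eq_iff[OF inj, of l m] by simp
    qed
    then have "inner_funs n k (\<Sum>x\<in>t. cscale (u x) x) v = (\<Sum>x\<in>t. if x = v then u x else 0)"
      unfolding inner_sum_left inner_cscale_left by (intro sum.cong refl) simp
    also have "\<dots> = u v" using t(1) v(1) by simp
    finally have "inner_funs n k 0 v = u v" by (simp only: t(3))
    then show False using v(2) by (simp add: inner_funs_def)
  qed
  have "funs n k = cfun.span (delta ` words n k)"
    by (simp add: funs_def span_delta[OF finite_words])
  then have "finite (B ` L) \<and> card (B ` L) \<le> card (delta ` words n k)"
    using cfun.independent_span_bound[OF _ indep, of "delta ` words n k"] finite_words funs by simp
  moreover have "card (delta ` words n k) \<le> n choose k"
    using card_image_le[OF finite_words] card_words by metis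
  ultimately show "finite L" "card L \<le> n choose k"
    using inj by (auto simp: card_image dest: finite_imageD)
qed

lemma representation_orthonormal:
  assumes funs: "B ` L \<subseteq> funs n k"
    and orth: "\<And>l m. l \<in> L \<Longrightarrow> m \<in> L \<Longrightarrow> inner_funs n k (B l) (B m) = (if l = m then 1 else 0)"
    and v: "v \<in> cfun.span (B ` L)" and l: "l \<in> L"
  shows "cfun.representation (B ` L) v (B l) = inner_funs n k v (B l)"
proof -
  note L = card_labels_orthonormal[OF funs orth]
  let ?r = "cfun.representation (B ` L) v"
  have "v = (\<Sum>b\<in>B ` L. cscale (?r b) b)"
    using cfun.sum_representation_eq[OF L(2) v, of "B ` L"] L(3) by simp
  also have "\<dots> = (\<Sum>m\<in>L. cscale (?r (B m)) (B m))"
    by (simp add: sum.reindex[OF L(1)])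
  finally have "inner_funs n k v (B l) = inner_funs n k (\<Sum>m\<in>L. cscale (?r (B m)) (B m)) (B l)"
    by (rule arg_cong)
  also have "\<dots> = (\<Sum>m\<in>L. if m = l then ?r (B m) else 0)"
    unfolding inner_sum_left inner_cscale_left using orth l by (intro sum.cong refl) simp
  also have "\<dots> = ?r (B l)" using L(3) l by simp
  finally show ?thesis by simp
qed

lemma expand_orthonormal:
  assumes funs: "B ` L \<subseteq> funs n k"
    and orth: "\<And>l m. l \<in> L \<Longrightarrow> m \<in> L \<Longrightarrow> inner_funs n k (B l) (B m) = (if l = m then 1 else 0)"
    and v: "v \<in> cfun.span (B ` L)"
  shows "v = (\<Sum>l\<in>L. cscale (inner_funs n k v (B l)) (B l))"
proof -
  note L = card_labels_orthonormal[OF funs orth]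
  have "v = (\<Sum>b\<in>B ` L. cscale (cfun.representation (B ` L) v b) b)"
    using cfun.sum_representation_eq[OF L(2) v, of "B ` L"] L(3) by simp
  also have "\<dots> = (\<Sum>l\<in>L. cscale (cfun.representation (B ` L) v (B l)) (B l))"
    by (simp add: sum.reindex[OF L(1)])
  also have "\<dots> = (\<Sum>l\<in>L. cscale (inner_funs n k v (B l)) (B l))"
    by (intro sum.cong refl) (simp add: representation_orthonormal[OF funs orth v])
  finally show ?thesis .
qed

section \<open>Chains of two-row diagrams and their separation by contents\<close>

lemma two_row_eq_iff: "two_row p q = two_row p' q' \<longleftrightarrow> p = p' \<and> q = q'"
proof
  assume eq: "two_row p q = two_row p' q'"
  have rows: "{c. (0, c) \<in> two_row p q} = {..<p}" "{c. (1, c) \<in> two_row p q} = {..<q}" for p q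
    by (auto simp: two_row_def)
  have "{..<p'} = {..<p}" using rows(1)[of p q] unfolding eq rows(1) .
  moreover have "{..<q'} = {..<q}" using rows(2)[of p q] unfolding eq rows(2) .
  ultimately show "p = p' \<and> q = q'" by simp
qed simp

lemma down_closed_nat:
  assumes "finite (X :: nat set)" "\<And>x y. x \<in> X \<Longrightarrow> y \<le> x \<Longrightarrow> y \<in> X"
  shows "X = {..<card X}"
proof -
  have "X = {..<(LEAST z. z \<notin> X)}"
  proof -
    obtain z where "z \<notin> X" using assms(1) ex_new_if_finite infinite_UNIV_nat by blast
    then have least: "(LEAST z. z \<notin> X) \<notin> X" by (rule LeastI)
    show ?thesis
    proof (intro set_eqI iffI)
      fix x assume "x \<in> X"
      then have "x < (LEAST z. z \<notin> X)" using least assms(2) by (meson not_le_imp_less)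
      then show "x \<in> {..<(LEAST z. z \<notin> X)}" by simp
    qed (use not_less_Least in blast)
  qed
  then show ?thesis by (metis card_lessThan)
qed

lemma young_subdiagram_two_row:
  assumes "young_diagram \<nu>" "\<nu> \<subseteq> two_row p q"
  shows "\<exists>p' q'. \<nu> = two_row p' q' \<and> q' \<le> p'"
proof -
  define R where "R r = {c. (r, c) \<in> \<nu>}" for r
  have "R r \<subseteq> snd ` \<nu>" for r by (force simp: R_def)
  then have fin: "finite (R r)" for r
    using assms(1) finite_subset by (metis finite_imageI young_diagram_def)
  have R: "R r = {..<card (R r)}" for r
  proof (rule down_closed_nat[OF fin])
    show "y \<in> R r" if "x \<in> R r" "y \<le> x" for x y
      using that assms(1) unfolding R_def young_diagram_def by blast
  qed
  have mem: "(r, c) \<in> \<nu> \<longleftrightarrow> c < card (R r)" for r c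
    using R[of r] by (metis R_def lessThan_iff mem_Collect_eq)
  have "\<nu> = two_row (card (R 0)) (card (R 1))"
  proof (intro set_eqI iffI)
    fix b assume b: "b \<in> \<nu>"
    then have "b \<in> two_row p q" using assms(2) by blast
    then have "fst b = 0 \<or> fst b = 1" by (auto simp: two_row_def)
    then show "b \<in> two_row (card (R 0)) (card (R 1))"
      using b mem[of "fst b" "snd b"] by (cases b) (auto simp: two_row_def)
  next
    fix b assume "b \<in> two_row (card (R 0)) (card (R 1))"
    then show "b \<in> \<nu>" using mem by (auto simp: two_row_def)
  qed
  moreover have "R 1 \<subseteq> R 0"
    using assms(1) unfolding R_def young_diagram_def by blast
  then have "card (R 1) \<le> card (R 0)" using fin card_mono by blast
  ultimately show ?thesis by blast
qed

text \<open>Labels prescribe the shape of the last diagram only; the chain increases, so all earlier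
  diagrams are contained in it and have two rows as well.\<close>

lemma chain_entry_two_row:
  assumes chain: "diagram_chain i \<Lambda>" and "last \<Lambda> = two_row p q" "j \<in> {1..i}"
  shows "\<exists>b. 2 * b \<le> j \<and> \<Lambda> ! (j - 1) = two_row (j - b) b"
proof -
  have len: "length \<Lambda> = i" using chain by (simp add: diagram_chain_def)
  have "successively (\<subseteq>) \<Lambda>"
    using chain unfolding diagram_chain_def
    by (elim conjE successively_mono) (auto simp: add_box_def)
  then have sorted: "sorted_wrt (\<subseteq>) \<Lambda>"
    by (subst successively_conv_sorted_wrt[symmetric]) (auto intro: transpI)
  have "\<Lambda> ! (j - 1) \<subseteq> \<Lambda> ! (i - 1)"
  proof (cases "j = i")
    case False
    then show ?thesis
      using assms(3) len by (intro sorted_wrt_nth_less[OF sorted]) auto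
  qed simp
  also have "\<Lambda> ! (i - 1) = two_row p q"
    using assms(2,3) len by (subst (asm) last_conv_nth) auto
  finally have "\<Lambda> ! (j - 1) \<subseteq> two_row p q" .
  moreover have young: "young_diagram (\<Lambda> ! (j - 1))" and card: "card (\<Lambda> ! (j - 1)) = j"
    using chain assms(3) by (auto simp: diagram_chain_def)
  ultimately obtain p' q' where eq: "\<Lambda> ! (j - 1) = two_row p' q'" "q' \<le> p'"
    using young_subdiagram_two_row by blast
  then have "j = p' + q'" using card by (simp add: card_two_row)
  then show ?thesis using eq by (intro exI[of _ q']) simp
qed

text \<open>The difference of the doubled sums factors as 2 (b - b') (b + b' - j - 1), and b + b' is
  at most j. Thus the class sum distinguishes two-row diagrams of the same size.\<close>

lemma content_sum_neq:
  assumes "b \<noteq> b'" "2 * b \<le> j" "2 * b' \<le> j"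
  shows "content_sum (j - b) b \<noteq> content_sum (j - b') b'"
proof
  assume eq: "content_sum (j - b) b = content_sum (j - b') b'"
  have le: "b \<le> j" "b' \<le> j" using assms by auto
  have "2 * content_sum (j - b) b - 2 * content_sum (j - b') b' =
      2 * (of_nat b - of_nat b') * (of_nat b + of_nat b' - of_nat j - 1)"
    unfolding two_content_sum of_nat_diff[OF le(1)] of_nat_diff[OF le(2)]
    by (simp add: algebra_simps power2_eq_square)
  moreover have "of_nat b - of_nat b' \<noteq> (0::complex)" using assms(1) by simp
  moreover have "of_nat b + of_nat b' - of_nat j - 1 \<noteq> (0::complex)"
  proof
    assume "of_nat b + of_nat b' - of_nat j - 1 = (0::complex)"
    then have "of_nat (b + b') = (of_nat (j + 1) :: complex)" by (simp add: algebra_simps)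
    then have "b + b' = j + 1" by (simp only: of_nat_eq_iff)
    then show False using assms by simp
  qed
  ultimately show False using eq by simp
qed

lemma cnj_content_sum: "cnj (content_sum p q) = content_sum p q"
  by (simp add: content_sum_def)

lemma inner_eq_0_class_sum:
  assumes "class_sum j f = cscale x f" "class_sum j g = cscale y g" "cnj y \<noteq> x" "j \<le> n"
  shows "inner_funs n k f g = 0"
proof -
  have "x * inner_funs n k f g = cnj y * inner_funs n k f g"
    using inner_class_sum[OF assms(4), of k f g]
    by (simp add: assms(1,2) inner_cscale_left inner_cscale_right)
  then show ?thesis using assms(3) by auto
qed

lemma inner_eq_0_suffix:
  assumes "f \<in> suffix_space n k q c" "g \<in> suffix_space n k q c'" "c \<noteq> c'"
  shows "inner_funs n k f g = 0"
proof -
  have "f w * cnj (g w) = 0" for w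
    using assms unfolding suffix_space_iff by (metis complex_cnj_zero mult_zero_left mult_zero_right)
  then show ?thesis unfolding inner_funs_def by (intro sum.neutral ballI)
qed

lemma suffix_space_Cons:
  assumes "f \<in> suffix_space n k (i + 1) (x # c)" "i < n"
  shows "f \<in> suffix_space n k (i + 2) c"
proof -
  have "[i + 1..<n + 1] = (i + 1) # [i + 2..<n + 1]" using assms(2) by (simp add: upt_conv_Cons)
  then have "map w [i + 2..<n + 1] = c" if "map w [i + 1..<n + 1] = x # c" for w
    using that by (simp only: list.map list.inject)
  then show ?thesis using assms(1) unfolding suffix_space_iff by blast
qed

lemma suffix_space_Cons_letter:
  assumes "f \<in> suffix_space n k (i + 1) (x # c)" "i < n" "f w \<noteq> 0"
  shows "w (i + 1) = x"
proof -
  have "[i + 1..<n + 1] = (i + 1) # [i + 2..<n + 1]" using assms(2) by (simp add: upt_conv_Cons)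
  moreover have "map w [i + 1..<n + 1] = x # c"
    using assms(1,3) unfolding suffix_space_iff by blast
  ultimately show ?thesis by (simp only: list.map list.inject)
qed

text \<open>The transpositions involved move only positions up to \<open>i + 1\<close>, so the
  letters from \<open>i + 2\<close> on are kept, although the one at \<open>i + 1\<close> is
  not.\<close>

lemma jucys_murphy_support:
  assumes "f \<in> suffix_space n k (i + 2) c" "i < n"
  shows "jucys_murphy (i + 1) f \<in> suffix_space n k (i + 2) c"
  unfolding suffix_space_iff
proof (intro allI impI)
  fix w assume "jucys_murphy (i + 1) f w \<noteq> 0"
  then obtain m where m: "m \<in> {1..<i + 1}" "f (w \<circ> transpose m (i + 1)) \<noteq> 0"
    unfolding jucys_murphy_apply by (rule sum.not_neutral_contains_not_neutral)
  let ?\<tau> = "transpose m (i + 1)"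
  have "?\<tau> permutes {1..n}" using m assms(2) by (intro transpose_permutes) auto
  moreover have "w \<circ> ?\<tau> \<in> words n k" "map (w \<circ> ?\<tau>) [i + 2..<n + 1] = c"
    using m assms(1) unfolding suffix_space_iff by auto
  ultimately have "w \<circ> ?\<tau> \<circ> ?\<tau> \<in> words n k" using words_comp by blast
  then have "w \<in> words n k" by (simp add: comp_assoc)
  moreover have "map (w \<circ> ?\<tau>) [i + 2..<n + 1] = map w [i + 2..<n + 1]"
    using m(1) by (intro map_cong refl) (auto simp: transpose_def simp del: upt_Suc)
  ultimately show "w \<in> words n k \<and> map w [i + 2..<n + 1] = c"
    using \<open>map (w \<circ> ?\<tau>) [i + 2..<n + 1] = c\<close> by (simp only: simp_thms)
qed

lemma suffix_space_funs: "f \<in> suffix_space n k q c \<Longrightarrow> f \<in> funs n k"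
  by (auto simp: suffix_space_iff funs_iff simp del: upt_Suc)

lemma jucys_murphy_funs:
  assumes "f \<in> funs n k" "j \<le> n"
  shows "jucys_murphy j f \<in> funs n k"
  unfolding funs_iff
proof (intro allI impI)
  fix w assume "jucys_murphy j f w \<noteq> 0"
  then obtain m where m: "m \<in> {1..<j}" "f (w \<circ> transpose m j) \<noteq> 0"
    unfolding jucys_murphy_apply by (rule sum.not_neutral_contains_not_neutral)
  have "transpose m j permutes {1..n}" using m assms(2) by (intro transpose_permutes) auto
  moreover have "w \<circ> transpose m j \<in> words n k" using m assms(1) unfolding funs_iff by blast
  ultimately have "w \<circ> transpose m j \<circ> transpose m j \<in> words n k" using words_comp by blast
  then show "w \<in> words n k" by (simp add: comp_assoc)
qed

text \<open>The contents of the two boxes that can be added to a diagram with rows of lengths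
  \<open>i - b\<close> and \<open>b\<close> are \<open>i - b\<close> and \<open>b - 1\<close>.\<close>

lemma jucys_murphy_quadratic:
  assumes f: "f \<in> funs n k" and "i < n" "b \<le> i"
    and eig: "class_sum i f = cscale (content_sum (i - b) b) f"
  shows "jucys_murphy (i + 1) (jucys_murphy (i + 1) f) =
    cscale (of_nat i - 1) (jucys_murphy (i + 1) f) -
    cscale ((of_nat i - of_nat b) * (of_nat b - 1)) f"
proof
  fix w
  let ?J = "jucys_murphy (i + 1)"
  have J: "?J f \<in> funs n k" "?J (?J f) \<in> funs n k"
    using f assms(2) by (simp_all add: jucys_murphy_funs)
  show "?J (?J f) w = (cscale (of_nat i - 1) (?J f) -
      cscale ((of_nat i - of_nat b) * (of_nat b - 1)) f) w"
  \<comment> \<open>The two-letter relation holds at words; elsewhere all terms vanish.\<close>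
  proof (cases "w \<in> words n k")
    case False
    then have "?J (?J f) w = 0" "?J f w = 0" "f w = 0" using J f unfolding funs_iff by blast+
    then show ?thesis by (simp add: cscale_apply)
  next
    case True
    then have "w x \<in> {1, 2}" if "x \<in> {1..Suc i}" for x
      using that assms(2) by (auto simp: words_def PiE_iff)
    from jucys_murphy_square[OF this, where f = f]
    have "2 * ?J (?J f) w = 2 * content_sum (i - b) b * f w +
        (2 * of_nat i - 2) * ?J f w + (3 * of_nat i - of_nat i ^ 2) * f w"
      by (simp add: eig cscale_apply)
    also have "\<dots> = 2 * ((of_nat i - 1) * ?J f w - (of_nat i - of_nat b) * (of_nat b - 1) * f w)"
      unfolding two_content_sum of_nat_diff[OF assms(3)]
      by (simp add: algebra_simps power2_eq_square)
    finally have "?J (?J f) w = (of_nat i - 1) * ?J f w - (of_nat i - of_nat b) * (of_nat b - 1) * f w"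
      by (simp only: mult_cancel_left) simp
    then show ?thesis by (simp add: cscale_apply)
  qed
qed

text \<open>Where \<open>f\<close> is nonzero the letter at \<open>i + 1\<close> is
  \<open>x\<close>. Exchanging it with a different letter leaves the support of \<open>f\<close>;
  exchanging it with an equal letter does nothing. So only the equal letters contribute.\<close>

lemma inner_jucys_murphy_letter:
  assumes f: "f \<in> suffix_space n k (i + 1) (x # c)" and "i < n"
    and count: "\<And>w. f w \<noteq> 0 \<Longrightarrow> card {j \<in> {1..i}. w j = x} = d"
  shows "inner_funs n k (jucys_murphy (i + 1) f) f = of_nat d * inner_funs n k f f"
proof -
  have "jucys_murphy (i + 1) f w * cnj (f w) = of_nat d * (f w * cnj (f w))" for w
  proof (cases "f w = 0")
    case False
    then have wx: "w (i + 1) = x" using suffix_space_Cons_letter[OF f assms(2)] by blast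
    have "f (w \<circ> transpose m (i + 1)) = (if w m = x then f w else 0)" if "m \<in> {1..<i + 1}" for m
    proof (cases "w m = x")
      case True
      then have "w \<circ> transpose m (i + 1) = w" using wx by (auto simp: fun_eq_iff transpose_def)
      then show ?thesis using True by simp
    next
      case False
      then have "(w \<circ> transpose m (i + 1)) (i + 1) \<noteq> x" by simp
      then have "f (w \<circ> transpose m (i + 1)) = 0"
        using suffix_space_Cons_letter[OF f assms(2)] by blast
      then show ?thesis using False by simp
    qed
    then have "jucys_murphy (i + 1) f w = (\<Sum>m\<in>{1..<i + 1}. if w m = x then f w else 0)"
      unfolding jucys_murphy_apply by (intro sum.cong refl) blast
    also have "\<dots> = of_nat (card {m \<in> {1..<i + 1}. w m = x}) * f w"
      by (simp only: sum.inter_filter[OF finite_atLeastLessThan, symmetric] sum_constant)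
    also have "{m \<in> {1..<i + 1}. w m = x} = {j \<in> {1..i}. w j = x}" by auto
    finally show ?thesis using count[OF False] by simp
  qed simp
  then show ?thesis unfolding inner_funs_def sum_distrib_left by (intro sum.cong refl)
qed

section \<open>Labels\<close>

lemma young_diagram_two_row: "q \<le> p \<Longrightarrow> young_diagram (two_row p q)"
  by (auto simp: young_diagram_def two_row_def)

lemma two_row_Suc:
  "two_row (Suc p) q = insert (0, p) (two_row p q)" "two_row p (Suc q) = insert (1, q) (two_row p q)"
  by (auto simp: two_row_def)

lemma mem_two_row: "(0, x) \<in> two_row p q \<longleftrightarrow> x < p" "(1, x) \<in> two_row p q \<longleftrightarrow> x < q"
  by (auto simp: two_row_def)

lemma add_box_two_row:
  "q \<le> p \<Longrightarrow> add_box (two_row p q) (two_row (Suc p) q)"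
  "Suc q \<le> p \<Longrightarrow> add_box (two_row p q) (two_row p (Suc q))"
proof -
  assume "q \<le> p"
  then show "add_box (two_row p q) (two_row (Suc p) q)"
    using young_diagram_two_row[of q p] young_diagram_two_row[of q "Suc p"] mem_two_row(1)[of p p q]
      two_row_Suc(1)[of p q]
    unfolding add_box_def by auto
next
  assume "Suc q \<le> p"
  then show "add_box (two_row p q) (two_row p (Suc q))"
    using young_diagram_two_row[of q p] young_diagram_two_row[of "Suc q" p] mem_two_row(2)[of q p q]
      two_row_Suc(2)[of p q]
    unfolding add_box_def by auto
qed

lemma two_row_subset:
  assumes "two_row p q \<subseteq> two_row p' q'"
  shows "p \<le> p'" "q \<le> q'"
proof -
  have "\<not> p' < p" using subsetD[OF assms, of "(0, p')"] unfolding mem_two_row by blast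
  then show "p \<le> p'" by simp
  have "\<not> q' < q" using subsetD[OF assms, of "(1, q')"] unfolding mem_two_row by blast
  then show "q \<le> q'" by simp
qed

lemma content_sum_Suc:
  "content_sum (Suc p) q = content_sum p q + of_nat p"
  "content_sum p (Suc q) = content_sum p q + (of_nat q - 1)"
  by (simp_all add: content_sum_def field_simps)

text \<open>The existential quantifiers in \<open>labels\<close> are resolved: the suffix determines
  \<open>r\<close>, and the last diagram determines \<open>a\<close>.\<close>

lemma labels_iff:
  assumes "\<Lambda> \<noteq> []" "last \<Lambda> = two_row (i - b) b" "b \<le> i" "k = r + count_list c 1"
  shows "(\<Lambda>, c) \<in> labels n k i \<longleftrightarrow>
    diagram_chain i \<Lambda> \<and> length c = n - i \<and> set c \<subseteq> {1, 2} \<and> b \<le> r \<and> b + r \<le> i"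
proof
  assume "(\<Lambda>, c) \<in> labels n k i"
  then obtain r' a where *: "diagram_chain i \<Lambda>" "length c = n - i" "set c \<subseteq> {1, 2}" "r' \<le> k"
    "count_list c 1 = k - r'" "a \<le> r'" "a + r' \<le> i" "last \<Lambda> = two_row (i - a) a"
    using assms(1) unfolding labels_def by auto
  then have "r' = r" "a = b" using assms(2,4) by (simp_all add: two_row_eq_iff)
  then show "diagram_chain i \<Lambda> \<and> length c = n - i \<and> set c \<subseteq> {1, 2} \<and> b \<le> r \<and> b + r \<le> i"
    using * by simp
next
  assume *: "diagram_chain i \<Lambda> \<and> length c = n - i \<and> set c \<subseteq> {1, 2} \<and> b \<le> r \<and> b + r \<le> i"
  have "r \<le> k \<and> count_list c 1 = k - r" using assms(4) by simp
  then show "(\<Lambda>, c) \<in> labels n k i" using * assms(2) unfolding labels_def by blast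
qed

lemma labelE:
  assumes "(\<Lambda>, c) \<in> labels n k i" "1 \<le> i"
  obtains b r where "diagram_chain i \<Lambda>" "\<Lambda> \<noteq> []" "last \<Lambda> = two_row (i - b) b" "length c = n - i"
    "set c \<subseteq> {1, 2}" "k = r + count_list c 1" "b \<le> r" "b + r \<le> i"
proof -
  obtain r a where *: "diagram_chain i \<Lambda>" "length c = n - i" "set c \<subseteq> {1, 2}" "r \<le> k"
    "count_list c 1 = k - r" "a \<le> r" "a + r \<le> i" "\<Lambda> \<noteq> [] \<longrightarrow> last \<Lambda> = two_row (i - a) a"
    using assms(1) unfolding labels_def by auto
  have "\<Lambda> \<noteq> []" using *(1) assms(2) by (auto simp: diagram_chain_def)
  then show thesis using * by (intro that[of a r]) auto
qed

lemma diagram_chain_snoc: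
  assumes "1 \<le> i"
  shows "diagram_chain (Suc i) (\<Lambda> @ [\<nu>]) \<longleftrightarrow>
    diagram_chain i \<Lambda> \<and> young_diagram \<nu> \<and> card \<nu> = Suc i \<and> add_box (last \<Lambda>) \<nu>"
proof -
  have *: "(\<forall>j\<in>{1..Suc i}. P ((\<Lambda> @ [\<nu>]) ! (j - 1)) j) \<longleftrightarrow>
      (\<forall>j\<in>{1..i}. P (\<Lambda> ! (j - 1)) j) \<and> P \<nu> (Suc i)" if "length \<Lambda> = i" for P
  proof -
    have "{1..Suc i} = insert (Suc i) {1..i}" by auto
    moreover have "(\<Lambda> @ [\<nu>]) ! (j - 1) = \<Lambda> ! (j - 1)" if "j \<in> {1..i}" for j
      using that \<open>length \<Lambda> = i\<close> by (auto simp: nth_append)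
    moreover have "(\<Lambda> @ [\<nu>]) ! (Suc i - 1) = \<nu>"
      using \<open>length \<Lambda> = i\<close> by (simp add: nth_append)
    ultimately show ?thesis by auto
  qed
  show ?thesis
    using assms *[of "\<lambda>\<mu> j. young_diagram \<mu> \<and> card \<mu> = j"]
    unfolding diagram_chain_def successively_append_iff by auto
qed

text \<open>Here \<open>\<epsilon>\<close> says that the last box was added to the first row; \<open>r\<close> is the number of
  letters 1 among the first \<open>i + 1\<close> letters of the words in question.\<close>

lemma label_SucE:
  assumes "(\<Lambda>', c) \<in> labels n k (Suc i)" "1 \<le> i"
  obtains \<Lambda> b r \<epsilon> where "\<Lambda>' = \<Lambda> @ [two_row (i - b + (if \<epsilon> then 1 else 0)) (b + (if \<epsilon> then 0 else 1))]"
    "diagram_chain i \<Lambda>" "\<Lambda> \<noteq> []" "last \<Lambda> = two_row (i - b) b" "2 * b \<le> i" "length c = n - Suc i"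
    "set c \<subseteq> {1, 2}" "k = r + count_list c 1" "if \<epsilon> then b \<le> r \<and> b + r \<le> Suc i else b < r \<and> b + r \<le> i"
proof -
  obtain a r where *: "diagram_chain (Suc i) \<Lambda>'" "\<Lambda>' \<noteq> []" "last \<Lambda>' = two_row (Suc i - a) a"
    "length c = n - Suc i" "set c \<subseteq> {1, 2}" "k = r + count_list c 1" "a \<le> r" "a + r \<le> Suc i"
    using labelE[OF assms(1)] by auto
  define \<Lambda> where "\<Lambda> = butlast \<Lambda>'"
  have \<Lambda>': "\<Lambda>' = \<Lambda> @ [two_row (Suc i - a) a]" using *(2,3) by (simp add: \<Lambda>_def flip: *(3))
  have \<Lambda>: "diagram_chain i \<Lambda>" "add_box (last \<Lambda>) (two_row (Suc i - a) a)"
    using *(1) unfolding \<Lambda>' diagram_chain_snoc[OF assms(2)] by auto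
  have ne: "\<Lambda> \<noteq> []" and len: "length \<Lambda> = i" using \<Lambda>(1) assms(2) by (auto simp: diagram_chain_def)
  have "\<exists>b. 2 * b \<le> i \<and> \<Lambda>' ! (i - 1) = two_row (i - b) b"
    using assms(2) by (intro chain_entry_two_row[OF *(1,3)]) auto
  moreover have "\<Lambda>' ! (i - 1) = last \<Lambda>"
    using ne len assms(2) by (simp add: \<Lambda>' nth_append last_conv_nth)
  ultimately obtain b where b: "2 * b \<le> i" "last \<Lambda> = two_row (i - b) b" by auto
  have "two_row (i - b) b \<subseteq> two_row (Suc i - a) a" using \<Lambda>(2) b(2) by (auto simp: add_box_def)
  then have "i - b \<le> Suc i - a" "b \<le> a" by (rule two_row_subset)+
  then consider "a = b" | "a = Suc b" using b(1) *(7,8) by linarith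
  then show thesis
  proof cases
    case 1
    then show ?thesis
      using that[of \<Lambda> b True r] * \<Lambda>(1) \<Lambda>' ne b by (simp add: Suc_diff_le)
  next
    case 2
    then show ?thesis
      using that[of \<Lambda> b False r] * \<Lambda>(1) \<Lambda>' ne b by simp
  qed
qed

lemma label_SucI:
  assumes "diagram_chain i \<Lambda>" "1 \<le> i" "last \<Lambda> = two_row (i - b) b" "2 * b \<le> i" "length c = n - Suc i"
    "set c \<subseteq> {1, 2}" "k = r + count_list c 1" "if \<epsilon> then b \<le> r \<and> b + r \<le> Suc i else b < r \<and> b + r \<le> i"
  shows "(\<Lambda> @ [two_row (i - b + (if \<epsilon> then 1 else 0)) (b + (if \<epsilon> then 0 else 1))], c) \<in> labels n k (Suc i)"
proof -
  let ?a = "b + (if \<epsilon> then 0 else 1)"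
  have eq: "i - b + (if \<epsilon> then 1 else 0) = Suc i - ?a" using assms(4) by auto
  have le: "?a \<le> i - b + (if \<epsilon> then 1 else 0)" "?a \<le> Suc i" using assms(4,8) by (auto split: if_splits)
  have "diagram_chain (Suc i) (\<Lambda> @ [two_row (i - b + (if \<epsilon> then 1 else 0)) ?a])"
    unfolding diagram_chain_snoc[OF assms(2)]
    using assms(1,3,4) le add_box_two_row[of b "i - b"]
    by (auto simp: young_diagram_two_row card_two_row Suc_diff_le split: if_splits)
  moreover have "last (\<Lambda> @ [two_row (i - b + (if \<epsilon> then 1 else 0)) ?a]) = two_row (Suc i - ?a) ?a"
    by (simp only: last_snoc eq)
  ultimately show ?thesis
    using labels_iff[of "\<Lambda> @ [two_row (i - b + (if \<epsilon> then 1 else 0)) ?a]" "Suc i" ?a k r c n]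
      assms(4-8) le by (auto split: if_splits)
qed

text \<open>For a label at level i + 1, \<open>first_label\<close> and \<open>second_label\<close>
  are the possible rows of its column in the change of basis. Either may fail to be a label at level
  i, which is the case of a block of size 1.\<close>

definition first_label :: "label \<Rightarrow> label" where
  "first_label l = (butlast (fst l), 1 # snd l)"

definition second_label :: "label \<Rightarrow> label" where
  "second_label l = (butlast (fst l), 2 # snd l)"

definition two_dimensional :: "nat \<Rightarrow> nat \<Rightarrow> nat \<Rightarrow> label \<Rightarrow> bool" where
  "two_dimensional n k i l \<longleftrightarrow> first_label l \<in> labels n k i \<and> second_label l \<in> labels n k i"

text \<open>The choice between the two roots must be readable from the label alone; a box was added
  to the first row exactly if the second row is unchanged.\<close>

definition first_row_grows :: "label \<Rightarrow> bool" where
  "first_row_grows l \<longleftrightarrow>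
     {x. (1, x) \<in> last (fst l)} = {x. (1, x) \<in> last (butlast (fst l))}"

lemma first_row_grows_snoc:
  assumes "last \<Lambda> = two_row (i - b) b"
  shows "first_row_grows (\<Lambda> @ [two_row p (b + (if \<epsilon> then 0 else 1))], c) \<longleftrightarrow> \<epsilon>"
proof -
  have "{x. (1, x) \<in> two_row p q} = {..<q}" for p q by (auto simp: two_row_def)
  then show ?thesis using assms by (simp add: first_row_grows_def)
qed

text \<open>The eigenvector of the block \<open>(m11, m12; m21, m22)\<close> for its larger or smaller
  eigenvalue is proportional to \<open>(2 * m12, y)\<close>.\<close>

definition eigen_coord :: "(label \<times> label \<Rightarrow> complex) \<Rightarrow> label \<Rightarrow> complex" where
  "eigen_coord M l = (let l1 = first_label l; l2 = second_label l in
     M (l2, l2) - M (l1, l1) + (if first_row_grows l then 1 else - 1) *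
       csqrt ((M (l2, l2) - M (l1, l1)) ^ 2 + 4 * (M (l1, l2) * M (l2, l1))))"

text \<open>The norm of the vector with coordinates 2 m12 and y: the matrix is Hermitian, so m12 m21
  is the squared modulus of m12, and y is real. No conjugation has to be computed.\<close>

definition eigen_norm :: "(label \<times> label \<Rightarrow> complex) \<Rightarrow> label \<Rightarrow> complex" where
  "eigen_norm M l =
     csqrt (eigen_coord M l ^ 2 + 4 * (M (first_label l, second_label l) * M (second_label l, first_label l)))"

definition block_matrix ::
    "nat \<Rightarrow> nat \<Rightarrow> nat \<Rightarrow> (label \<times> label \<Rightarrow> complex) \<Rightarrow> label \<times> label \<Rightarrow> complex" where
  "block_matrix n k i M = (\<lambda>(l, l').
     if two_dimensional n k i l' then
       if l = first_label l' then 2 * M (first_label l', second_label l') / eigen_norm M l'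
       else if l = second_label l' then eigen_coord M l' / eigen_norm M l' else 0
     else if l = first_label l' \<or> l = second_label l' then 1 else 0)"

section \<open>The block structure of the Jucys-Murphy operator in an intermediate basis\<close>

locale intermediate =
  fixes n k i :: nat and B :: "label \<Rightarrow> word \<Rightarrow> complex"
  assumes basis: "intermediate_basis n k i B" and i_ge_1: "1 \<le> i" and i_less: "i < n"
begin

abbreviation "L \<equiv> labels n k i"
abbreviation "J \<equiv> jucys_murphy (Suc i)"
abbreviation "inner \<equiv> inner_funs n k"
abbreviation "M \<equiv> operator_matrix n k i B J"

lemma B_in: "l \<in> L \<Longrightarrow> B l \<in> label_space n k i l"
  using basis by (auto simp: intermediate_basis_def)

lemma orth: "l \<in> L \<Longrightarrow> m \<in> L \<Longrightarrow> inner (B l) (B m) = (if l = m then 1 else 0)"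
  using basis by (auto simp: intermediate_basis_def)

lemma span_B: "cfun.span (B ` L) = funs n k"
  using basis by (simp add: intermediate_basis_def)

lemma B_funs: "B ` L \<subseteq> funs n k"
  using span_B cfun.span_superset by blast

lemma B_suffix: "(\<Lambda>, c) \<in> L \<Longrightarrow> B (\<Lambda>, c) \<in> suffix_space n k (i + 1) c"
  using B_in[of "(\<Lambda>, c)"] by simp

lemma finite_L: "finite L"
  by (rule card_labels_orthonormal(3)[OF B_funs orth])

lemma B_class_sum:
  assumes "(\<Lambda>, c) \<in> L" "j \<in> {1..i}" "\<Lambda> ! (j - 1) = two_row (j - b) b" "2 * b \<le> j"
  shows "class_sum j (B (\<Lambda>, c)) = cscale (content_sum (j - b) b) (B (\<Lambda>, c))"
proof (rule class_sum_isotypic)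
  have "length \<Lambda> = i" using assms(1) by (auto simp: labels_def diagram_chain_def)
  then have "B (\<Lambda>, c) \<in> isotypic n k j (\<Lambda> ! (j - 1))"
    using B_in[OF assms(1)] assms(2) unfolding label_space.simps chain_space_def by blast
  then show "B (\<Lambda>, c) \<in> isotypic n k j (two_row (j - b) b)" by (simp only: assms(3))
qed (use assms(4) in simp)

lemma M_eq: "l \<in> L \<Longrightarrow> m \<in> L \<Longrightarrow> M (l, m) = inner (J (B m)) (B l)"
proof -
  assume lm: "l \<in> L" "m \<in> L"
  have "J (B m) \<in> cfun.span (B ` L)"
    unfolding span_B using B_funs lm i_less by (intro jucys_murphy_funs) auto
  then show ?thesis
    using lm representation_orthonormal[OF B_funs orth]
    by (simp add: operator_matrix_def columns_in_basis_def)
qed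

lemma M_cnj: "l \<in> L \<Longrightarrow> m \<in> L \<Longrightarrow> M (m, l) = cnj (M (l, m))"
  using i_less by (simp add: M_eq inner_jucys_murphy[of "Suc i"] inner_commute[of n k "B l"])

lemma J_suffix: "(\<Lambda>, x # c) \<in> L \<Longrightarrow> J (B (\<Lambda>, x # c)) \<in> suffix_space n k (i + 2) c"
  using jucys_murphy_support[OF suffix_space_Cons[OF B_suffix i_less] i_less] by simp

text \<open>If the letters after position i + 1 differ, the supports are disjoint. Otherwise the
  chains differ at some level j up to i; \<open>J\<close> commutes with the class sum of that level,
  whose eigenvalues on the two vectors are different.\<close>

lemma J_orthogonal:
  assumes l: "(\<Lambda>, x # c) \<in> L" and m: "m \<in> L" "m \<noteq> (\<Lambda>, 1 # c)" "m \<noteq> (\<Lambda>, 2 # c)"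
  shows "inner (J (B (\<Lambda>, x # c))) (B m) = 0"
proof -
  obtain \<Lambda>' c' where m_eq: "m = (\<Lambda>', c')" by (cases m)
  obtain b r where l': "diagram_chain i \<Lambda>" "last \<Lambda> = two_row (i - b) b"
    using labelE[OF l i_ge_1] by metis
  obtain b' r' where m': "diagram_chain i \<Lambda>'" "last \<Lambda>' = two_row (i - b') b'" "length c' = n - i"
      "set c' \<subseteq> {1, 2}"
    using labelE[of \<Lambda>' c' n k i] m(1) m_eq i_ge_1 by metis
  obtain y c'' where c': "c' = y # c''" using m'(3) i_less by (cases c') auto
  show ?thesis
  proof (cases "c'' = c")
    case False
    have "B m \<in> suffix_space n k (i + 2) c''"
      using m(1) unfolding m_eq c' by (rule suffix_space_Cons[OF B_suffix i_less])
    then show ?thesis using J_suffix[OF l] False inner_eq_0_suffix by blast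
  next
    case True
    then have "\<Lambda>' \<noteq> \<Lambda>" using m(2,3) m'(4) m_eq c' by auto
    then obtain j where j: "j \<in> {1..i}" "\<Lambda> ! (j - 1) \<noteq> \<Lambda>' ! (j - 1)"
    proof -
      have len: "length \<Lambda> = i" "length \<Lambda>' = i" using l'(1) m'(1) by (simp_all add: diagram_chain_def)
      then obtain j0 where "j0 < i" "\<Lambda> ! j0 \<noteq> \<Lambda>' ! j0"
        using \<open>\<Lambda>' \<noteq> \<Lambda>\<close> by (metis nth_equalityI)
      then show thesis by (intro that[of "Suc j0"]) auto
    qed
    obtain d where d: "2 * d \<le> j" "\<Lambda> ! (j - 1) = two_row (j - d) d"
      using chain_entry_two_row[OF l' j(1)] by blast
    obtain d' where d': "2 * d' \<le> j" "\<Lambda>' ! (j - 1) = two_row (j - d') d'"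
      using chain_entry_two_row[OF m'(1,2) j(1)] by blast
    have "class_sum j (J (B (\<Lambda>, x # c))) = cscale (content_sum (j - d) d) (J (B (\<Lambda>, x # c)))"
      using j(1) by (simp add: class_sum_jucys_murphy B_class_sum[OF l j(1) d(2,1)] jucys_murphy_cscale)
    moreover have "class_sum j (B m) = cscale (content_sum (j - d') d') (B m)"
      using B_class_sum[of \<Lambda>' c' j d'] m(1) m_eq j(1) d' by simp
    moreover have "d' \<noteq> d" using j(2) d(2) d'(2) by auto
    then have "cnj (content_sum (j - d') d') \<noteq> content_sum (j - d) d"
      unfolding cnj_content_sum using content_sum_neq d(1) d'(1) by blast
    ultimately show ?thesis using j(1) i_less by (intro inner_eq_0_class_sum) auto
  qed
qed

lemma J_expand:
  assumes l: "(\<Lambda>, x # c) \<in> L"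
  shows "J (B (\<Lambda>, x # c)) =
    (\<Sum>m\<in>L \<inter> {(\<Lambda>, 1 # c), (\<Lambda>, 2 # c)}. cscale (M (m, (\<Lambda>, x # c))) (B m))"
proof -
  have "J (B (\<Lambda>, x # c)) \<in> cfun.span (B ` L)"
    unfolding span_B using B_funs l i_less by (intro jucys_murphy_funs) auto
  note in_span = this
  have "J (B (\<Lambda>, x # c)) = (\<Sum>m\<in>L. cscale (inner (J (B (\<Lambda>, x # c))) (B m)) (B m))"
    by (rule expand_orthonormal[OF B_funs _ in_span]) (rule orth)
  also have "\<dots> = (\<Sum>m\<in>L \<inter> {(\<Lambda>, 1 # c), (\<Lambda>, 2 # c)}. cscale (inner (J (B (\<Lambda>, x # c))) (B m)) (B m))"
  proof (rule sum.mono_neutral_right[OF finite_L])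
    show "\<forall>m\<in>L - L \<inter> {(\<Lambda>, 1 # c), (\<Lambda>, 2 # c)}.
        cscale (inner (J (B (\<Lambda>, x # c))) (B m)) (B m) = 0"
    proof
      fix m assume "m \<in> L - L \<inter> {(\<Lambda>, 1 # c), (\<Lambda>, 2 # c)}"
      then have "inner (J (B (\<Lambda>, x # c))) (B m) = 0" by (intro J_orthogonal[OF l]) auto
      then show "cscale (inner (J (B (\<Lambda>, x # c))) (B m)) (B m) = 0"
        by (simp only: cfun.scale_zero_left)
    qed
  qed simp
  also have "\<dots> = (\<Sum>m\<in>L \<inter> {(\<Lambda>, 1 # c), (\<Lambda>, 2 # c)}. cscale (M (m, (\<Lambda>, x # c))) (B m))"
    using l by (intro sum.cong refl) (simp add: M_eq)
  finally show ?thesis .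
qed

lemma letter_count:
  assumes l: "(\<Lambda>, c) \<in> L" and k: "k = r + count_list c 1" and w: "B (\<Lambda>, c) w \<noteq> 0"
  shows "card {j \<in> {1..i}. w j = 1} = r" "card {j \<in> {1..i}. w j = 2} = i - r"
proof -
  have w': "w \<in> words n k" "map w [i + 1..<n + 1] = c"
    using B_suffix[OF l] w unfolding suffix_space_iff by blast+
  have "diagram_chain i \<Lambda>" using l by (auto simp: labels_def)
  obtain b r' where "length c = n - i" "set c \<subseteq> {1, 2}" "k = r' + count_list c 1" "b \<le> r'" "b + r' \<le> i"
    using labelE[OF l i_ge_1] by metis
  moreover from this have "r' = r" using k by simp
  ultimately have "card (ones i w) = r"
    using card_ones[of c n i k r b w] w' i_less by simp
  then show one: "card {j \<in> {1..i}. w j = 1} = r"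
    by (simp only: ones_def)
  have "w j = 2 \<longleftrightarrow> w j \<noteq> 1" if "j \<in> {1..i}" for j
    using w'(1) that i_less by (auto simp: words_def PiE_iff)
  then have "{j \<in> {1..i}. w j = 2} = {1..i} - {j \<in> {1..i}. w j = 1}" by blast
  moreover have "card ({1..i} - {j \<in> {1..i}. w j = 1}) = card {1..i} - card {j \<in> {1..i}. w j = 1}"
    by (rule card_Diff_subset) auto
  ultimately show "card {j \<in> {1..i}. w j = 2} = i - r"
    using one by (simp only: card_atLeastAtMost diff_Suc_1)
qed

text \<open>Here \<open>r\<close> counts the letters 1 among the first \<open>i\<close> positions;
  for a block as a whole it counts those among the first \<open>i + 1\<close>.\<close>

lemma M_diagonal:
  assumes l: "(\<Lambda>, x # c) \<in> L" and k: "k = r + count_list (x # c) 1" and x: "x = 1 \<or> x = 2"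
  shows "M ((\<Lambda>, x # c), (\<Lambda>, x # c)) = of_nat (if x = 1 then r else i - r)"
proof -
  have "card {j \<in> {1..i}. w j = x} = (if x = 1 then r else i - r)" if "B (\<Lambda>, x # c) w \<noteq> 0" for w
    using letter_count[OF l k that] x by auto
  from inner_jucys_murphy_letter[OF B_suffix[OF l] i_less this] show ?thesis
    using l by (simp add: M_eq orth)
qed

end

section \<open>Diagonalization of the blocks\<close>

context intermediate
begin

abbreviation "U \<equiv> block_matrix n k i M"

text \<open>Defined by the columns of \<open>U\<close>, so that the change of basis matrix is
  \<open>U\<close> by construction; the work lies in showing that this is an intermediate
  basis.\<close>

definition new_basis :: "label \<Rightarrow> word \<Rightarrow> complex" where
  "new_basis l' = (\<Sum>l\<in>L. cscale (U (l, l')) (B l))"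

text \<open>Putting the letter 1 at position i + 1 leaves \<open>r - 1\<close> letters 1 before it,
  which shifts both inequalities; putting 2 there leaves \<open>r\<close>. For \<open>r = 0\<close>
  the suffix \<open>1 # c\<close> would contain too many letters 1.\<close>

lemma block_label_iff:
  assumes "diagram_chain i \<Lambda>" "last \<Lambda> = two_row (i - b) b" "2 * b \<le> i" "length c = n - Suc i"
    "set c \<subseteq> {1, 2}" "k = r + count_list c 1"
  shows "(\<Lambda>, 1 # c) \<in> L \<longleftrightarrow> b < r \<and> b + r \<le> Suc i" "(\<Lambda>, 2 # c) \<in> L \<longleftrightarrow> b \<le> r \<and> b + r \<le> i"
proof -
  have ne: "\<Lambda> \<noteq> []" using assms(1) i_ge_1 by (auto simp: diagram_chain_def)
  have len: "Suc (n - Suc i) = n - i" using i_less by simp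
  show "(\<Lambda>, 2 # c) \<in> L \<longleftrightarrow> b \<le> r \<and> b + r \<le> i"
    using labels_iff[of \<Lambda> i b k r "2 # c" n] ne assms len by simp
  show "(\<Lambda>, 1 # c) \<in> L \<longleftrightarrow> b < r \<and> b + r \<le> Suc i"
  proof (cases r)
    case 0
    have "(\<Lambda>, 1 # c) \<notin> L" using 0 assms(6) by (auto simp: labels_def)
    then show ?thesis using 0 by simp
  next
    case (Suc r')
    then show ?thesis using labels_iff[of \<Lambda> i b k r' "1 # c" n] ne assms len by auto
  qed
qed

lemma block_matrix_outside: "l \<noteq> first_label l' \<Longrightarrow> l \<noteq> second_label l' \<Longrightarrow> U (l, l') = 0"
  by (simp add: block_matrix_def)

lemma new_basis_eq:
  "new_basis l' = (\<Sum>l\<in>L \<inter> {first_label l', second_label l'}. cscale (U (l, l')) (B l))"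
  unfolding new_basis_def
proof (rule sum.mono_neutral_right[OF finite_L])
  show "\<forall>l\<in>L - L \<inter> {first_label l', second_label l'}. cscale (U (l, l')) (B l) = 0"
  proof
    fix l assume "l \<in> L - L \<inter> {first_label l', second_label l'}"
    then have "U (l, l') = 0" by (intro block_matrix_outside) auto
    then show "cscale (U (l, l')) (B l) = 0" by (simp only: cfun.scale_zero_left)
  qed
qed simp

lemma sum_pair:
  "(\<Sum>m\<in>{(\<Lambda>, 1 # c), (\<Lambda>, 2 # c)}. F m) = F (\<Lambda>, 1 # c) + F (\<Lambda>, 2 # c)"
  for F :: "label \<Rightarrow> 'a::comm_monoid_add"
  by simp

lemma inner_new_basis:
  "inner (new_basis l') (new_basis m') = (\<Sum>l\<in>L. U (l, l') * cnj (U (l, m')))"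
proof -
  have "inner (B l) (new_basis m') = cnj (U (l, m'))" if "l \<in> L" for l
  proof -
    have "inner (B l) (new_basis m') = (\<Sum>m\<in>L. if m = l then cnj (U (m, m')) else 0)"
      unfolding new_basis_def inner_sum_right inner_cscale_right
      using that by (intro sum.cong refl) (simp add: orth)
    then show ?thesis using that finite_L by simp
  qed
  then show ?thesis
    unfolding new_basis_def[of l'] inner_sum_left inner_cscale_left
    by (intro sum.cong refl) simp
qed

text \<open>In the parameters u = r - b and v = i + 1 - r - b the diagonal entries are b + u - 1 and
  b + v - 1, and the eigenvalues exceed the first one by v and by -u. The last clause covers both
  new labels of the block with the same \<open>u\<close>, \<open>v\<close>,
  \<open>q\<close>.\<close>

lemma block_two_dimensional:
  assumes l1: "(\<Lambda>, 1 # c) \<in> L" and l2: "(\<Lambda>, 2 # c) \<in> L"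
    and \<Lambda>: "diagram_chain i \<Lambda>" "last \<Lambda> = two_row (i - b) b" "2 * b \<le> i"
    and c: "length c = n - Suc i" "set c \<subseteq> {1, 2}" "k = r + count_list c 1"
  obtains u v :: nat and q :: complex where "u > 0" "v > 0" "r = b + u" "Suc i = u + v + 2 * b"
    "q * cnj q = of_nat (u * v)"
    "J (B (\<Lambda>, 1 # c)) =
       cscale (of_nat b + of_nat u - 1) (B (\<Lambda>, 1 # c)) + cscale (cnj q) (B (\<Lambda>, 2 # c))"
    "J (B (\<Lambda>, 2 # c)) =
       cscale q (B (\<Lambda>, 1 # c)) + cscale (of_nat b + of_nat v - 1) (B (\<Lambda>, 2 # c))"
    "\<forall>\<nu> (z::real). z = (if first_row_grows (\<Lambda> @ [\<nu>], c) then real v else - real u) \<longrightarrow>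
       U ((\<Lambda>, 1 # c), (\<Lambda> @ [\<nu>], c)) = 2 * q / of_real (sqrt (4 * (real u * real v + z ^ 2))) \<and>
       U ((\<Lambda>, 2 # c), (\<Lambda> @ [\<nu>], c)) = 2 * of_real z / of_real (sqrt (4 * (real u * real v + z ^ 2)))"
proof -
  let ?l1 = "(\<Lambda>, 1 # c)" and ?l2 = "(\<Lambda>, 2 # c)"
  note br = l1[unfolded block_label_iff(1)[OF \<Lambda> c]] l2[unfolded block_label_iff(2)[OF \<Lambda> c]]
  define u where "u = r - b"
  define v where "v = Suc i - r - b"
  have u: "u > 0" "r = b + u" and v: "v > 0" "Suc i = u + v + 2 * b"
    using br by (auto simp: u_def v_def)
  define q where "q = M (?l1, ?l2)"
  have q21: "M (?l2, ?l1) = cnj q" unfolding q_def using l1 l2 by (rule M_cnj)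
  have "k = (r - 1) + count_list (1 # c) 1" using u c(3) by simp
  from M_diagonal[OF l1 this] have "M (?l1, ?l1) = of_nat (r - 1)" by simp
  also have "\<dots> = of_nat b + of_nat u - 1" using u by (simp add: of_nat_diff)
  finally have m11: "M (?l1, ?l1) = of_nat b + of_nat u - 1" .
  have "k = r + count_list (2 # c) 1" using c(3) by simp
  from M_diagonal[OF l2 this] have "M (?l2, ?l2) = of_nat (i - r)" by simp
  also have "i - r = b + v - 1" using u v by simp
  also have "of_nat (b + v - 1) = (of_nat b + of_nat v - 1 :: complex)" using v by (simp add: of_nat_diff)
  finally have m22: "M (?l2, ?l2) = of_nat b + of_nat v - 1" .
  have inter: "L \<inter> {?l1, ?l2} = {?l1, ?l2}" using l1 l2 by auto
  have J1: "J (B ?l1) = cscale (of_nat b + of_nat u - 1) (B ?l1) + cscale (cnj q) (B ?l2)"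
    by (simp only: J_expand[OF l1] inter sum_pair m11 q21)
  have J2: "J (B ?l2) = cscale q (B ?l1) + cscale (of_nat b + of_nat v - 1) (B ?l2)"
    by (simp only: J_expand[OF l2] inter sum_pair m22 q_def)
  have len: "length \<Lambda> = i" using \<Lambda>(1) by (simp add: diagram_chain_def)
  then have "\<Lambda> ! (i - 1) = two_row (i - b) b"
    using \<Lambda>(2) i_ge_1 by (subst (asm) last_conv_nth) auto
  then have "class_sum i (B ?l1) = cscale (content_sum (i - b) b) (B ?l1)"
    using i_ge_1 \<Lambda>(3) by (intro B_class_sum[OF l1]) auto
  then have quad: "J (J (B ?l1)) =
      cscale (of_nat i - 1) (J (B ?l1)) - cscale ((of_nat i - of_nat b) * (of_nat b - 1)) (B ?l1)"
    using jucys_murphy_quadratic[of "B ?l1" n k i b] B_funs l1 i_less \<Lambda>(3) by auto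
  have p: "inner (J (B ?l1)) (B ?l1) = of_nat b + of_nat u - 1"
    using M_eq[OF l1 l1] m11 by simp
  have q12: "inner (J (B ?l2)) (B ?l1) = q" using M_eq[OF l1 l2] q_def by simp
  have selfadj: "inner (J f) g = inner f (J g)" for f g
    using i_less by (intro inner_jucys_murphy) simp
  \<comment> \<open>The diagonal entry of the square of \<open>J\<close> is computed from the
    columns and from the quadratic relation; comparison gives the squared modulus of
    \<open>q\<close>.\<close>
  have "inner (J (J (B ?l1))) (B ?l1) = inner (J (B ?l1)) (J (B ?l1))" by (rule selfadj)
  also have "\<dots> = (of_nat b + of_nat u - 1) ^ 2 + q * cnj q"
    by (subst J1, simp only: inner_add_left inner_cscale_left selfadj[symmetric] p q12)
       (simp add: power2_eq_square)
  also have "inner (J (J (B ?l1))) (B ?l1) =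
      (of_nat i - 1) * (of_nat b + of_nat u - 1) - (of_nat i - of_nat b) * (of_nat b - 1)"
    unfolding quad inner_diff_left inner_cscale_left p using orth[OF l1 l1] by simp
  finally have "q * cnj q = (of_nat i - 1) * (of_nat b + of_nat u - 1) -
      (of_nat i - of_nat b) * (of_nat b - 1) - (of_nat b + of_nat u - 1) ^ 2"
    by (simp add: algebra_simps)
  moreover have "of_nat (Suc i) = (of_nat (u + v + 2 * b) :: complex)" using v by simp
  then have "of_nat i = (of_nat u + of_nat v + 2 * of_nat b - 1 :: complex)"
    by (simp add: algebra_simps)
  ultimately have qq: "q * cnj q = of_nat (u * v)"
    by (simp add: algebra_simps power2_eq_square)
  show thesis
  proof (rule that[OF u(1) v(1) u(2) v(2) qq J1 J2], intro allI impI)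
    fix \<nu> and z :: real
    let ?l' = "(\<Lambda> @ [\<nu>], c)"
    assume z: "z = (if first_row_grows ?l' then real v else - real u)"
    have fl: "first_label ?l' = ?l1" "second_label ?l' = ?l2"
      by (simp_all add: first_label_def second_label_def)
    have two: "two_dimensional n k i ?l'" using l1 l2 by (simp add: two_dimensional_def fl)
    \<comment> \<open>The discriminant is a perfect square, which settles the branch of
      \<open>csqrt\<close> and makes the second coordinate 2 v or -2 u.\<close>
    have "(of_nat v - of_nat u) ^ 2 + 4 * of_nat (u * v) = (of_nat (u + v) :: complex) ^ 2"
      by (simp add: algebra_simps power2_eq_square)
    moreover have "csqrt (of_nat (u + v) ^ 2) = of_nat (u + v)"
      using u(1) by (intro csqrt_square) simp
    ultimately have sqrt: "csqrt ((of_nat v - of_nat u) ^ 2 + 4 * of_nat (u * v)) = of_nat (u + v)"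
      by simp
    have coord: "eigen_coord M ?l' = 2 * of_real z"
      unfolding eigen_coord_def Let_def fl m11 m22 q21 q_def[symmetric] qq
      using sqrt by (simp add: z)
    have "eigen_norm M ?l' = csqrt (of_real (4 * (real u * real v + z ^ 2)))"
      unfolding eigen_norm_def coord fl q21 q_def[symmetric] qq
      by (simp add: power_mult_distrib algebra_simps)
    also have "\<dots> = of_real (sqrt (4 * (real u * real v + z ^ 2)))"
      by (subst of_real_sqrt) simp_all
    finally have norm: "eigen_norm M ?l' = of_real (sqrt (4 * (real u * real v + z ^ 2)))" .
    show "U (?l1, ?l') = 2 * q / of_real (sqrt (4 * (real u * real v + z ^ 2))) \<and>
      U (?l2, ?l') = 2 * of_real z / of_real (sqrt (4 * (real u * real v + z ^ 2)))"
      by (simp add: block_matrix_def two fl norm coord q_def)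
  qed
qed

text \<open>A block of size 1 means \<open>b = r\<close> or \<open>b + r = Suc i\<close>. Then the
  second row cannot grow, and in both cases the diagonal entry, a number of letters, equals the
  content \<open>i - b\<close> of the box added to the first row.\<close>

lemma block_one_dimensional:
  assumes \<Lambda>: "diagram_chain i \<Lambda>" "last \<Lambda> = two_row (i - b) b" "2 * b \<le> i"
    and c: "length c = n - Suc i" "set c \<subseteq> {1, 2}" "k = r + count_list c 1"
    and \<epsilon>: "if \<epsilon> then b \<le> r \<and> b + r \<le> Suc i else b < r \<and> b + r \<le> i"
    and not2: "\<not> ((\<Lambda>, 1 # c) \<in> L \<and> (\<Lambda>, 2 # c) \<in> L)"
  obtains x where "\<epsilon>" "(\<Lambda>, x # c) \<in> L" "L \<inter> {(\<Lambda>, 1 # c), (\<Lambda>, 2 # c)} = {(\<Lambda>, x # c)}"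
    "x = 1 \<or> x = 2" "J (B (\<Lambda>, x # c)) = cscale (of_nat i - of_nat b) (B (\<Lambda>, x # c))"
proof -
  note iff = block_label_iff[OF \<Lambda> c]
  have eps: \<epsilon> using \<epsilon> not2 unfolding iff by (auto split: if_splits)
  have of_nat_ib: "of_nat (i - b) = (of_nat i - of_nat b :: complex)"
    using \<Lambda>(3) by (simp add: of_nat_diff)
  show thesis
  proof (cases "(\<Lambda>, 1 # c) \<in> L")
    case True
    then have not_l2: "(\<Lambda>, 2 # c) \<notin> L" using not2 by blast
    have "b < r" "b + r = Suc i" using True not_l2 unfolding iff by auto
    then have r: "r - 1 = i - b" "k = (r - 1) + count_list (1 # c) 1" using c(3) by auto
    have inter: "L \<inter> {(\<Lambda>, 1 # c), (\<Lambda>, 2 # c)} = {(\<Lambda>, 1 # c)}" using True not_l2 by auto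
    have "M ((\<Lambda>, 1 # c), (\<Lambda>, 1 # c)) = of_nat (i - b)"
      using M_diagonal[OF True r(2)] r(1) by simp
    then have "J (B (\<Lambda>, 1 # c)) = cscale (of_nat i - of_nat b) (B (\<Lambda>, 1 # c))"
      unfolding J_expand[OF True] inter by (simp add: of_nat_ib)
    then show thesis using that[of 1] eps True inter by blast
  next
    case False
    have "b = r" "b + r \<le> i" using False \<epsilon> eps \<Lambda>(3) unfolding iff by auto
    then have l2: "(\<Lambda>, 2 # c) \<in> L" unfolding iff by simp
    have inter: "L \<inter> {(\<Lambda>, 1 # c), (\<Lambda>, 2 # c)} = {(\<Lambda>, 2 # c)}" using False l2 by auto
    have "k = r + count_list (2 # c) 1" using c(3) by simp
    from M_diagonal[OF l2 this] have "M ((\<Lambda>, 2 # c), (\<Lambda>, 2 # c)) = of_nat (i - b)"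
      using \<open>b = r\<close> by simp
    then have "J (B (\<Lambda>, 2 # c)) = cscale (of_nat i - of_nat b) (B (\<Lambda>, 2 # c))"
      unfolding J_expand[OF l2] inter by (simp add: of_nat_ib)
    then show thesis using that[of 2] eps l2 inter by blast
  qed
qed

lemma block_matrix_one_dimensional:
  assumes "\<not> ((\<Lambda>, 1 # c) \<in> L \<and> (\<Lambda>, 2 # c) \<in> L)" "x = 1 \<or> x = 2"
  shows "U ((\<Lambda>, x # c), (\<Lambda> @ [\<nu>], c)) = 1"
  using assms by (auto simp: block_matrix_def two_dimensional_def first_label_def second_label_def)

lemma new_basis_jucys_murphy:
  assumes \<Lambda>: "diagram_chain i \<Lambda>" "last \<Lambda> = two_row (i - b) b" "2 * b \<le> i"
    and c: "length c = n - Suc i" "set c \<subseteq> {1, 2}" "k = r + count_list c 1"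
    and \<epsilon>: "if \<epsilon> then b \<le> r \<and> b + r \<le> Suc i else b < r \<and> b + r \<le> i"
    and grows: "first_row_grows (\<Lambda> @ [\<nu>], c) \<longleftrightarrow> \<epsilon>"
  shows "J (new_basis (\<Lambda> @ [\<nu>], c)) =
    cscale (if \<epsilon> then of_nat i - of_nat b else of_nat b - 1) (new_basis (\<Lambda> @ [\<nu>], c))"
proof -
  let ?l' = "(\<Lambda> @ [\<nu>], c)" and ?l1 = "(\<Lambda>, 1 # c)" and ?l2 = "(\<Lambda>, 2 # c)"
  have fl: "first_label ?l' = ?l1" "second_label ?l' = ?l2"
    by (simp_all add: first_label_def second_label_def)
  show ?thesis
  proof (cases "?l1 \<in> L \<and> ?l2 \<in> L")
    case True
    obtain u v q where uv: "u > 0" "v > 0" "r = b + u" "Suc i = u + v + 2 * b"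
      and qq: "q * cnj q = of_nat (u * v)"
      and J1: "J (B ?l1) = cscale (of_nat b + of_nat u - 1) (B ?l1) + cscale (cnj q) (B ?l2)"
      and J2: "J (B ?l2) = cscale q (B ?l1) + cscale (of_nat b + of_nat v - 1) (B ?l2)"
      and U: "\<forall>\<nu> (z::real). z = (if first_row_grows (\<Lambda> @ [\<nu>], c) then real v else - real u) \<longrightarrow>
       U (?l1, (\<Lambda> @ [\<nu>], c)) = 2 * q / of_real (sqrt (4 * (real u * real v + z ^ 2))) \<and>
       U (?l2, (\<Lambda> @ [\<nu>], c)) = 2 * of_real z / of_real (sqrt (4 * (real u * real v + z ^ 2)))"
      by (rule block_two_dimensional[OF conjunct1 conjunct2 \<Lambda> c, OF True True])
    define z where "z = (if \<epsilon> then real v else - real u)"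
    define N :: complex where "N = of_real (sqrt (4 * (real u * real v + z ^ 2)))"
    have Uz: "U (?l1, ?l') = 2 * q / N" "U (?l2, ?l') = 2 * of_real z / N"
      using U[rule_format, of z \<nu>] grows by (simp_all add: z_def N_def)
    have inter: "L \<inter> {?l1, ?l2} = {?l1, ?l2}" using True by auto
    have nb: "new_basis ?l' = cscale (2 * q / N) (B ?l1) + cscale (2 * of_real z / N) (B ?l2)"
      by (simp only: new_basis_eq fl inter sum_pair Uz)
    have "of_nat (Suc i) = (of_nat (u + v + 2 * b) :: complex)" using uv by simp
    then have i: "of_nat i = (of_nat u + of_nat v + 2 * of_nat b - 1 :: complex)"
      by (simp add: algebra_simps)
    define \<alpha> :: complex where "\<alpha> = of_nat b + of_nat u - 1 + of_real z"
    \<comment> \<open>This is (z - v) (z + u) = 0 in disguise, the equation satisfied by both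
      choices of \<open>z\<close>.\<close>
    have "of_nat u * of_nat v + of_real z * (of_nat b + of_nat v - 1) = of_real z * \<alpha>"
      by (simp add: \<alpha>_def z_def algebra_simps)
    then have second: "cnj q * q + of_real z * (of_nat b + of_nat v - 1) = of_real z * \<alpha>"
      using qq by (simp add: mult.commute)
    have "J (new_basis ?l') =
        cscale (2 * q / N) (J (B ?l1)) + cscale (2 * of_real z / N) (J (B ?l2))"
      unfolding nb by (simp only: jucys_murphy_add jucys_murphy_cscale)
    also have "\<dots> = cscale (2 * q / N * \<alpha>) (B ?l1) +
        cscale (2 / N * (cnj q * q + of_real z * (of_nat b + of_nat v - 1))) (B ?l2)"
      unfolding J1 J2 by (simp add: fun_eq_iff cscale_apply \<alpha>_def divide_inverse algebra_simps)
    also have "\<dots> = cscale \<alpha> (new_basis ?l')"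
      unfolding nb second by (simp add: fun_eq_iff cscale_apply divide_inverse algebra_simps)
    also have "\<alpha> = (if \<epsilon> then of_nat i - of_nat b else of_nat b - 1)"
      by (simp add: \<alpha>_def z_def i)
    finally show ?thesis .
  next
    case False
    from block_one_dimensional[OF \<Lambda> c \<epsilon> False]
    obtain x where x: "\<epsilon>" "L \<inter> {?l1, ?l2} = {(\<Lambda>, x # c)}" "x = 1 \<or> x = 2"
      "J (B (\<Lambda>, x # c)) = cscale (of_nat i - of_nat b) (B (\<Lambda>, x # c))" by metis
    have "new_basis ?l' = B (\<Lambda>, x # c)"
      unfolding new_basis_eq fl x(2) using block_matrix_one_dimensional[OF False x(3)] by simp
    then show ?thesis using x(1,4) by simp
  qed
qed

lemma inner_new_basis_same_block:
  assumes \<Lambda>: "diagram_chain i \<Lambda>" "last \<Lambda> = two_row (i - b) b" "2 * b \<le> i"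
    and c: "length c = n - Suc i" "set c \<subseteq> {1, 2}" "k = r + count_list c 1"
    and \<epsilon>: "if \<epsilon> then b \<le> r \<and> b + r \<le> Suc i else b < r \<and> b + r \<le> i"
    and \<delta>: "if \<delta> then b \<le> r \<and> b + r \<le> Suc i else b < r \<and> b + r \<le> i"
    and grows: "first_row_grows (\<Lambda> @ [\<nu>], c) \<longleftrightarrow> \<epsilon>" "first_row_grows (\<Lambda> @ [\<mu>], c) \<longleftrightarrow> \<delta>"
  shows "inner (new_basis (\<Lambda> @ [\<nu>], c)) (new_basis (\<Lambda> @ [\<mu>], c)) = (if \<epsilon> = \<delta> then 1 else 0)"
proof -
  let ?l' = "(\<Lambda> @ [\<nu>], c)" and ?m' = "(\<Lambda> @ [\<mu>], c)" and ?l1 = "(\<Lambda>, 1 # c)" and ?l2 = "(\<Lambda>, 2 # c)"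
  have fl: "first_label ?l' = ?l1" "second_label ?l' = ?l2"
    by (simp_all add: first_label_def second_label_def)
  have sum: "inner (new_basis ?l') (new_basis ?m') = (\<Sum>l\<in>L \<inter> {?l1, ?l2}. U (l, ?l') * cnj (U (l, ?m')))"
    unfolding inner_new_basis
  proof (rule sum.mono_neutral_right[OF finite_L])
    show "\<forall>l\<in>L - L \<inter> {?l1, ?l2}. U (l, ?l') * cnj (U (l, ?m')) = 0"
      using block_matrix_outside[of _ ?l'] unfolding fl by auto
  qed simp
  show ?thesis
  proof (cases "?l1 \<in> L \<and> ?l2 \<in> L")
    case True
    obtain u v q where uv: "u > 0" "v > 0" "r = b + u" "Suc i = u + v + 2 * b"
      and qq: "q * cnj q = of_nat (u * v)"
      and J1: "J (B ?l1) = cscale (of_nat b + of_nat u - 1) (B ?l1) + cscale (cnj q) (B ?l2)"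
      and J2: "J (B ?l2) = cscale q (B ?l1) + cscale (of_nat b + of_nat v - 1) (B ?l2)"
      and U: "\<forall>\<nu> (z::real). z = (if first_row_grows (\<Lambda> @ [\<nu>], c) then real v else - real u) \<longrightarrow>
       U (?l1, (\<Lambda> @ [\<nu>], c)) = 2 * q / of_real (sqrt (4 * (real u * real v + z ^ 2))) \<and>
       U (?l2, (\<Lambda> @ [\<nu>], c)) = 2 * of_real z / of_real (sqrt (4 * (real u * real v + z ^ 2)))"
      by (rule block_two_dimensional[OF conjunct1 conjunct2 \<Lambda> c, OF True True])
    define z where "z \<epsilon> = (if \<epsilon> then real v else - real u)" for \<epsilon>
    define N where "N \<epsilon> = sqrt (4 * (real u * real v + z \<epsilon> ^ 2))" for \<epsilon>
    have U': "U (?l1, ?l') = 2 * q / of_real (N \<epsilon>)" "U (?l2, ?l') = 2 * of_real (z \<epsilon>) / of_real (N \<epsilon>)"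
      "U (?l1, ?m') = 2 * q / of_real (N \<delta>)" "U (?l2, ?m') = 2 * of_real (z \<delta>) / of_real (N \<delta>)"
      using U[rule_format, of "z \<epsilon>" \<nu>] U[rule_format, of "z \<delta>" \<mu>] grows by (simp_all add: z_def N_def)
    have pos: "real u * real v + z \<epsilon> ^ 2 > 0" for \<epsilon> using uv by (simp add: add_pos_nonneg)
    have "inner (new_basis ?l') (new_basis ?m') =
        4 * (q * cnj q + of_real (z \<epsilon> * z \<delta>)) / of_real (N \<epsilon> * N \<delta>)"
    proof -
      have "L \<inter> {?l1, ?l2} = {?l1, ?l2}" using True by auto
      then show ?thesis
        unfolding sum by (simp only: sum_pair U') (simp add: add_divide_distrib algebra_simps)
    qed
    also have "\<dots> = of_real (4 * (real u * real v + z \<epsilon> * z \<delta>) / (N \<epsilon> * N \<delta>))"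
      by (simp add: qq)
    also have "4 * (real u * real v + z \<epsilon> * z \<delta>) / (N \<epsilon> * N \<delta>) = (if \<epsilon> = \<delta> then 1 else 0)"
    proof (cases "\<epsilon> = \<delta>")
      case True
      have "N \<epsilon> * N \<epsilon> = 4 * (real u * real v + z \<epsilon> ^ 2)"
        using pos[of \<epsilon>] unfolding N_def by (intro real_sqrt_mult_self[THEN trans]) simp
      then show ?thesis using True pos[of \<epsilon>] by (simp add: power2_eq_square)
    next
      case False
      \<comment> \<open>One of the two values of \<open>z\<close> is v and the other -u, so their
        product cancels u v.\<close>
      then have "real u * real v + z \<epsilon> * z \<delta> = 0" by (auto simp: z_def)
      then show ?thesis using False by simp
    qed
    finally show ?thesis by simp
  next
    case False
    from block_one_dimensional[OF \<Lambda> c \<epsilon> False]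
    obtain x where x: "\<epsilon>" "L \<inter> {?l1, ?l2} = {(\<Lambda>, x # c)}" "x = 1 \<or> x = 2" by metis
    moreover have \<delta> using block_one_dimensional[OF \<Lambda> c \<delta> False] by metis
    ultimately show ?thesis
      unfolding sum using block_matrix_one_dimensional[OF False x(3)] by simp
  qed
qed

text \<open>Within a block this is \<open>inner_new_basis_same_block\<close>; columns of different
  blocks have disjoint sets of nonzero rows.\<close>

lemma new_basis_orthonormal:
  assumes l': "l' \<in> labels n k (Suc i)" and m': "m' \<in> labels n k (Suc i)"
  shows "inner (new_basis l') (new_basis m') = (if l' = m' then 1 else 0)"
proof -
  obtain \<Lambda> b r \<epsilon> c where l: "l' = (\<Lambda> @ [two_row (i - b + (if \<epsilon> then 1 else 0)) (b + (if \<epsilon> then 0 else 1))], c)"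
    "diagram_chain i \<Lambda>" "last \<Lambda> = two_row (i - b) b" "2 * b \<le> i" "length c = n - Suc i"
    "set c \<subseteq> {1, 2}" "k = r + count_list c 1" "if \<epsilon> then b \<le> r \<and> b + r \<le> Suc i else b < r \<and> b + r \<le> i"
    using label_SucE[of "fst l'" "snd l'" n k i] l' i_ge_1 by (metis prod.collapse)
  obtain \<Lambda>' b' r' \<delta> c' where m: "m' = (\<Lambda>' @ [two_row (i - b' + (if \<delta> then 1 else 0)) (b' + (if \<delta> then 0 else 1))], c')"
    "last \<Lambda>' = two_row (i - b') b'" "2 * b' \<le> i" "k = r' + count_list c' 1"
    "if \<delta> then b' \<le> r' \<and> b' + r' \<le> Suc i else b' < r' \<and> b' + r' \<le> i"
    using label_SucE[of "fst m'" "snd m'" n k i] m' i_ge_1 by (metis prod.collapse)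
  show ?thesis
  proof (cases "\<Lambda>' = \<Lambda> \<and> c' = c")
    case True
    then have eq: "b' = b" "r' = r" using l(3,7) m(2,4) by (simp_all add: two_row_eq_iff)
    define row where "row \<epsilon> = two_row (i - b + (if \<epsilon> then 1 else 0)) (b + (if \<epsilon> then 0 else 1))" for \<epsilon>
    have rows: "l' = (\<Lambda> @ [row \<epsilon>], c)" "m' = (\<Lambda> @ [row \<delta>], c)"
      unfolding l(1) m(1) row_def using True eq by simp_all
    have "row \<epsilon> = row \<delta> \<longleftrightarrow> \<epsilon> = \<delta>" by (auto simp: row_def two_row_eq_iff)
    then have iff: "l' = m' \<longleftrightarrow> \<epsilon> = \<delta>" unfolding rows by simp
    have grows: "first_row_grows (\<Lambda> @ [row \<gamma>], c) \<longleftrightarrow> \<gamma>" for \<gamma>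
      unfolding row_def by (rule first_row_grows_snoc[OF l(3)])
    have "if \<delta> then b \<le> r \<and> b + r \<le> Suc i else b < r \<and> b + r \<le> i" using m(5) by (simp only: eq)
    from inner_new_basis_same_block[OF l(2-8) this grows grows] show ?thesis unfolding iff by (simp only: rows)
  next
    case False
    have "U (l, l') * cnj (U (l, m')) = 0" for l
    proof (rule ccontr)
      assume "U (l, l') * cnj (U (l, m')) \<noteq> 0"
      then have "U (l, l') \<noteq> 0" "U (l, m') \<noteq> 0" by auto
      then have "l = first_label l' \<or> l = second_label l'" "l = first_label m' \<or> l = second_label m'"
        using block_matrix_outside[of l l'] block_matrix_outside[of l m'] by blast+
      then show False
        using False unfolding l(1) m(1) first_label_def second_label_def by auto
    qed
    then have "inner (new_basis l') (new_basis m') = 0"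
      unfolding inner_new_basis by (intro sum.neutral ballI)
    moreover have "l' \<noteq> m'" using False unfolding l(1) m(1) by auto
    ultimately show ?thesis by simp
  qed
qed

lemma new_basis_class_sum:
  assumes \<Lambda>: "diagram_chain i \<Lambda>" "last \<Lambda> = two_row (i - b) b" "2 * b \<le> i"
  shows "class_sum i (new_basis (\<Lambda> @ [\<nu>], c)) =
    cscale (content_sum (i - b) b) (new_basis (\<Lambda> @ [\<nu>], c))"
proof -
  let ?l' = "(\<Lambda> @ [\<nu>], c)"
  have last: "\<Lambda> ! (i - 1) = two_row (i - b) b"
    using \<Lambda>(1,2) i_ge_1 by (subst (asm) last_conv_nth) (auto simp: diagram_chain_def)
  have "class_sum i (B l) = cscale (content_sum (i - b) b) (B l)"
    if "l \<in> L \<inter> {first_label ?l', second_label ?l'}" for l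
    using that B_class_sum[of \<Lambda> _ i b] last \<Lambda>(3) i_ge_1
    by (auto simp: first_label_def second_label_def)
  then show ?thesis
    unfolding new_basis_eq class_sum_sum class_sum_cscale cfun.scale_sum_right
    by (intro sum.cong refl) (simp only: cfun.scale_left_commute)
qed

lemma subspace_label_space:
  "cfun.subspace (isotypic n k j \<nu>)" "cfun.subspace (suffix_space n k q c)"
  by (simp_all only: isotypic_def suffix_space_def cfun.subspace_span)

lemma new_basis_in_subspace:
  assumes "cfun.subspace V" "\<And>l. l \<in> L \<inter> {first_label l', second_label l'} \<Longrightarrow> B l \<in> V"
  shows "new_basis l' \<in> V"
  unfolding new_basis_eq using assms by (intro cfun.subspace_sum cfun.subspace_scale) auto

text \<open>Levels up to i are inherited, since the old vectors involved share the chain. At level i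
  + 1 the eigenvalue of \<open>J\<close> is the content of the added box, so the class sum acts by
  the content sum of the new diagram and \<open>isotypic_class_sum\<close> applies.\<close>

lemma new_basis_label_space:
  assumes l': "l' \<in> labels n k (Suc i)"
  shows "new_basis l' \<in> label_space n k (Suc i) l'"
proof -
  obtain \<Lambda> b r \<epsilon> c where l: "l' = (\<Lambda> @ [two_row (i - b + (if \<epsilon> then 1 else 0)) (b + (if \<epsilon> then 0 else 1))], c)"
    "diagram_chain i \<Lambda>" "last \<Lambda> = two_row (i - b) b" "2 * b \<le> i" "length c = n - Suc i"
    "set c \<subseteq> {1, 2}" "k = r + count_list c 1" "if \<epsilon> then b \<le> r \<and> b + r \<le> Suc i else b < r \<and> b + r \<le> i"
    using label_SucE[of "fst l'" "snd l'" n k i] l' i_ge_1 by (metis prod.collapse)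
  define a where "a = b + (if \<epsilon> then 0 else 1)"
  define \<nu> where "\<nu> = two_row (i - b + (if \<epsilon> then 1 else 0)) a"
  have l'_eq: "l' = (\<Lambda> @ [\<nu>], c)" by (simp add: l(1) \<nu>_def a_def)
  have sia: "Suc i - a = i - b + (if \<epsilon> then 1 else 0)" using l(4) by (auto simp: a_def)
  have len: "length \<Lambda> = i" using l(2) by (simp add: diagram_chain_def)
  have fl: "first_label l' = (\<Lambda>, 1 # c)" "second_label l' = (\<Lambda>, 2 # c)"
    by (simp_all add: l'_eq first_label_def second_label_def)
  have B_suffix': "B m \<in> suffix_space n k (i + 2) c" if "m \<in> L \<inter> {first_label l', second_label l'}" for m
    using that suffix_space_Cons[OF B_suffix i_less] unfolding fl by blast
  have suffix: "new_basis l' \<in> suffix_space n k (i + 2) c"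
    using B_suffix' by (rule new_basis_in_subspace[OF subspace_label_space(2)])
  have grows: "first_row_grows l' \<longleftrightarrow> \<epsilon>"
    unfolding l(1) by (rule first_row_grows_snoc[OF l(3)])
  have "class_sum (Suc i) (new_basis l') = cscale (content_sum (i - b) b) (new_basis l') +
      cscale (if \<epsilon> then of_nat i - of_nat b else of_nat b - 1) (new_basis l')"
    unfolding class_sum_Suc l'_eq
    using new_basis_class_sum[OF l(2-4)] new_basis_jucys_murphy[OF l(2-8)] grows l'_eq by simp
  also have "\<dots> = cscale (content_sum (Suc i - a) a) (new_basis l')"
  proof -
    have "of_nat i - of_nat b = (of_nat (i - b) :: complex)" using l(4) by (simp add: of_nat_diff)
    then have "content_sum (Suc i - a) a =
        content_sum (i - b) b + (if \<epsilon> then of_nat i - of_nat b else of_nat b - 1)"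
      unfolding sia by (simp add: a_def content_sum_Suc)
    then show ?thesis by (simp add: cfun.scale_left_distrib)
  qed
  finally have eig: "class_sum (Suc i) (new_basis l') = cscale (content_sum (Suc i - a) a) (new_basis l')" .
  have "new_basis l' \<in> isotypic n k (Suc i) (two_row (Suc i - a) a)"
    using l(8) i_less suffix
    by (intro isotypic_class_sum[OF l(5-7) _ _ _ _ eig]) (auto simp: a_def split: if_splits)
  then have top: "new_basis l' \<in> isotypic n k (Suc i) \<nu>" by (simp only: sia \<nu>_def)
  have below: "new_basis l' \<in> isotypic n k j (\<Lambda> ! (j - 1))" if j: "j \<in> {1..i}" for j
  proof (rule new_basis_in_subspace[OF subspace_label_space(1)])
    fix m assume m: "m \<in> L \<inter> {first_label l', second_label l'}"
    then obtain c' where m_eq: "m = (\<Lambda>, c')" unfolding fl by auto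
    then have "B m \<in> chain_space n k \<Lambda>" using B_in[of m] m by auto
    then show "B m \<in> isotypic n k j (\<Lambda> ! (j - 1))" using j len unfolding chain_space_def by blast
  qed
  have "new_basis l' \<in> isotypic n k j ((\<Lambda> @ [\<nu>]) ! (j - 1))" if j: "j \<in> {1..Suc i}" for j
  proof (cases "j = Suc i")
    case True
    have "(\<Lambda> @ [\<nu>]) ! i = \<nu>" using len by (simp add: nth_append)
    then show ?thesis using top True by simp
  next
    case False
    then have "(\<Lambda> @ [\<nu>]) ! (j - 1) = \<Lambda> ! (j - 1)" "j \<in> {1..i}"
      using j len by (auto simp: nth_append)
    then show ?thesis using below by simp
  qed
  then have "new_basis l' \<in> chain_space n k (\<Lambda> @ [\<nu>])"
    using suffix_space_funs[OF suffix] len unfolding chain_space_def by auto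
  then show ?thesis unfolding l'_eq using suffix by (simp add: l'_eq)
qed

text \<open>The blocks are inverted explicitly: a combination of the two new vectors eliminates the
  first old one and leaves 2 (u + v) times the second; the first is then recovered because
  \<open>q\<close> is nonzero.\<close>

lemma span_new_basis: "cfun.span (new_basis ` labels n k (Suc i)) = funs n k"
proof
  let ?S = "cfun.span (new_basis ` labels n k (Suc i))"
  have "new_basis l' \<in> cfun.span (B ` L)" for l'
    unfolding new_basis_def by (intro cfun.span_sum cfun.span_scale cfun.span_base) auto
  then show "?S \<subseteq> funs n k"
    unfolding span_B[symmetric] by (intro cfun.span_minimal) auto
  have "B l \<in> ?S" if l: "l \<in> L" for l
  proof -
    obtain \<Lambda> c0 where l_eq: "l = (\<Lambda>, c0)" by (cases l)
    obtain b r0 where \<Lambda>: "diagram_chain i \<Lambda>" "last \<Lambda> = two_row (i - b) b" "length c0 = n - i"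
      "set c0 \<subseteq> {1, 2}" "k = r0 + count_list c0 1" "b \<le> r0" "b + r0 \<le> i"
      using labelE[OF l[unfolded l_eq] i_ge_1] by metis
    obtain x c where c0: "c0 = x # c" using \<Lambda>(3) i_less by (cases c0) auto
    \<comment> \<open>Converts the count over the first i letters into the count over the first i +
      1.\<close>
    define r where "r = (if x = 1 then Suc r0 else r0)"
    have x: "x = 1 \<or> x = 2" using \<Lambda>(4) c0 by auto
    have c: "length c = n - Suc i" "set c \<subseteq> {1, 2}" "k = r + count_list c 1" and b: "2 * b \<le> i"
      using \<Lambda> c0 x by (auto simp: r_def)
    have \<epsilon>: "if True then b \<le> r \<and> b + r \<le> Suc i else b < r \<and> b + r \<le> i"
      using \<Lambda>(6,7) by (auto simp: r_def)
    let ?l1 = "(\<Lambda>, 1 # c)" and ?l2 = "(\<Lambda>, 2 # c)"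
    define n1 where "n1 = (\<Lambda> @ [two_row (i - b + 1) b], c)"
    have n1: "n1 \<in> labels n k (Suc i)"
      unfolding n1_def using label_SucI[OF \<Lambda>(1) i_ge_1 \<Lambda>(2) b c \<epsilon>] by simp
    have fl: "first_label (\<Lambda> @ [\<nu>], c) = ?l1" "second_label (\<Lambda> @ [\<nu>], c) = ?l2" for \<nu>
      by (simp_all add: first_label_def second_label_def)
    have g1: "first_row_grows n1"
      using first_row_grows_snoc[OF \<Lambda>(2), of "i - b + 1" True c] by (simp add: n1_def)
    show ?thesis
    proof (cases "?l1 \<in> L \<and> ?l2 \<in> L")
      case False
      from block_one_dimensional[OF \<Lambda>(1,2) b c \<epsilon> False]
      obtain y where y: "L \<inter> {?l1, ?l2} = {(\<Lambda>, y # c)}" "y = 1 \<or> y = 2" by metis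
      have "new_basis n1 = B (\<Lambda>, y # c)"
        unfolding new_basis_eq n1_def fl y(1) using block_matrix_one_dimensional[OF False y(2)] by simp
      moreover have "l \<in> L \<inter> {?l1, ?l2}" using l l_eq c0 x by auto
      then have "l = (\<Lambda>, y # c)" unfolding y(1) by simp
      ultimately show ?thesis using n1 by (metis cfun.span_base imageI)
    next
      case True
      obtain u v q where uv: "u > 0" "v > 0" "r = b + u" "Suc i = u + v + 2 * b"
      and qq: "q * cnj q = of_nat (u * v)"
      and J1: "J (B ?l1) = cscale (of_nat b + of_nat u - 1) (B ?l1) + cscale (cnj q) (B ?l2)"
      and J2: "J (B ?l2) = cscale q (B ?l1) + cscale (of_nat b + of_nat v - 1) (B ?l2)"
      and U: "\<forall>\<nu> (z::real). z = (if first_row_grows (\<Lambda> @ [\<nu>], c) then real v else - real u) \<longrightarrow>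
       U (?l1, (\<Lambda> @ [\<nu>], c)) = 2 * q / of_real (sqrt (4 * (real u * real v + z ^ 2))) \<and>
       U (?l2, (\<Lambda> @ [\<nu>], c)) = 2 * of_real z / of_real (sqrt (4 * (real u * real v + z ^ 2)))"
      by (rule block_two_dimensional[OF conjunct1 conjunct2 \<Lambda>(1,2) b c, OF True True])
      define n2 where "n2 = (\<Lambda> @ [two_row (i - b) (b + 1)], c)"
      have \<delta>: "if False then b \<le> r \<and> b + r \<le> Suc i else b < r \<and> b + r \<le> i"
        using uv by simp
      have n2: "n2 \<in> labels n k (Suc i)"
        unfolding n2_def using label_SucI[OF \<Lambda>(1) i_ge_1 \<Lambda>(2) b c \<delta>] by simp
      have g2: "\<not> first_row_grows n2"
        using first_row_grows_snoc[OF \<Lambda>(2), of "i - b" False c] by (simp add: n2_def)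
      define N where "N z = (of_real (sqrt (4 * (real u * real v + z ^ 2))) :: complex)" for z :: real
      have N: "N z \<noteq> 0" for z
      proof -
        have "real u * real v + z ^ 2 > 0" using uv by (simp add: add_pos_nonneg)
        then show ?thesis by (simp add: N_def)
      qed
      have inter: "L \<inter> {?l1, ?l2} = {?l1, ?l2}" using True by auto
      have nb1: "new_basis n1 = cscale (2 * q / N v) (B ?l1) + cscale (2 * of_nat v / N v) (B ?l2)"
        using U[rule_format, of "real v" "two_row (i - b + 1) b"] g1
        unfolding new_basis_eq n1_def fl inter sum_pair by (simp add: N_def)
      have nb2: "new_basis n2 = cscale (2 * q / N (- u)) (B ?l1) + cscale (- 2 * of_nat u / N (- u)) (B ?l2)"
        using U[rule_format, of "- real u" "two_row (i - b) (b + 1)"] g2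
        unfolding new_basis_eq n2_def fl inter sum_pair by (simp add: N_def)
      have S: "new_basis n1 \<in> ?S" "new_basis n2 \<in> ?S" using n1 n2 by (simp_all add: cfun.span_base)
      have uv0: "2 * (of_nat u + of_nat v) \<noteq> (0::complex)"
        using uv by (metis add_gr_0 less_irrefl mult_eq_0_iff of_nat_add of_nat_eq_0_iff zero_neq_numeral)
      have q0: "q \<noteq> 0" using qq uv by auto
      have "cscale (N v) (new_basis n1) + cscale (- N (- u)) (new_basis n2) =
          cscale (2 * (of_nat u + of_nat v)) (B ?l2)"
        using N[of v] N[of "- u"] unfolding nb1 nb2
        by (simp add: fun_eq_iff cscale_apply field_simps)
      then have "B ?l2 = cscale (1 / (2 * (of_nat u + of_nat v)))
          (cscale (N v) (new_basis n1) + cscale (- N (- u)) (new_basis n2))"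
        by (simp only: cfun.scale_scale divide_self_if[of "2 * (of_nat u + of_nat v)"] uv0 if_False
          times_divide_eq_left mult_1_left cfun.scale_one)
      then have B2: "B ?l2 \<in> ?S"
        using S by (metis cfun.span_add cfun.span_scale)
      have "B ?l1 = cscale (1 / (2 * q)) (cscale (N v) (new_basis n1) + cscale (- 2 * of_nat v) (B ?l2))"
        using N[of v] q0 unfolding nb1 by (simp add: fun_eq_iff cscale_apply field_simps)
      then have B1: "B ?l1 \<in> ?S"
        using S B2 by (metis cfun.span_add cfun.span_scale)
      show ?thesis using B1 B2 l_eq c0 x by auto
    qed
  qed
  then show "funs n k \<subseteq> ?S"
    unfolding span_B[symmetric] by (intro cfun.span_minimal cfun.subspace_span) auto
qed

lemma intermediate_basis_new_basis: "intermediate_basis n k (Suc i) new_basis"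
  unfolding intermediate_basis_def
  using new_basis_label_space new_basis_orthonormal span_new_basis by blast

lemma change_matrix_new_basis:
  assumes "l \<in> L" "l' \<in> labels n k (Suc i)"
  shows "change_matrix n k i B (Suc i) new_basis (l, l') = U (l, l')"
proof -
  have "new_basis l' \<in> cfun.span (B ` L)"
    unfolding new_basis_def by (intro cfun.span_sum cfun.span_scale cfun.span_base) auto
  then have "change_matrix n k i B (Suc i) new_basis (l, l') = inner (new_basis l') (B l)"
    using assms representation_orthonormal[OF B_funs _ _ assms(1)] orth
    by (simp add: change_matrix_def columns_in_basis_def)
  also have "\<dots> = (\<Sum>m\<in>L. if m = l then U (m, l') else 0)"
    unfolding new_basis_def inner_sum_left inner_cscale_left
    using assms(1) by (intro sum.cong refl) (simp add: orth)
  also have "\<dots> = U (l, l')" using assms(1) finite_L by simp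
  finally show ?thesis .
qed

end

section \<open>The program\<close>

text \<open>\<open>p\<close> is the number of results already present. Factors 2 and 4 are produced
  by doubling, since 0, 1 and -1 are the only constants, and the sign of the root is fixed by the
  label when the program is written. The last two results are the entries of the column.\<close>

definition block_ops :: "nat \<Rightarrow> label \<Rightarrow> (label \<times> label) operation list" where
  "block_ops p l = (let l1 = first_label l; l2 = second_label l; m12 = Input (l1, l2) in
    [Mult_Add Neg_One (Input (l1, l1)) (Input (l2, l2)),
     Mult_Add m12 (Input (l2, l1)) Zero,
     Mult_Add (Result (p + 1)) One (Result (p + 1)),
     Mult_Add (Result (p + 2)) One (Result (p + 2)),
     Mult_Add (Result p) (Result p) (Result (p + 3)),
     Square_Root (Result (p + 4)),
     Mult_Add (if first_row_grows l then One else Neg_One) (Result (p + 5)) (Result p),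
     Mult_Add (Result (p + 6)) (Result (p + 6)) (Result (p + 3)),
     Square_Root (Result (p + 7)),
     Mult_Add m12 One m12,
     Divide (Result (p + 9)) (Result (p + 8)),
     Divide (Result (p + 6)) (Result (p + 8))])"

lemma execute_block_ops:
  assumes "length rs = p" "eigen_norm M l \<noteq> 0"
  shows "\<exists>vs. length vs = 12 \<and> execute M rs (block_ops p l) = Some (rs @ vs) \<and>
    vs ! 10 = 2 * M (first_label l, second_label l) / eigen_norm M l \<and>
    vs ! 11 = eigen_coord M l / eigen_norm M l"
proof -
  define l1 l2 where "l1 = first_label l" and "l2 = second_label l"
  define d where "d = M (l2, l2) - M (l1, l1)"
  define e where "e = M (l1, l2) * M (l2, l1)"
  define s where "s = csqrt (d ^ 2 + 4 * e)"
  define y where "y = eigen_coord M l"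
  define N where "N = eigen_norm M l"
  define vs where "vs = [d, e, 2 * e, 4 * e, d ^ 2 + 4 * e, s, y, y ^ 2 + 4 * e, N,
    2 * M (l1, l2), 2 * M (l1, l2) / N, y / N]"
  have y: "(if first_row_grows l then s else - s) + d = y"
    by (simp add: y_def eigen_coord_def Let_def s_def d_def e_def l1_def l2_def)
  have s: "csqrt (d * d + 4 * e) = s" by (simp add: s_def power2_eq_square)
  have N: "csqrt (y * y + 4 * e) = N" "N \<noteq> 0"
    using assms(2) by (simp_all add: N_def eigen_norm_def y_def e_def l1_def l2_def power2_eq_square)
  have "execute M rs (block_ops p l) = Some (rs @ vs)"
    using assms(1) y N s
    by (cases "first_row_grows l")
       (simp_all add: block_ops_def Let_def l1_def[symmetric] l2_def[symmetric] nth_append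
         d_def[symmetric] e_def[symmetric] power2_eq_square vs_def del: csqrt_eq_0)
  then show ?thesis
    by (intro exI[of _ vs]) (simp add: vs_def N_def y_def l1_def l2_def)
qed

fun program_ops :: "nat \<Rightarrow> label list \<Rightarrow> (label \<times> label) operation list" where
  "program_ops p [] = []"
| "program_ops p (l # ls) = block_ops p l @ program_ops (p + 12) ls"

lemma execute_append:
  "execute M rs xs = Some rs' \<Longrightarrow> execute M rs (xs @ ys) = execute M rs' ys"
proof (induction xs arbitrary: rs)
  case (Cons x xs)
  then show ?case by (cases x) (auto split: if_splits)
qed simp

lemma length_program_ops: "length (program_ops p ls) = 12 * length ls"
  by (induction ls arbitrary: p) (simp_all add: block_ops_def Let_def)

lemma execute_program_ops:
  assumes "length rs = p" "\<And>l. l \<in> set ls \<Longrightarrow> eigen_norm M l \<noteq> 0"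
  shows "\<exists>vs. execute M rs (program_ops p ls) = Some (rs @ vs) \<and> length vs = 12 * length ls \<and>
    (\<forall>t<length ls. vs ! (12 * t + 10) = 2 * M (first_label (ls ! t), second_label (ls ! t)) / eigen_norm M (ls ! t) \<and>
      vs ! (12 * t + 11) = eigen_coord M (ls ! t) / eigen_norm M (ls ! t))"
  using assms
proof (induction ls arbitrary: rs p)
  case (Cons l ls)
  obtain us where us: "length us = 12" "execute M rs (block_ops p l) = Some (rs @ us)"
    "us ! 10 = 2 * M (first_label l, second_label l) / eigen_norm M l"
    "us ! 11 = eigen_coord M l / eigen_norm M l"
    using execute_block_ops[OF Cons.prems(1), of M l] Cons.prems(2) by auto
  have "length (rs @ us) = p + 12" using Cons.prems(1) us(1) by simp
  from Cons.IH[OF this] obtain vs where vs: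
    "execute M (rs @ us) (program_ops (p + 12) ls) = Some (rs @ us @ vs)" "length vs = 12 * length ls"
    "\<forall>t<length ls. vs ! (12 * t + 10) = 2 * M (first_label (ls ! t), second_label (ls ! t)) / eigen_norm M (ls ! t) \<and>
      vs ! (12 * t + 11) = eigen_coord M (ls ! t) / eigen_norm M (ls ! t)"
    using Cons.prems(2) by auto
  show ?case
  proof (intro exI[of _ "us @ vs"] conjI allI impI)
    show "execute M rs (program_ops p (l # ls)) = Some (rs @ us @ vs)"
      using execute_append[OF us(2)] vs(1) by simp
    show "length (us @ vs) = 12 * length (l # ls)" using us(1) vs(2) by simp
    fix t assume t: "t < length (l # ls)"
    have "(us @ vs) ! (12 * t + 10) = 2 * M (first_label ((l # ls) ! t), second_label ((l # ls) ! t)) / eigen_norm M ((l # ls) ! t) \<and>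
      (us @ vs) ! (12 * t + 11) = eigen_coord M ((l # ls) ! t) / eigen_norm M ((l # ls) ! t)"
    proof (cases t)
      case 0
      then show ?thesis using us by (simp add: nth_append)
    next
      case (Suc t')
      then show ?thesis using vs(3) t us(1) by (simp add: nth_append add.commute)
    qed
    then show "(us @ vs) ! (12 * t + 10) = 2 * M (first_label ((l # ls) ! t), second_label ((l # ls) ! t)) / eigen_norm M ((l # ls) ! t)"
      "(us @ vs) ! (12 * t + 11) = eigen_coord M ((l # ls) ! t) / eigen_norm M ((l # ls) ! t)"
      by blast+
  qed
qed simp

text \<open>Columns of blocks of size 1 consist of constants and cost nothing; \<open>pos l'\<close>
  is the index of the group of 12 operations belonging to \<open>l'\<close>.\<close>

definition program_output ::
    "nat \<Rightarrow> nat \<Rightarrow> nat \<Rightarrow> (label \<Rightarrow> nat) \<Rightarrow> label \<times> label \<Rightarrow> (label \<times> label) operand" where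
  "program_output n k i pos = (\<lambda>(l, l').
     if two_dimensional n k i l' then
       if l = first_label l' then Result (12 * pos l' + 10)
       else if l = second_label l' then Result (12 * pos l' + 11) else Zero
     else if l = first_label l' \<or> l = second_label l' then One else Zero)"

context intermediate
begin

text \<open>With a vanishing norm the convention x / 0 = 0 would make the whole column zero,
  contradicting that \<open>new_basis l'\<close> is a unit vector. Hence the program never divides
  by zero.\<close>

lemma eigen_norm_neq_0:
  assumes "l' \<in> labels n k (Suc i)" "two_dimensional n k i l'"
  shows "eigen_norm M l' \<noteq> 0"
proof
  assume "eigen_norm M l' = 0"
  then have "U (l, l') = 0" for l using assms(2) by (simp add: block_matrix_def)
  then have "inner (new_basis l') (new_basis l') = 0" unfolding inner_new_basis by simp
  then show False using new_basis_orthonormal[OF assms(1,1)] by simp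
qed

lemma new_basis_labels: "finite (labels n k (Suc i))" "card (labels n k (Suc i)) \<le> n choose k"
proof -
  have "new_basis ` labels n k (Suc i) \<subseteq> funs n k"
    using span_new_basis cfun.span_superset by blast
  from card_labels_orthonormal(3,4)[OF this new_basis_orthonormal]
  show "finite (labels n k (Suc i))" "card (labels n k (Suc i)) \<le> n choose k" by blast+
qed

lemma computes_change_matrix:
  assumes ls: "set ls = {l' \<in> labels n k (Suc i). two_dimensional n k i l'}"
    and pos: "\<And>l'. l' \<in> set ls \<Longrightarrow> pos l' < length ls \<and> ls ! pos l' = l'"
  shows "computes (program_ops 0 ls, program_output n k i pos) M
    (L \<times> labels n k (Suc i)) (change_matrix n k i B (Suc i) new_basis)"
proof -
  obtain vs where vs: "execute M [] (program_ops 0 ls) = Some vs" "length vs = 12 * length ls"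
    "\<forall>t<length ls. vs ! (12 * t + 10) = 2 * M (first_label (ls ! t), second_label (ls ! t)) / eigen_norm M (ls ! t) \<and>
      vs ! (12 * t + 11) = eigen_coord M (ls ! t) / eigen_norm M (ls ! t)"
    using execute_program_ops[of "[]" 0 ls M] eigen_norm_neq_0 ls by auto
  have "operand_value M vs (program_output n k i pos (l, l')) = U (l, l')"
    if "l' \<in> labels n k (Suc i)" for l l'
  proof (cases "two_dimensional n k i l'")
    case True
    then have "pos l' < length ls" "ls ! pos l' = l'" using pos[of l'] ls that by auto
    then show ?thesis
      using True vs(2,3) by (auto simp: program_output_def block_matrix_def)
  qed (simp add: program_output_def block_matrix_def)
  then show ?thesis
    using vs(1) change_matrix_new_basis by auto
qed

end

theorem proposition3:
  shows "\<exists>C::real. \<forall>n k i::nat. k \<le> n \<and> 1 \<le> i \<and> i \<le> n - 1 \<longrightarrow>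
    (\<exists>P :: (label \<times> label, label \<times> label) program.
       real (operation_count P) \<le> C * real (n choose k) \<and>
       (\<forall>B. intermediate_basis n k i B \<longrightarrow>
          (\<exists>B'. intermediate_basis n k (i + 1) B' \<and>
             computes P (operator_matrix n k i B (jucys_murphy (i + 1)))
               (labels n k i \<times> labels n k (i + 1))
               (change_matrix n k i B (i + 1) B'))))"
proof (intro exI[of _ 12] allI impI)
  fix n k i :: nat assume nki: "k \<le> n \<and> 1 \<le> i \<and> i \<le> n - 1"
  show "\<exists>P :: (label \<times> label, label \<times> label) program.
       real (operation_count P) \<le> 12 * real (n choose k) \<and>
       (\<forall>B. intermediate_basis n k i B \<longrightarrow>
          (\<exists>B'. intermediate_basis n k (i + 1) B' \<and>
             computes P (operator_matrix n k i B (jucys_murphy (i + 1)))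
               (labels n k i \<times> labels n k (i + 1))
               (change_matrix n k i B (i + 1) B')))"
  proof (cases "\<exists>B. intermediate_basis n k i B")
    case False
    \<comment> \<open>If no basis exists, the claim about all bases is vacuous and the empty program
      serves.\<close>
    then show ?thesis by (intro exI[of _ "([], \<lambda>_. Zero)"]) simp
  next
    case True
    then obtain B0 where "intermediate_basis n k i B0" by blast
    \<comment> \<open>This basis supplies only the bound on the number of labels; the program is
      built from \<open>n\<close>, \<open>k\<close> and \<open>i\<close>, before the basis
      \<open>B\<close> below is given.\<close>
    then interpret B0: intermediate n k i B0 using nki by unfold_locales auto
    let ?S = "{l' \<in> labels n k (Suc i). two_dimensional n k i l'}"
    have fin: "finite ?S" using B0.new_basis_labels(1) by simp
    then obtain ls where ls: "set ls = ?S" "distinct ls" using finite_distinct_list by blast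
    have "length ls = card ?S" using ls distinct_card by metis
    also have "\<dots> \<le> card (labels n k (Suc i))"
      using B0.new_basis_labels(1) by (intro card_mono) auto
    also have "\<dots> \<le> n choose k" by (rule B0.new_basis_labels(2))
    finally have len: "length ls \<le> n choose k" .
    have "\<forall>l'\<in>set ls. \<exists>t. t < length ls \<and> ls ! t = l'" by (simp add: in_set_conv_nth)
    then obtain pos where pos: "\<forall>l'\<in>set ls. pos l' < length ls \<and> ls ! pos l' = l'"
      by (rule bchoice[THEN exE])
    let ?P = "(program_ops 0 ls, program_output n k i pos)"
    have "real (operation_count ?P) \<le> 12 * real (n choose k)"
      using len by (simp add: length_program_ops)
    moreover have "\<exists>B'. intermediate_basis n k (i + 1) B' \<and>
        computes ?P (operator_matrix n k i B (jucys_murphy (i + 1)))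
          (labels n k i \<times> labels n k (i + 1)) (change_matrix n k i B (i + 1) B')"
      if "intermediate_basis n k i B" for B
    proof -
      interpret B: intermediate n k i B using that nki by unfold_locales auto
      show ?thesis
        unfolding Suc_eq_plus1[symmetric]
        using B.intermediate_basis_new_basis B.computes_change_matrix[OF ls(1) bspec[OF pos]] by blast
    qed
    ultimately show ?thesis by blast
  qed
qed

end
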